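(* Let $\alpha \geq -1$, $p > 2$ and $C \geq 1$ be real numbers. The following statements are equivalent: (a) For every $f \in A^2_\alpha$, $$\| f \|_{A^p_{\frac{p}{2}(\alpha + 2) - 2}} \leq C \| f \|_{A^2_\alpha}.$$ (b) For every $f \in A^2_\alpha$ with $\| f \|_{A^2_\alpha} = 1$, $$|f(0)|^p + \frac{p}{2} \int_{\mathbb{D}} |f'(z)|^2 |f(z)|^{p - 2} (1 - |z|^2)^{\frac{p(\alpha + 2)}{2}} \left(\int_0^1 \frac{s^{\alpha + 1}}{1 - (1 - |z|^2) s} \, ds\right) dA(z) \leq C^p.$$ (c) There exists $M > 0$ such that for every $f \in A^2_\alpha$ with $\| f \|_{A^2_\alpha} = 1$ and $f^{(j)}(0) = 0$ for all integers $0 \leq j \leq M$, $$\frac{p}{2(\alpha + 2)} \int_{\mathbb{D}} |f'(z)|^2 |f(z)|^{p - 2} (1 - |z|^2)^{\frac{p(\alpha + 2)}{2}} \, dA(z) \leq C^p.$$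
   Context: Let $\mathbb{D}$ be the open unit disk of $\mathbb{C}$, and let $dA(z) = \frac{1}{\pi}\,dx\,dy$ be the normalized area measure on $\mathbb{D}$. For $q>0$ and $\beta>-1$, the standard weighted Bergman space $A^q_\beta$ is the set of all holomorphic functions $f$ on $\mathbb{D}$ such that $$\|f\|_{A^q_\beta} := \left( (\beta+1)\int_{\mathbb{D}} (1-|z|^2)^\beta |f(z)|^q \, dA(z)\right)^{1/q} < \infty.$$ For $\beta=-1$, by convention $A^q_{-1}$ is the Hardy space $H^q$ of holomorphic $f$ on $\mathbb{D}$ with $$\|f\|_{A^q_{-1}} := \|f\|_{H^q} := \sup_{0<r<1}\left(\frac{1}{2\pi}\int_0^{2\pi}|f(re^{it})|^q\,dt\right)^{1/q}<\infty.$$ Note that $\frac{p}{2}(\alpha+2)-2>-1$ when $p>2$ and $\alpha\ge -1$. *)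

theory Defs
  imports "HOL-Complex_Analysis.Complex_Analysis"
begin

definition disk_area :: "complex measure" where
  "disk_area = scale_measure (ennreal (1 / pi)) (restrict_space lborel (ball 0 1))"

text \<open>Real power on \<^typ>\<open>ennreal\<close>, used only for exponents \<open>a > 0\<close>; the value \<open>\<infinity>\<close> has to be
  treated separately since \<^const>\<open>enn2real\<close> sends it to \<open>0\<close>.\<close>

definition ennpowr :: "ennreal \<Rightarrow> real \<Rightarrow> ennreal" where
  "ennpowr x a = (if x = \<infinity> then \<infinity> else ennreal (enn2real x powr a))"

definition hardy_norm :: "real \<Rightarrow> (complex \<Rightarrow> complex) \<Rightarrow> ennreal" where
  "hardy_norm q f =
     (SUP r\<in>{0<..<1::real}.
        ennpowr (ennreal (1 / (2 * pi)) *
          (\<integral>\<^sup>+ t\<in>{0..2 * pi}. ennreal (cmod (f (of_real r * exp (\<i> * of_real t))) powr q) \<partial>lborel))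
        (1 / q))"

text \<open>The norms take the value \<open>\<infinity>\<close> on holomorphic functions outside the space. They are meant
  for \<open>q > 0\<close> and \<open>\<beta> \<ge> -1\<close>. Functions on the disk are represented by functions on
  \<^typ>\<open>complex\<close> whose values outside the open unit disk are irrelevant.\<close>

definition bergman_norm :: "real \<Rightarrow> real \<Rightarrow> (complex \<Rightarrow> complex) \<Rightarrow> ennreal" where
  "bergman_norm q \<beta> f =
     (if \<beta> = -1 then hardy_norm q f
      else ennpowr (ennreal (\<beta> + 1) *
             (\<integral>\<^sup>+ z. ennreal ((1 - (cmod z)\<^sup>2) powr \<beta> * cmod (f z) powr q) \<partial>disk_area))
           (1 / q))"

definition bergman_space :: "real \<Rightarrow> real \<Rightarrow> (complex \<Rightarrow> complex) set" where
  "bergman_space q \<beta> = {f. f holomorphic_on ball 0 1 \<and> bergman_norm q \<beta> f < \<infinity>}"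

end

theory Submission
  imports Defs
begin

text \<open>
  Put \<open>\<gamma> = p (\<alpha> + 2) / 2\<close>, so that \<open>A\<^sup>p\<^sub>\<gamma>\<^sub>-\<^sub>2\<close> is the target space. The function \<open>|f|\<^sup>p\<close> has
  Laplacian \<open>p\<^sup>2 |f'|\<^sup>2 |f|\<^sup>p\<^sup>-\<^sup>2\<close>. Integrating this over circles (\<open>Hardy_Stein_identity\<close>) and then
  against the radial weight gives the Littlewood--Paley formula (\<open>Littlewood_Paley\<close>)
  \<open>\<parallel>f\<parallel>\<^sup>p = |f(0)|\<^sup>p + (p\<^sup>2/2) \<integral> |f'|\<^sup>2 |f|\<^sup>p\<^sup>-\<^sup>2 k dA\<close>, where the kernel \<open>k\<close> at \<open>|z| = exp (-y)\<close> is the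
  integral of \<open>(1 - exp (-2v))\<^sup>\<gamma>\<^sup>-\<^sup>1\<close> over \<open>0 < v < y\<close>.

  The left-hand side of (b) is the right-hand side of this formula with \<open>p\<^sup>2/2 k\<close> replaced by \<open>p/2\<close> times
  \<open>(1 - |z|\<^sup>2)\<^sup>\<gamma>\<close> times the inner integral of (b). This replacement is pointwise smaller
  (\<open>kernel_le_lp_kernel\<close>), which gives (a) \<open>\<Longrightarrow>\<close> (b). The inner integral is at least \<open>1 / (\<alpha> + 2)\<close>
  (\<open>kernel_lower_bound\<close>), which gives (b) \<open>\<Longrightarrow>\<close> (c) with \<open>M = 1\<close>. At the boundary of the disk all three
  kernels are asymptotic to \<open>p / (2 (\<alpha> + 2)) (1 - |z|\<^sup>2)\<^sup>\<gamma>\<close>.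

  This agreement is the reason for (c) \<open>\<Longrightarrow>\<close> (a). Let \<open>f\<close> be a polynomial. For \<open>0 < a < 1\<close> the weighted
  composition \<open>g = (f \<circ> \<phi>) w\<close>, where \<open>\<phi>\<close> is the disk automorphism that sends \<open>a\<close> to \<open>0\<close> and \<open>w\<close> the
  power \<open>(\<alpha> + 2)/2\<close> of \<open>\<phi>'\<close>, has the same norm as \<open>f\<close> in the target space and no larger norm in
  \<open>A\<^sup>2\<^sub>\<alpha>\<close> (\<open>weighted_integral_mob_transform\<close>, \<open>bergman_norm_2_mob_transform_le\<close>). As \<open>a\<close> tends
  to \<open>1\<close>, \<open>g\<close> tends to \<open>0\<close> uniformly on compact sets; so its Taylor polynomial \<open>T\<close> of degree \<open>M\<close> is
  negligible, and (c) applies to the remainder \<open>h = g - T\<close>, whose norm in \<open>A\<^sup>2\<^sub>\<alpha>\<close> is not larger than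
  that of \<open>g\<close> by orthogonality on circles. In the Littlewood--Paley formula for \<open>h\<close>, the points near the
  boundary contribute at most \<open>1 + \<epsilon>\<close> times the left-hand side of (c), and the other points contribute
  at most twice the mean of \<open>|h|\<^sup>p\<close> over one fixed circle (\<open>Bergman_norm_upper_bound\<close>), which tends to
  \<open>0\<close>. This proves (a) for polynomials (\<open>power_norm_bound_polynomial\<close>); Taylor polynomials do not
  increase the norm of \<open>A\<^sup>2\<^sub>\<alpha>\<close>, so Fatou's lemma gives (a) for all \<open>f\<close>.

  Radial integrals use \<open>z = exp (-y + it)\<close> with \<open>y > 0\<close>: these coordinates are conformal, so the Laplacian
  keeps its form up to a factor, and \<open>1 - |z|\<^sup>2 = 1 - exp (-2y)\<close> increases with \<open>y\<close>.
\<close>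

section \<open>Holomorphic substitution in area integrals\<close>

text \<open>The change of variables theorem for several variables concerns \<open>real^n\<close>; this is the bridge from \<^typ>\<open>real^2\<close> to
  the complex plane.\<close>

lemma lborel_complex_eq_distr_real2:
  "(lborel :: complex measure) = distr (lborel :: (real^2) measure) borel (\<lambda>v. Complex (v$1) (v$2))"
proof (rule lborel_eqI)
  fix l u :: complex
  assume le: "\<And>b. b \<in> Basis \<Longrightarrow> l \<bullet> b \<le> u \<bullet> b"
  have [measurable]: "(\<lambda>v::real^2. Complex (v$1) (v$2)) \<in> borel_measurable borel"
    by (intro borel_measurable_continuous_onI) (auto simp: Complex_eq intro!: continuous_intros)
  have box_eq: "(\<lambda>v::real^2. Complex (v$1) (v$2)) -` box l u = box (vector [Re l, Im l]) (vector [Re u, Im u])"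
    by (auto simp: in_box_complex_iff mem_box_cart forall_2 vector_2)
  have Basis2: "(Basis :: (real^2) set) = {axis 1 1, axis 2 1}"
    by (auto simp: Basis_vec_def) (metis exhaust_2)+
  have le': "vector [Re l, Im l] \<bullet> b \<le> (vector [Re u, Im u] :: real^2) \<bullet> b" if "b \<in> Basis" for b
    using that le[of 1] le[of \<i>] by (auto simp: Basis2 inner_axis Basis_complex_def vector_2)
  have "emeasure (distr lborel borel (\<lambda>v::real^2. Complex (v$1) (v$2))) (box l u)
      = emeasure lborel (box (vector [Re l, Im l]) (vector [Re u, Im u] :: real^2))"
    by (subst emeasure_distr) (simp_all add: box_eq)
  also have "\<dots> = (\<Prod>b\<in>Basis. (vector [Re u, Im u] - vector [Re l, Im l] :: real^2) \<bullet> b)"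
    by (rule emeasure_lborel_box) (use le' in auto)
  also have "(\<Prod>b\<in>Basis. (vector [Re u, Im u] - vector [Re l, Im l] :: real^2) \<bullet> b)
     = (\<Prod>b\<in>Basis. (u - l) \<bullet> b)"
  proof -
    have "axis 1 1 \<noteq> (axis 2 1 :: real^2)" by (simp add: axis_eq_axis)
    then show ?thesis
      by (simp add: Basis2 Basis_complex_def inner_axis vector_2)
  qed
  finally show "emeasure (distr lborel borel (\<lambda>v::real^2. Complex (v$1) (v$2))) (box l u)
      = ennreal (\<Prod>b\<in>Basis. (u - l) \<bullet> b)" .
qed simp

lemma lborel_complex_eq_distr_prod:
  "(lborel :: complex measure) = distr (lborel \<Otimes>\<^sub>M lborel) borel (\<lambda>(x, y). Complex x y)"
proof (rule lborel_eqI)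
  fix l u :: complex
  assume le: "\<And>b. b \<in> Basis \<Longrightarrow> l \<bullet> b \<le> u \<bullet> b"
  have [measurable]: "(\<lambda>(x, y). Complex x y) \<in> borel_measurable borel"
    by (intro borel_measurable_continuous_onI) (auto simp: Complex_eq split_beta intro!: continuous_intros)
  have box_eq: "(\<lambda>(x, y). Complex x y) -` box l u = {Re l<..<Re u} \<times> {Im l<..<Im u}"
    by (auto simp: in_box_complex_iff)
  have le': "Re l \<le> Re u" "Im l \<le> Im u"
    using le[of 1] le[of \<i>] by (auto simp: Basis_complex_def)
  have "emeasure (distr (lborel \<Otimes>\<^sub>M lborel) borel (\<lambda>(x, y). Complex x y)) (box l u)
      = emeasure (lborel \<Otimes>\<^sub>M lborel) ({Re l<..<Re u} \<times> {Im l<..<Im u})"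
    by (subst emeasure_distr) (simp_all add: box_eq lborel_prod)
  also have "\<dots> = ennreal (\<Prod>b\<in>Basis. (u - l) \<bullet> b)"
    using le' by (subst lborel.emeasure_pair_measure_Times)
      (auto simp: Basis_complex_def ennreal_mult'' ennreal_mult)
  finally show "emeasure (distr (lborel \<Otimes>\<^sub>M lborel) borel (\<lambda>(x, y). Complex x y)) (box l u)
      = ennreal (\<Prod>b\<in>Basis. (u - l) \<bullet> b)" .
qed simp

text \<open>The real Jacobian of a holomorphic map is the square of the modulus of its derivative: the matrix of
  multiplication by \<open>c\<close> has rows \<open>(Re c, - Im c)\<close> and \<open>(Im c, Re c)\<close>.\<close>

lemma emeasure_holomorphic_image:
  assumes S: "open S" and g: "g holomorphic_on S" and inj: "inj_on g S"
    and A: "A \<in> sets borel" "A \<subseteq> S" and gA: "g ` A \<in> sets borel"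
  shows "emeasure lborel (g ` A) = (\<integral>\<^sup>+z. ennreal ((cmod (deriv g z))\<^sup>2) * indicator A z \<partial>lborel)"
proof -
  define P where "P = (\<lambda>v::real^2. Complex (v$1) (v$2))"
  define Q where "Q = (\<lambda>z. vector [Re z, Im z] :: real^2)"
  have PQ [simp]: "P (Q z) = z" for z by (simp add: P_def Q_def vector_2)
  have QP [simp]: "Q (P v) = v" for v by (simp add: P_def Q_def vec_eq_iff forall_2 vector_2)
  have bP: "bounded_linear P"
  proof -
    have "linear P"
      by (intro linearI) (auto simp: P_def complex_eq_iff)
    then show ?thesis by (simp add: linear_conv_bounded_linear)
  qed
  have bQ: "bounded_linear Q"
  proof -
    have "linear Q"
      by (intro linearI) (auto simp: Q_def vec_eq_iff forall_2 vector_2)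
    then show ?thesis by (simp add: linear_conv_bounded_linear)
  qed
  have mP [measurable]: "P \<in> borel_measurable borel"
    by (intro borel_measurable_continuous_onI linear_continuous_on bP)
  have mQ [measurable]: "Q \<in> borel_measurable borel"
    by (intro borel_measurable_continuous_onI linear_continuous_on bQ)
  define G where "G = (\<lambda>v. Q (g (P v)))"
  define T where "T = P -` A"
  have T: "T \<in> sets borel" using A measurable_sets[OF mP, of A] by (simp add: T_def)
  define G' where "G' = (\<lambda>v h. Q (deriv g (P v) * P h))"
  have dG: "(G has_derivative G' v) (at v within T)" if "v \<in> T" for v
  proof -
    have "P v \<in> S" using that A by (auto simp: T_def)
    then have "(g has_field_derivative deriv g (P v)) (at (P v))"
      using S g holomorphic_derivI by blast
    then have "(g has_derivative (*) (deriv g (P v))) (at (P v))"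
      by (simp add: has_field_derivative_def)
    moreover have "(P has_derivative P) (at v)" by (rule bounded_linear_imp_has_derivative[OF bP])
    ultimately have "((\<lambda>v. g (P v)) has_derivative (\<lambda>h. deriv g (P v) * P h)) (at v)"
      using has_derivative_compose by blast
    then have "(G has_derivative G' v) (at v)"
      unfolding G_def G'_def by (rule bounded_linear.has_derivative[OF bQ])
    then show ?thesis by (rule has_derivative_at_withinI)
  qed
  have injG: "inj_on G T"
  proof (rule inj_onI)
    fix v w assume "v \<in> T" "w \<in> T" "G v = G w"
    then have "g (P v) = g (P w)" unfolding G_def by (metis PQ)
    then have "P v = P w" using \<open>v \<in> T\<close> \<open>w \<in> T\<close> A inj by (auto simp: T_def inj_on_def)
    then show "v = w" by (metis QP)
  qed
  have det: "\<bar>det (matrix (G' v))\<bar> = (cmod (deriv g (P v)))\<^sup>2" for v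
    unfolding det_2 matrix_def G'_def Q_def P_def
    by (simp add: vector_2 axis_def cmod_power2) (simp add: power2_eq_square)
  have GT: "G ` T = P -` (g ` A)"
  proof -
    have "v \<in> G ` T" if "P v = g a" "a \<in> A" for v a
    proof
      show "v = G (Q a)" using that by (simp add: G_def flip: that(1))
      show "Q a \<in> T" using that by (simp add: T_def)
    qed
    then show ?thesis by (auto simp: G_def T_def)
  qed
  have GTb: "G ` T \<in> sets borel" using measurable_sets[OF mP, of "g ` A"] gA by (simp add: GT)
  have main: "(G ` T \<in> lmeasurable \<and> measure lebesgue (G ` T) = m) \<longleftrightarrow>
      ((\<lambda>v. (cmod (deriv g (P v)))\<^sup>2) has_integral m) T" for m
    using has_measure_differentiable_image[of T G G' m] T dG injG by (simp add: det)
  have md: "(\<lambda>z. (cmod (deriv g z))\<^sup>2 * indicator A z) \<in> borel_measurable borel"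
  proof -
    have "(\<lambda>z. indicator S z *\<^sub>R deriv g z) \<in> borel_measurable borel"
      using S g by (intro borel_measurable_continuous_on_indicator holomorphic_on_imp_continuous_on holomorphic_deriv) auto
    then have "(\<lambda>z. (cmod (indicator S z *\<^sub>R deriv g z))\<^sup>2 * indicator A z) \<in> borel_measurable borel"
      using A by measurable
    also have "(\<lambda>z. (cmod (indicator S z *\<^sub>R deriv g z))\<^sup>2 * indicator A z) = (\<lambda>z. (cmod (deriv g z))\<^sup>2 * indicator A z)"
      using A by (auto simp: indicator_def fun_eq_iff)
    finally show ?thesis .
  qed
  have md2: "(\<lambda>v. (cmod (deriv g (P v)))\<^sup>2 * indicator T v) \<in> borel_measurable borel"
    using measurable_compose[OF mP md] by (simp add: T_def indicator_def)
  let ?I = "\<integral>\<^sup>+v. ennreal ((cmod (deriv g (P v)))\<^sup>2) * indicator T v \<partial>lborel"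
  have eqI: "?I = (\<integral>\<^sup>+z. ennreal ((cmod (deriv g z))\<^sup>2) * indicator A z \<partial>lborel)"
  proof -
    have [measurable]: "(\<lambda>z. ennreal ((cmod (deriv g z))\<^sup>2) * indicator A z) \<in> borel_measurable borel"
      using md by (subst ennreal_indicator[symmetric], subst ennreal_mult''[symmetric]) simp_all
    have "(\<integral>\<^sup>+z. ennreal ((cmod (deriv g z))\<^sup>2) * indicator A z \<partial>lborel)
        = (\<integral>\<^sup>+v. ennreal ((cmod (deriv g (P v)))\<^sup>2) * indicator A (P v) \<partial>lborel)"
      unfolding P_def
      by (subst lborel_complex_eq_distr_real2, subst nn_integral_distr) (simp_all flip: P_def)
    then show ?thesis by (simp add: T_def indicator_def)
  qed
  have eqE: "emeasure lborel (G ` T) = emeasure lborel (g ` A)"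
  proof -
    have "emeasure lborel (g ` A) = emeasure (distr (lborel :: (real^2) measure) borel P) (g ` A)"
      by (simp add: lborel_complex_eq_distr_real2 P_def)
    also have "\<dots> = emeasure lborel (G ` T)"
      using gA by (subst emeasure_distr) (simp_all add: GT)
    finally show ?thesis ..
  qed
  \<comment> \<open>the real theorem speaks of finite measures only; if one side is infinite, it shows that so is the other\<close>
  have "emeasure lborel (G ` T) = ?I"
  proof (cases "emeasure lborel (G ` T) < \<infinity>")
    case True
    then have L: "G ` T \<in> lmeasurable" using GTb by (auto simp: fmeasurable_def)
    then have "((\<lambda>v. (cmod (deriv g (P v)))\<^sup>2) has_integral measure lebesgue (G ` T)) T"
      using main by blast
    then have "?I = ennreal (measure lebesgue (G ` T))"
      by (intro nn_integral_has_integral_lebesgue') auto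
    also have "\<dots> = emeasure lebesgue (G ` T)" using L by (simp add: emeasure_eq_measure2)
    finally show ?thesis using GTb by simp
  next
    case False
    have "?I = \<infinity>"
    proof (rule ccontr)
      assume "?I \<noteq> \<infinity>"
      then have "(\<integral>\<^sup>+v. ennreal ((cmod (deriv g (P v)))\<^sup>2 * indicator T v) \<partial>lborel) < \<infinity>"
        by (simp add: ennreal_mult' ennreal_indicator less_top)
      then obtain r where r: "r \<ge> 0" "(\<integral>\<^sup>+v. ennreal ((cmod (deriv g (P v)))\<^sup>2 * indicator T v) \<partial>lborel) = ennreal r"
        by (cases "\<integral>\<^sup>+v. ennreal ((cmod (deriv g (P v)))\<^sup>2 * indicator T v) \<partial>lborel") auto
      then have "((\<lambda>v. (cmod (deriv g (P v)))\<^sup>2 * indicator T v) has_integral r) UNIV"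
        using md2 by (intro nn_integral_has_integral) auto
      then have "((\<lambda>v. (cmod (deriv g (P v)))\<^sup>2) has_integral r) T"
        unfolding has_integral_restrict_UNIV[of T, symmetric]
        by (rule back_subst[where P = "\<lambda>f. (f has_integral r) UNIV"]) (auto simp: indicator_def)
      then have "G ` T \<in> lmeasurable" using main by blast
      moreover have e: "emeasure lebesgue (G ` T) = emeasure lborel (G ` T)" using GTb by simp
      ultimately have "emeasure lborel (G ` T) < \<infinity>"
        unfolding fmeasurable_def mem_Collect_eq e infinity_ennreal_def by blast
      then show False using False by blast
    qed
    then show ?thesis using False unfolding infinity_ennreal_def by (metis top.not_eq_extremum)
  qed
  with eqI eqE show ?thesis by simp
qed

text \<open>The measure with density \<open>|g'|\<^sup>2\<close> on \<open>S\<close> is pushed forward by \<open>g\<close> to Lebesgue measure on \<open>g ` S\<close>.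
  Two instances are used below: the exponential, for polar coordinates, and the disk automorphisms.\<close>

lemma nn_integral_holomorphic_substitution:
  assumes S: "open S" and g: "g holomorphic_on S" and inj: "inj_on g S"
    and F [measurable]: "F \<in> borel_measurable borel"
  shows "(\<integral>\<^sup>+w. F w * indicator (g ` S) w \<partial>lborel)
       = (\<integral>\<^sup>+z. F (g z) * ennreal ((cmod (deriv g z))\<^sup>2) * indicator S z \<partial>lborel)"
proof -
  \<comment> \<open>outside of the open set nothing is known about \<open>g\<close>, so a globally measurable version is needed\<close>
  define h where "h = (\<lambda>z. indicator S z *\<^sub>R g z)"
  have hS: "h z = g z" if "z \<in> S" for z using that by (simp add: h_def)
  have [measurable]: "S \<in> sets borel" using S by simp
  have gS: "open (g ` S)" using open_mapping_thm3[OF g S inj] .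
  then have [measurable]: "g ` S \<in> sets borel" by simp
  have h [measurable]: "h \<in> borel_measurable borel"
    unfolding h_def using S g
    by (intro borel_measurable_continuous_on_indicator holomorphic_on_imp_continuous_on) auto
  define d where "d = (\<lambda>z. ennreal ((cmod (indicator S z *\<^sub>R deriv g z))\<^sup>2))"
  have d [measurable]: "d \<in> borel_measurable borel"
  proof -
    have "(\<lambda>z. indicator S z *\<^sub>R deriv g z) \<in> borel_measurable borel"
      using S g by (intro borel_measurable_continuous_on_indicator holomorphic_on_imp_continuous_on holomorphic_deriv) auto
    then show ?thesis unfolding d_def by measurable
  qed
  have dS: "d z = ennreal ((cmod (deriv g z))\<^sup>2) * indicator S z" for z
    by (auto simp: d_def indicator_def)
  have eq: "distr (density lborel d) borel h = density lborel (indicator (g ` S))"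
  proof (rule measure_eqI)
    fix B assume "B \<in> sets (distr (density lborel d) borel h)"
    then have B [measurable]: "B \<in> sets borel" by simp
    define A where "A = h -` B \<inter> S"
    have Ab: "A \<in> sets borel" using measurable_sets[OF h B] by (simp add: A_def)
    have gA: "g ` A = B \<inter> g ` S" by (auto simp: A_def hS)
    have "emeasure (distr (density lborel d) borel h) B = emeasure (density lborel d) (h -` B)"
      by (simp add: emeasure_distr)
    also have "\<dots> = (\<integral>\<^sup>+z. d z * indicator (h -` B) z \<partial>lborel)"
      using measurable_sets[OF h B] by (intro emeasure_density) auto
    also have "\<dots> = (\<integral>\<^sup>+z. ennreal ((cmod (deriv g z))\<^sup>2) * indicator A z \<partial>lborel)"
      by (intro nn_integral_cong) (auto simp: dS A_def indicator_def)
    also have "\<dots> = emeasure lborel (g ` A)"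
      by (rule emeasure_holomorphic_image[symmetric, OF S g inj Ab]) (auto simp: A_def gA[unfolded A_def])
    also have "\<dots> = (\<integral>\<^sup>+z. indicator (g ` S) z * indicator B z \<partial>lborel)"
      by (simp add: gA indicator_inter_arith[symmetric] Int_commute)
    also have "\<dots> = emeasure (density lborel (indicator (g ` S))) B"
      by (subst emeasure_density) auto
    finally show "emeasure (distr (density lborel d) borel h) B = emeasure (density lborel (indicator (g ` S))) B" .
  qed simp
  have "(\<integral>\<^sup>+w. F w * indicator (g ` S) w \<partial>lborel) = (\<integral>\<^sup>+w. F w \<partial>density lborel (indicator (g ` S)))"
    by (subst nn_integral_density) (auto simp: mult.commute)
  also have "\<dots> = (\<integral>\<^sup>+w. F (h w) \<partial>density lborel d)"
    unfolding eq[symmetric] by (subst nn_integral_distr) auto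
  also have "\<dots> = (\<integral>\<^sup>+z. F (g z) * ennreal ((cmod (deriv g z))\<^sup>2) * indicator S z \<partial>lborel)"
    by (subst nn_integral_density, simp, simp, intro nn_integral_cong)
       (auto simp: dS hS indicator_def mult.commute)
  finally show ?thesis .
qed

section \<open>Polar coordinates on the disk\<close>

abbreviation polar :: "real \<Rightarrow> real \<Rightarrow> complex" where
  "polar y t \<equiv> exp (Complex (- y) t)"

definition circle_mean :: "(complex \<Rightarrow> ennreal) \<Rightarrow> real \<Rightarrow> ennreal" where
  "circle_mean F y = ennreal (1 / (2 * pi)) * (\<integral>\<^sup>+t\<in>{0..2 * pi}. F (polar y t) \<partial>lborel)"

text \<open>Up to a segment of the real axis, the exponential is a bijection from a half-strip onto the disk.\<close>

lemma exp_strip_image: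
  defines "S \<equiv> {w. Re w < 0 \<and> 0 < Im w \<and> Im w < 2 * pi}"
  shows "exp ` S \<subseteq> ball 0 1" "ball 0 1 - {z. Im z = 0} \<subseteq> exp ` S" "inj_on exp S" "open S"
proof -
  show "exp ` S \<subseteq> ball 0 1" by (auto simp: S_def norm_exp_eq_Re)
  show "ball 0 1 - {z. Im z = 0} \<subseteq> exp ` S"
  proof
    fix z :: complex assume z: "z \<in> ball 0 1 - {z. Im z = 0}"
    then have [simp]: "z \<noteq> 0" by auto
    have re: "Re (Ln z) < 0" using z by simp
    have im: "- pi < Im (Ln z)" "Im (Ln z) \<le> pi" by (auto simp: mpi_less_Im_Ln Im_Ln_le_pi)
    have ne: "Im (Ln z) \<noteq> 0" 
    proof
      assume "Im (Ln z) = 0"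
      then have "Im (exp (Ln z)) = 0" unfolding Im_exp by simp
      then show False using z by simp
    qed
    show "z \<in> exp ` S"
    proof (cases "Im (Ln z) > 0")
      case True
      then have "Ln z \<in> S" using re im pi_gt_zero by (auto simp: S_def)
      then show ?thesis by (intro image_eqI[of _ _ "Ln z"]) auto
    next
      case False
      then have "Ln z + 2 * of_real pi * \<i> \<in> S" using re im ne by (auto simp: S_def)
      then show ?thesis by (intro image_eqI[of _ _ "Ln z + 2 * of_real pi * \<i>"]) (auto simp: exp_add)
    qed
  qed
  show "inj_on exp S"
  proof (rule inj_onI)
    fix v w assume v: "v \<in> S" "w \<in> S" and eq: "exp v = exp w"
    have "\<bar>Im v - Im w\<bar> < 2 * pi" using v unfolding S_def mem_Collect_eq by linarith
    then show "v = w" using eq by (rule exp_complex_eqI)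
  qed
  show "open S" unfolding S_def
    by (intro open_Collect_conj open_Collect_less continuous_intros)
qed

lemma nn_integral_disk_area:
  assumes "F \<in> borel_measurable (restrict_space borel (ball 0 1))"
  shows "(\<integral>\<^sup>+z. F z \<partial>disk_area) = ennreal (1 / pi) * (\<integral>\<^sup>+z\<in>ball 0 1. F z \<partial>lborel)"
proof -
  have "F \<in> borel_measurable (restrict_space lborel (ball 0 1))"
    using assms by (simp cong: measurable_cong_sets sets_restrict_space_cong)
  then show ?thesis
    unfolding disk_area_def by (simp add: nn_integral_scale_measure nn_integral_restrict_space)
qed

lemma nn_integral_complex_iterated:
  assumes F [measurable]: "F \<in> borel_measurable borel"
  shows "(\<integral>\<^sup>+z. F z \<partial>(lborel :: complex measure)) = (\<integral>\<^sup>+x. \<integral>\<^sup>+y. F (Complex x y) \<partial>lborel \<partial>lborel)"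
proof -
  have C [measurable]: "(\<lambda>(x, y). Complex x y) \<in> borel_measurable (borel \<Otimes>\<^sub>M borel)"
    unfolding borel_prod
    by (intro borel_measurable_continuous_onI) (auto simp: Complex_eq split_beta intro!: continuous_intros)
  have "(\<integral>\<^sup>+z. F z \<partial>(lborel :: complex measure)) = (\<integral>\<^sup>+u. F (case u of (x, y) \<Rightarrow> Complex x y) \<partial>(lborel \<Otimes>\<^sub>M lborel))"
    by (subst lborel_complex_eq_distr_prod, rule nn_integral_distr) simp_all
  also have "\<dots> = (\<integral>\<^sup>+x. \<integral>\<^sup>+y. F (case (x, y) of (x, y) \<Rightarrow> Complex x y) \<partial>lborel \<partial>lborel)"
    by (rule lborel.nn_integral_fst[symmetric]) simp
  finally show ?thesis by simp
qed

text \<open>Holomorphic substitution by the exponential on the half-strip, then Fubini and \<open>y = - Re w\<close>. The factor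
  \<open>exp (-2y)\<close> is \<open>|exp'|\<^sup>2\<close>; the factor \<open>2\<close> comes from the normalizations \<open>1/\<pi>\<close> of the area and
  \<open>1/(2\<pi>)\<close> of the circle mean.\<close>

lemma polar_coordinates_disk:
  assumes F: "F \<in> borel_measurable (restrict_space borel (ball 0 1))"
  shows "(\<integral>\<^sup>+z. F z \<partial>disk_area) = (\<integral>\<^sup>+y\<in>{0<..}. ennreal (2 * exp (- 2 * y)) * circle_mean F y \<partial>lborel)"
proof -
  define S where "S = {w. Re w < 0 \<and> 0 < Im w \<and> Im w < 2 * pi}"
  note S = exp_strip_image[folded S_def]
  define F1 where "F1 = (\<lambda>z. F z * indicator (ball 0 1) z)"
  have [measurable]: "F1 \<in> borel_measurable borel"
    unfolding F1_def using F by (subst (asm) borel_measurable_restrict_space_iff_ennreal) auto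
  have [measurable]: "(\<lambda>(x, y). Complex x y) \<in> borel_measurable (borel \<Otimes>\<^sub>M borel)"
    unfolding borel_prod
    by (intro borel_measurable_continuous_onI) (auto simp: Complex_eq split_beta intro!: continuous_intros)
  have [measurable]: "(exp :: complex \<Rightarrow> complex) \<in> borel_measurable borel"
    by (intro borel_measurable_continuous_onI continuous_intros)
  have "negligible {z::complex. \<i> \<bullet> z = 0}" by (rule negligible_hyperplane) simp
  then have "{z::complex. \<i> \<bullet> z = 0} \<in> null_sets lebesgue" by (simp add: negligible_iff_null_sets)
  moreover have "{z::complex. \<i> \<bullet> z = 0} \<in> sets borel" 
    by (intro borel_closed closed_hyperplane)
  ultimately have "{z::complex. \<i> \<bullet> z = 0} \<in> null_sets lborel"
    by (simp add: null_sets_def)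
  then have ae: "AE z in lborel. Im (z::complex) \<noteq> 0"
    by (intro AE_I'[of "{z::complex. \<i> \<bullet> z = 0}"]) (auto simp: inner_complex_def)
  have "(\<integral>\<^sup>+z\<in>ball 0 1. F z \<partial>lborel) = (\<integral>\<^sup>+z\<in>exp ` S. F1 z \<partial>lborel)"
    using S(1,2) by (intro nn_integral_cong_AE, use ae in eventually_elim) (auto simp: F1_def indicator_def)
  also have "\<dots> = (\<integral>\<^sup>+w. F1 (exp w) * ennreal ((cmod (exp w))\<^sup>2) * indicator S w \<partial>lborel)"
    using S by (subst nn_integral_holomorphic_substitution)
      (auto intro: holomorphic_intros simp: DERIV_imp_deriv[OF DERIV_exp] simp del: norm_exp_eq_Re)
  also have "\<dots> = (\<integral>\<^sup>+x. \<integral>\<^sup>+t. F1 (exp (Complex x t)) * ennreal ((cmod (exp (Complex x t)))\<^sup>2) * indicator S (Complex x t) \<partial>lborel \<partial>lborel)"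
    using S(4) by (intro nn_integral_complex_iterated) simp
  also have "\<dots> = (\<integral>\<^sup>+x. \<integral>\<^sup>+t. F1 (exp (Complex x t)) * ennreal ((exp x)\<^sup>2) 
         * (indicator {..<0} x * indicator {0<..<2 * pi} t) \<partial>lborel \<partial>lborel)"
    by (intro nn_integral_cong) (simp add: norm_exp_eq_Re S_def indicator_def)
  also have "\<dots> = (\<integral>\<^sup>+x. ennreal (exp (2 * x)) * indicator {..<0} x * 
     (\<integral>\<^sup>+t\<in>{0..2 * pi}. F1 (exp (Complex x t)) \<partial>lborel) \<partial>lborel)"
  proof (intro nn_integral_cong)
    fix x :: real
    have e: "(exp x)\<^sup>2 = exp (2 * x)" by (simp add: exp_double)
    have "AE t in lborel. t \<noteq> 0 \<and> t \<noteq> 2 * pi" using AE_lborel_singleton by (auto intro: AE_conjI)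
    then have "(\<integral>\<^sup>+t. F1 (exp (Complex x t)) * ennreal ((exp x)\<^sup>2) 
         * (indicator {..<0} x * indicator {0<..<2 * pi} t) \<partial>lborel) = 
       (\<integral>\<^sup>+t. (ennreal (exp (2 * x)) * indicator {..<0} x) * (F1 (exp (Complex x t)) * indicator {0..2*pi} t) \<partial>lborel)"
      by (intro nn_integral_cong_AE, eventually_elim)
         (auto simp: indicator_def mult_ac e)
    also have "\<dots> = ennreal (exp (2 * x)) * indicator {..<0} x * 
       (\<integral>\<^sup>+t\<in>{0..2 * pi}. F1 (exp (Complex x t)) \<partial>lborel)"
      by (subst nn_integral_cmult) simp_all
    finally show "(\<integral>\<^sup>+t. F1 (exp (Complex x t)) * ennreal ((exp x)\<^sup>2) 
         * (indicator {..<0} x * indicator {0<..<2 * pi} t) \<partial>lborel) = \<dots>" .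
  qed
  also have "\<dots> = (\<integral>\<^sup>+y. ennreal (exp (- 2 * y)) * indicator {..<0} (- y) * 
     (\<integral>\<^sup>+t\<in>{0..2 * pi}. F1 (polar y t) \<partial>lborel) \<partial>lborel)"
    by (subst nn_integral_real_affine[where c = "-1" and t = 0]) (simp_all)
  finally have eq: "(\<integral>\<^sup>+z\<in>ball 0 1. F z \<partial>lborel) = \<dots>" .
  have "(\<integral>\<^sup>+z. F z \<partial>disk_area) = (\<integral>\<^sup>+y. ennreal (1 / pi) * (ennreal (exp (- 2 * y)) * indicator {..<0} (- y) * 
     (\<integral>\<^sup>+t\<in>{0..2 * pi}. F1 (polar y t) \<partial>lborel)) \<partial>lborel)"
    unfolding nn_integral_disk_area[OF F] eq by (subst nn_integral_cmult) simp_all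
  also have "\<dots> = (\<integral>\<^sup>+y\<in>{0<..}. ennreal (2 * exp (- 2 * y)) * circle_mean F y \<partial>lborel)"
  proof (intro nn_integral_cong)
    fix y :: real
    show "ennreal (1 / pi) * (ennreal (exp (- 2 * y)) * indicator {..<0} (- y) * 
        (\<integral>\<^sup>+t\<in>{0..2 * pi}. F1 (polar y t) \<partial>lborel)) = 
      ennreal (2 * exp (- 2 * y)) * circle_mean F y * indicator {0<..} y"
    proof (cases "y > 0")
      case True
      then have "F1 (polar y t) = F (polar y t)" for t
        by (simp add: F1_def norm_exp_eq_Re)
      moreover have "ennreal (2 * exp (- 2 * y)) * ennreal (1 / (2 * pi)) = ennreal (1 / pi) * ennreal (exp (- 2 * y))"
        by (simp flip: ennreal_mult)
      ultimately show ?thesis using True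
        by (simp add: circle_mean_def mult.assoc[symmetric])
    qed simp
  qed
  finally show ?thesis .
qed

section \<open>The Hardy--Stein identity\<close>

text \<open>At a zero of \<open>g\<close>, a function of size \<open>|g|\<^sup>r\<close> with \<open>r > 1\<close> is \<open>o(|u - x|)\<close>. This takes care of the
  zeros of \<open>f\<close> in the derivatives of \<open>|f|\<^sup>p\<close>.\<close>

lemma DERIV_zero_of_powr_bound:
  fixes g :: "real \<Rightarrow> complex" and \<phi> k :: "real \<Rightarrow> real"
  assumes g: "(g has_vector_derivative g') (at x)" and g0: "g x = 0" and r: "r > 1"
    and bd: "\<And>u. \<bar>\<phi> u\<bar> \<le> k u * cmod (g u) powr r" and k: "isCont k x"
  shows "(\<phi> has_real_derivative 0) (at x)"
proof -
  have [simp]: "\<phi> x = 0" using bd[of x] g0 by simp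
  have gc: "isCont g x" using g has_vector_derivative_continuous by blast
  define E where "E = (\<lambda>u. cmod ((1 / norm (u - x)) *\<^sub>R (g u - (g x + (u - x) *\<^sub>R g'))))"
  have E: "(E \<longlongrightarrow> 0) (at x)"
    using g unfolding has_vector_derivative_def has_derivative_within E_def
    by (intro tendsto_norm_zero) auto
  have lim: "((\<lambda>u. k u * cmod (g u) powr (r - 1) * (E u + cmod g')) \<longlongrightarrow> k x * 0 * (0 + cmod g')) (at x)"
  proof (intro tendsto_mult tendsto_add E tendsto_const)
    show "(k \<longlongrightarrow> k x) (at x)" using k by (simp add: isCont_def)
    have "((\<lambda>u. cmod (g u)) \<longlongrightarrow> 0) (at x)"
      using gc g0 by (simp add: isCont_def tendsto_norm_zero)
    moreover have "\<forall>\<^sub>F u in at x. 0 \<le> cmod (g u)" by simp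
    ultimately show "((\<lambda>u. cmod (g u) powr (r - 1)) \<longlongrightarrow> 0) (at x)"
      using tendsto_zero_powrI[of "\<lambda>u. cmod (g u)" "at x" "\<lambda>_. r - 1" "r - 1"] r by auto
  qed
  have "((\<lambda>u. (\<phi> u - \<phi> x) / (u - x)) \<longlongrightarrow> 0) (at x)"
  proof (rule Lim_null_comparison)
    show "((\<lambda>u. k u * cmod (g u) powr (r - 1) * (E u + cmod g')) \<longlongrightarrow> 0) (at x)"
      using lim by simp
    show "\<forall>\<^sub>F u in at x. norm ((\<phi> u - \<phi> x) / (u - x)) \<le> k u * cmod (g u) powr (r - 1) * (E u + cmod g')"
      unfolding eventually_at_filter
    proof (intro always_eventually allI impI)
      fix u :: real assume ux: "u \<noteq> x"
      have "g u = (u - x) *\<^sub>R g' + (g u - (g x + (u - x) *\<^sub>R g'))" using g0 by simp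
      then have "cmod (g u) \<le> \<bar>u - x\<bar> * cmod g' + cmod (g u - (g x + (u - x) *\<^sub>R g'))"
        by (metis norm_scaleR norm_triangle_ineq)
      also have "\<dots> = \<bar>u - x\<bar> * (E u + cmod g')" using ux unfolding E_def norm_scaleR by (simp add: distrib_left)
      finally have *: "cmod (g u) \<le> \<bar>u - x\<bar> * (E u + cmod g')" .
      have "cmod (g u) powr r = cmod (g u) powr (r - 1) * cmod (g u)"
        using powr_add[of "cmod (g u)" "r - 1" 1] by simp
      then have "\<bar>\<phi> u\<bar> \<le> k u * cmod (g u) powr (r - 1) * cmod (g u)"
        using bd[of u] by (simp add: mult.assoc)
      also have "\<dots> \<le> k u * cmod (g u) powr (r - 1) * (\<bar>u - x\<bar> * (E u + cmod g'))"
      proof (cases "g u = 0")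
        case False
        moreover have "0 \<le> k u * cmod (g u) powr r" using bd[of u] by linarith
        ultimately have "0 \<le> k u" by (simp add: zero_le_mult_iff)
        then show ?thesis by (intro mult_left_mono *) simp
      qed simp
      finally show "norm ((\<phi> u - \<phi> x) / (u - x)) \<le> k u * cmod (g u) powr (r - 1) * (E u + cmod g')"
        using ux by (simp add: field_simps)
    qed
  qed
  then show ?thesis by (simp add: has_field_derivative_iff)
qed

lemma DERIV_cmod_powr_nonzero:
  assumes g: "(g has_vector_derivative g') (at x)" and g0: "g x \<noteq> 0"
  shows "((\<lambda>u. cmod (g u) powr r) has_real_derivative r * cmod (g x) powr (r - 2) * Re (cnj (g x) * g')) (at x)"
proof -
  have pos: "(Re (g x))\<^sup>2 + (Im (g x))\<^sup>2 > 0" using g0 by (simp add: complex_eq_iff sum_power2_gt_zero_iff)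
  have eq: "cmod w powr s = ((Re w)\<^sup>2 + (Im w)\<^sup>2) powr (s / 2)" for w s
    unfolding cmod_def by (simp add: powr_half_sqrt[symmetric] powr_powr)
  have "((\<lambda>u. ((Re (g u))\<^sup>2 + (Im (g u))\<^sup>2) powr (r / 2)) has_real_derivative
      r / 2 * ((Re (g x))\<^sup>2 + (Im (g x))\<^sup>2) powr (r / 2 - 1) * (2 * Re (g x) * Re g' + 2 * Im (g x) * Im g')) (at x)"
    using pos by (auto intro!: derivative_eq_intros g)
  then show ?thesis
    unfolding eq by (rule DERIV_cong) (simp add: diff_divide_distrib algebra_simps)
qed

text \<open>At a zero of \<open>g\<close> the formula gives \<open>0\<close>, because \<open>0 powr r = 0\<close> for all \<open>r\<close>.\<close>

lemma DERIV_cmod_powr: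
  assumes g: "(g has_vector_derivative g') (at x)" and r: "r > 1"
  shows "((\<lambda>u. cmod (g u) powr r) has_real_derivative r * cmod (g x) powr (r - 2) * Re (cnj (g x) * g')) (at x)"
proof (cases "g x = 0")
  case True
  then show ?thesis using DERIV_zero_of_powr_bound[OF g True r, of "\<lambda>u. cmod (g u) powr r" "\<lambda>_. 1"] by simp
next
  case False
  then show ?thesis by (rule DERIV_cmod_powr_nonzero[OF g])
qed

text \<open>With \<open>h = g'\<close> and \<open>q = p - 2\<close> this is the second derivative of \<open>|g|\<^sup>p\<close> up to the factor \<open>p\<close>. The
  exponent \<open>q - 2\<close> may be negative; the convention \<open>0 powr (q - 2) = 0\<close> is the right value at zeros.\<close>

lemma DERIV_cmod_powr_inner:
  assumes g: "(g has_vector_derivative g') (at x)" and h: "(h has_vector_derivative h') (at x)" and q: "q > 0"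
  shows "((\<lambda>u. cmod (g u) powr q * Re (cnj (g u) * h u)) has_real_derivative
     q * cmod (g x) powr (q - 2) * Re (cnj (g x) * g') * Re (cnj (g x) * h x)
     + cmod (g x) powr q * (Re (cnj g' * h x) + Re (cnj (g x) * h'))) (at x)"
proof (cases "g x = 0")
  case True
  have hc: "isCont h x" using h has_vector_derivative_continuous by blast
  have "((\<lambda>u. cmod (g u) powr q * Re (cnj (g u) * h u)) has_real_derivative 0) (at x)"
  proof (rule DERIV_zero_of_powr_bound[OF g True, where r = "q + 1" and k = "\<lambda>u. cmod (h u)"])
    fix u
    have "\<bar>Re (cnj (g u) * h u)\<bar> \<le> cmod (g u) * cmod (h u)"
      using abs_Re_le_cmod[of "cnj (g u) * h u"] by (simp add: norm_mult)
    then have "\<bar>cmod (g u) powr q * Re (cnj (g u) * h u)\<bar> \<le> cmod (g u) powr q * (cmod (g u) * cmod (h u))"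
      by (simp add: abs_mult mult_left_mono)
    also have "\<dots> = cmod (h u) * cmod (g u) powr (q + 1)" by (simp add: powr_add)
    finally show "\<bar>cmod (g u) powr q * Re (cnj (g u) * h u)\<bar> \<le> cmod (h u) * cmod (g u) powr (q + 1)" .
  qed (use q hc in \<open>auto intro: continuous_intros\<close>)
  then show ?thesis using True by simp
next
  case False
  have "((\<lambda>u. Re (cnj (g u) * h u)) has_real_derivative Re (cnj g' * h x) + Re (cnj (g x) * h')) (at x)"
    by (auto intro!: derivative_eq_intros g h simp: algebra_simps)
  from DERIV_mult[OF DERIV_cmod_powr_nonzero[OF g False, of q] this]
  show ?thesis by (simp add: algebra_simps)
qed

text \<open>The term of the second derivative that contains the possibly negative power is still continuous: by
  Cauchy--Schwarz it is at most \<open>|w|\<^sup>q |v|\<^sup>2\<close>.\<close>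

lemma continuous_on_powr_inner_square:
  assumes q: "q > 0"
  shows "continuous_on UNIV (\<lambda>u :: complex \<times> complex. cmod (fst u) powr (q - 2) * (Re (cnj (fst u) * snd u))\<^sup>2)"
proof (rule continuous_at_imp_continuous_on, clarify)
  fix w v :: complex
  let ?K = "\<lambda>u :: complex \<times> complex. cmod (fst u) powr (q - 2) * (Re (cnj (fst u) * snd u))\<^sup>2"
  show "isCont ?K (w, v)"
  proof (cases "w = 0")
    case False
    then show ?thesis by (intro continuous_intros) auto
  next
    case True
    have "((\<lambda>u :: complex \<times> complex. cmod (fst u) powr q * (cmod (snd u))\<^sup>2) \<longlongrightarrow> cmod (fst (w, v)) powr q * (cmod (snd (w, v)))\<^sup>2) (at (w, v))"
      using q by (intro tendsto_intros) auto
    then have lim: "((\<lambda>u :: complex \<times> complex. cmod (fst u) powr q * (cmod (snd u))\<^sup>2) \<longlongrightarrow> 0) (at (w, v))"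
      using True by simp
    have "(?K \<longlongrightarrow> 0) (at (w, v))"
    proof (rule Lim_null_comparison[OF always_eventually lim], clarify)
      fix a b :: complex
      have "(Re (cnj a * b))\<^sup>2 \<le> (cmod a)\<^sup>2 * (cmod b)\<^sup>2"
        using abs_Re_le_cmod[of "cnj a * b"] 
        by (metis complex_mod_cnj norm_mult power2_abs power_mono abs_ge_zero power_mult_distrib)
      then have "cmod a powr (q - 2) * (Re (cnj a * b))\<^sup>2 \<le> cmod a powr (q - 2) * ((cmod a)\<^sup>2 * (cmod b)\<^sup>2)"
        by (rule mult_left_mono) simp
      also have "cmod a powr (q - 2) * ((cmod a)\<^sup>2 * (cmod b)\<^sup>2) = cmod a powr q * (cmod b)\<^sup>2"
        by (cases "a = 0") (simp_all add: powr_diff powr_numeral)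
      finally show "norm (?K (a, b)) \<le> cmod (fst (a, b)) powr q * (cmod (snd (a, b)))\<^sup>2" by simp
    qed
    then show ?thesis using True by (simp add: isCont_def)
  qed
qed

text \<open>The Henstock--Kurzweil version of the circle mean, without the factor \<open>1/(2\<pi>)\<close>; it serves for
  differentiation in \<open>y\<close>, while the measure theoretic \<open>circle_mean\<close> serves for Tonelli.\<close>

definition circle_int :: "(complex \<Rightarrow> real) \<Rightarrow> real \<Rightarrow> real" where
  "circle_int u y = integral {0..2 * pi} (\<lambda>t. u (polar y t))"

abbreviation circle_sq :: "(complex \<Rightarrow> complex) \<Rightarrow> real \<Rightarrow> real" where
  "circle_sq f \<equiv> circle_int (\<lambda>z. (cmod (f z))\<^sup>2)"

lemma continuous_on_circle:
  assumes u: "continuous_on (ball 0 1) u"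
  shows "continuous_on ({0<..} \<times> A) (\<lambda>(y, t). u (polar y t))"
proof -
  have "continuous_on ({0<..} \<times> A) (\<lambda>x. u (exp (Complex (- fst x) (snd x))))"
    by (intro continuous_on_compose2[OF u])
       (auto simp: Complex_eq norm_exp_eq_Re intro!: continuous_intros)
  then show ?thesis by (simp add: split_beta)
qed

lemma continuous_on_circle1:
  assumes u: "continuous_on (ball 0 1) u" and "y > 0"
  shows "continuous_on A (\<lambda>t. u (polar y t))"
  using assms(2) by (intro continuous_on_compose2[OF u])
       (auto simp: Complex_eq norm_exp_eq_Re intro!: continuous_intros)

lemma continuous_on_circle_int:
  assumes u: "continuous_on (ball 0 1) u"
  shows "continuous_on {0<..} (circle_int u)"
proof -
  have "continuous_on {0<..} (\<lambda>y. integral (cbox 0 (2 * pi)) (\<lambda>t. u (polar y t)))"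
    by (rule integral_continuous_on_param[OF continuous_on_circle[OF u]])
  then show ?thesis by (simp add: circle_int_def[abs_def])
qed

text \<open>As \<open>y\<close> tends to infinity the circles shrink to the origin.\<close>

lemma circle_int_tendsto:
  assumes u: "continuous_on (ball 0 1) u"
  shows "(circle_int u \<longlongrightarrow> 2 * pi * u 0) at_top"
proof (rule tendstoI)
  fix e :: real assume e: "e > 0"
  have "isCont u 0" using continuous_on_interior[OF u, of 0] by simp
  then obtain d where d: "d > 0" "\<And>z. dist z 0 < d \<Longrightarrow> dist (u z) (u 0) < e / (4 * pi)"
    unfolding continuous_at_eps_delta using e by (metis divide_pos_pos mult_pos_pos pi_gt_zero zero_less_numeral)
  have "eventually (\<lambda>y. exp (- y) < d) at_top"
    using d(1) by real_asymp
  then show "eventually (\<lambda>y. dist (circle_int u y) (2 * pi * u 0) < e) at_top"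
    using eventually_gt_at_top[of 0]
  proof eventually_elim
    case (elim y)
    have b: "dist (u (polar y t)) (u 0) \<le> e / (4 * pi)" for t
      using d(2)[of "polar y t"] elim by (simp add: norm_exp_eq_Re less_imp_le)
    have int: "(\<lambda>t. u (polar y t)) integrable_on {0..2 * pi}"
      by (intro integrable_continuous_real continuous_on_circle1 u elim)
    have "integral {0..2 * pi} (\<lambda>t. u (polar y t) - u 0) = circle_int u y - 2 * pi * u 0"
      using int by (subst integral_diff) (auto simp: circle_int_def)
    moreover have "norm (integral {0..2 * pi} (\<lambda>t. u (polar y t) - u 0)) \<le> e / (4 * pi) * (2 * pi - 0)"
      using b by (intro integral_bound) (auto simp: dist_norm intro!: continuous_intros continuous_on_circle1 u elim)
    ultimately show ?case using e by (simp add: dist_norm)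
  qed
qed

lemma circle_mean_eq_circle_int:
  assumes u: "continuous_on (ball 0 1) u" and nonneg: "\<And>z. z \<in> ball 0 1 \<Longrightarrow> u z \<ge> 0" and y: "y > 0"
  shows "circle_mean (\<lambda>z. ennreal (u z)) y = ennreal (circle_int u y / (2 * pi))" "circle_int u y \<ge> 0"
proof -
  have nn: "u (polar y t) \<ge> 0" for t
    using y by (intro nonneg) (simp add: norm_exp_eq_Re)
  have hi: "((\<lambda>t. u (polar y t)) has_integral circle_int u y) {0..2 * pi}"
    unfolding circle_int_def
    by (intro integrable_integral integrable_continuous_real continuous_on_circle1 u y)
  show ge: "circle_int u y \<ge> 0"
    by (rule has_integral_nonneg[OF hi]) (use nn in auto)
  have "(\<integral>\<^sup>+t\<in>{0..2 * pi}. ennreal (u (polar y t)) \<partial>lborel) = ennreal (circle_int u y)"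
    by (rule nn_integral_has_integral_lebesgue'[OF _ hi]) (use nn in auto)
  then show "circle_mean (\<lambda>z. ennreal (u z)) y = ennreal (circle_int u y / (2 * pi))"
    using ge by (simp add: circle_mean_def ennreal_mult'[symmetric])
qed

text \<open>The Euler operator \<open>z d/dz\<close>. On \<open>z = exp (-y + it)\<close> it equals \<open>-d/dy\<close> and \<open>-\<i> d/dt\<close>.\<close>

definition theta :: "(complex \<Rightarrow> complex) \<Rightarrow> complex \<Rightarrow> complex" where
  "theta f z = z * deriv f z"

abbreviation theta_energy :: "real \<Rightarrow> (complex \<Rightarrow> complex) \<Rightarrow> complex \<Rightarrow> real" where
  "theta_energy p f z \<equiv> (cmod (theta f z))\<^sup>2 * cmod (f z) powr (p - 2)"

lemma holomorphic_on_theta: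
  "f holomorphic_on ball 0 1 \<Longrightarrow> theta f holomorphic_on ball 0 1"
  unfolding theta_def[abs_def] by (intro holomorphic_intros) auto

lemma continuous_on_cmod_powr:
  assumes "h holomorphic_on ball 0 1" "r > 0"
  shows "continuous_on (ball 0 1) (\<lambda>z. cmod (h z) powr r)"
  using assms by (intro continuous_on_powr' continuous_intros holomorphic_on_imp_continuous_on) auto

lemma continuous_on_theta_energy:
  assumes "f holomorphic_on ball 0 1" "p > 2"
  shows "continuous_on (ball 0 1) (\<lambda>z. theta_energy p f z)"
  using assms by (intro continuous_on_cmod_powr continuous_intros holomorphic_on_imp_continuous_on holomorphic_on_theta) auto

lemma circle_curve_derivatives:
  assumes f: "f holomorphic_on ball 0 1" and y: "y > 0"
  shows "((\<lambda>y. f (polar y t)) has_vector_derivative - theta f (polar y t)) (at y)"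
    "((\<lambda>t. f (polar y t)) has_vector_derivative \<i> * theta f (polar y t)) (at t)"
proof -
  let ?z = "polar y t"
  have df: "(f has_field_derivative deriv f ?z) (at ?z)"
    using f y by (intro holomorphic_derivI[of f "ball 0 1"]) (auto simp: norm_exp_eq_Re)
  have "((\<lambda>y. exp (complex_of_real (- y) + \<i> * complex_of_real t)) has_vector_derivative - ?z) (at y)"
    unfolding Complex_eq of_real_minus
    by (intro has_vector_derivative_real_field) (auto intro!: derivative_eq_intros)
  from field_vector_diff_chain_at[OF this[folded Complex_eq] df]
  show "((\<lambda>y. f (polar y t)) has_vector_derivative - theta f ?z) (at y)"
    by (simp add: o_def theta_def)
  have "((\<lambda>t. polar y t) has_vector_derivative \<i> * ?z) (at t)"
    unfolding Complex_eq
    by (intro has_vector_derivative_real_field) (auto intro!: derivative_eq_intros)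
  from field_vector_diff_chain_at[OF this df]
  show "((\<lambda>t. f (polar y t)) has_vector_derivative \<i> * theta f ?z) (at t)"
    by (simp add: o_def theta_def mult_ac)
qed

lemma DERIV_circle_int:
  assumes u: "continuous_on (ball 0 1) u" and u': "continuous_on (ball 0 1) u'" and y: "y > 0"
    and d: "\<And>y t. y > 0 \<Longrightarrow> ((\<lambda>y. u (polar y t)) has_real_derivative u' (polar y t)) (at y)"
  shows "(circle_int u has_real_derivative circle_int u' y) (at y)"
proof -
  have "((\<lambda>y. integral (cbox 0 (2 * pi)) (\<lambda>t. u (polar y t))) has_real_derivative
      integral (cbox 0 (2 * pi)) (\<lambda>t. u' (polar y t))) (at y within {0<..})"
  proof (rule leibniz_rule_field_derivative[where f = "\<lambda>y t. u (polar y t)" and fx = "\<lambda>y t. u' (polar y t)"])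
    show "continuous_on ({0<..} \<times> cbox 0 (2 * pi)) (\<lambda>(y, t). u' (polar y t))"
      by (rule continuous_on_circle[OF u'])
    show "(\<lambda>t. u (polar y t)) integrable_on cbox 0 (2 * pi)" if "y \<in> {0<..}" for y
      using that by (intro integrable_continuous continuous_on_circle1 u) auto
  qed (use y in \<open>auto intro: has_field_derivative_at_within d\<close>)
  then show ?thesis
    using y by (simp add: circle_int_def[abs_def] at_within_open[of _ "{0<..}"])
qed

text \<open>In the coordinates \<open>(y, t)\<close> the Laplacian of \<open>|f|\<^sup>p\<close> is \<open>p\<^sup>2 |\<theta>f|\<^sup>2 |f|\<^sup>p\<^sup>-\<^sup>2\<close>, where \<open>\<theta>\<close> is the Euler
  operator. Its \<open>t\<close>-part integrates to \<open>0\<close> over the circle by periodicity, so the circle integral of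
  the Laplacian is the second \<open>y\<close>-derivative of the circle integral of \<open>|f|\<^sup>p\<close>.\<close>

theorem Hardy_Stein_derivatives:
  assumes f: "f holomorphic_on ball 0 1" and p: "p > 2" and y: "y > 0"
  shows "(circle_int (\<lambda>z. cmod (f z) powr p) has_real_derivative
           - circle_int (\<lambda>z. p * (cmod (f z) powr (p - 2) * Re (cnj (f z) * theta f z))) y) (at y)" (is ?A)
    and "(circle_int (\<lambda>z. p * (cmod (f z) powr (p - 2) * Re (cnj (f z) * theta f z))) has_real_derivative
           - (p\<^sup>2 * circle_int (\<lambda>z. theta_energy p f z) y)) (at y)" (is ?B)
proof -
  have [continuous_intros]: "continuous_on (ball 0 1) f" "continuous_on (ball 0 1) (theta f)"
    "continuous_on (ball 0 1) (theta (theta f))"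
    using f by (auto intro!: holomorphic_on_imp_continuous_on holomorphic_on_theta)
  note [continuous_intros] = continuous_on_cmod_powr[OF f]
  \<comment> \<open>the second derivatives of \<open>|f|\<^sup>p\<close> with respect to \<open>y\<close> and \<open>t\<close>\<close>
  define E1 where "E1 z = p * ((p - 2) * cmod (f z) powr (p - 2 - 2) * (Re (cnj (f z) * theta f z))\<^sup>2
      + cmod (f z) powr (p - 2) * ((cmod (theta f z))\<^sup>2 + Re (cnj (f z) * theta (theta f) z)))" for z
  define E2 where "E2 z = p * ((p - 2) * cmod (f z) powr (p - 2 - 2) * (Re (cnj (f z) * (\<i> * theta f z)))\<^sup>2
      + cmod (f z) powr (p - 2) * ((cmod (theta f z))\<^sup>2 - Re (cnj (f z) * theta (theta f) z)))" for z
  have E1c: "continuous_on (ball 0 1) E1"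
    unfolding E1_def mult.assoc using p
    by (intro continuous_intros continuous_on_compose2[OF continuous_on_powr_inner_square[of "p - 2"],
          where f = "\<lambda>z. (f z, theta f z)", unfolded fst_conv snd_conv]) auto
  have E2c: "continuous_on (ball 0 1) E2"
    unfolding E2_def mult.assoc using p
    by (intro continuous_intros continuous_on_compose2[OF continuous_on_powr_inner_square[of "p - 2"],
          where f = "\<lambda>z. (f z, \<i> * theta f z)", unfolded fst_conv snd_conv]) auto
  have E12: "E1 z + E2 z = p\<^sup>2 * (theta_energy p f z)" for z
  proof -
    have *: "(Re (cnj a * b))\<^sup>2 + (Re (cnj a * (\<i> * b)))\<^sup>2 = (cmod a)\<^sup>2 * (cmod b)\<^sup>2" for a b
      by (simp add: cmod_power2) (simp add: power2_eq_square algebra_simps)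
    have "cmod (f z) powr (p - 2 - 2) * (cmod (f z))\<^sup>2 = cmod (f z) powr (p - 2)"
      using powr_add[of "cmod (f z)" "p - 2 - 2" 2]
      by (cases "f z = 0") (simp_all add: powr_numeral)
    then have "cmod (f z) powr (p - 2 - 2) * ((Re (cnj (f z) * theta f z))\<^sup>2 + (Re (cnj (f z) * (\<i> * theta f z)))\<^sup>2)
       = cmod (f z) powr (p - 2) * (cmod (theta f z))\<^sup>2"
      unfolding * by (simp add: mult.assoc[symmetric])
    moreover have "E1 z + E2 z = p * ((p - 2) * (cmod (f z) powr (p - 2 - 2) * ((Re (cnj (f z) * theta f z))\<^sup>2 + (Re (cnj (f z) * (\<i> * theta f z)))\<^sup>2))
        + 2 * (cmod (f z) powr (p - 2) * (cmod (theta f z))\<^sup>2))"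
      unfolding E1_def E2_def by (simp only: ring_distribs mult_ac)
    ultimately show ?thesis by (simp add: algebra_simps power2_eq_square)
  qed
  show ?A
  proof -
    have "(circle_int (\<lambda>z. cmod (f z) powr p) has_real_derivative
        circle_int (\<lambda>z. - (p * (cmod (f z) powr (p - 2) * Re (cnj (f z) * theta f z)))) y) (at y)"
    proof (rule DERIV_circle_int[OF _ _ y])
      fix y t :: real assume "y > 0"
      from DERIV_cmod_powr[OF circle_curve_derivatives(1)[OF f this], of p t] p
      show "((\<lambda>y. cmod (f (polar y t)) powr p) has_real_derivative
        - (p * (cmod (f (polar y t)) powr (p - 2) * Re (cnj (f (polar y t)) * theta f (polar y t))))) (at y)"
        by (simp add: algebra_simps)
    qed (use p in \<open>auto intro!: continuous_intros\<close>)
    then show ?thesis by (simp add: circle_int_def)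
  qed
  have "(circle_int (\<lambda>z. p * (cmod (f z) powr (p - 2) * Re (cnj (f z) * theta f z))) has_real_derivative
        circle_int (\<lambda>z. - E1 z) y) (at y)"
  proof (rule DERIV_circle_int[OF _ _ y])
    fix y t :: real assume y: "y > 0"
    note d = circle_curve_derivatives(1)[OF f y, of t] circle_curve_derivatives(1)[OF holomorphic_on_theta[OF f] y, of t]
    have n: "Re (cnj (- a) * a) = - (cmod a)\<^sup>2" for a
      by (simp add: cmod_power2) (simp add: power2_eq_square)
    from DERIV_cmult[OF DERIV_cmod_powr_inner[OF d, of "p - 2"], of p] p
    show "((\<lambda>y. p * (cmod (f (polar y t)) powr (p - 2) * Re (cnj (f (polar y t)) * theta f (polar y t)))) has_real_derivative
        - E1 (polar y t)) (at y)"
      unfolding E1_def n by (simp add: algebra_simps power2_eq_square)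
  qed (use p in \<open>auto intro!: continuous_intros E1c\<close>)
  \<comment> \<open>the integrand is the \<open>t\<close>-derivative of a function with period \<open>2 \<pi>\<close>\<close>
  moreover have "circle_int E2 y = 0"
  proof -
    let ?h = "\<lambda>t. p * (cmod (f (polar y t)) powr (p - 2) * Re (cnj (f (polar y t)) * (\<i> * theta f (polar y t))))"
    have "(?h has_real_derivative E2 (polar y t)) (at t)" for t
    proof -
      note d = circle_curve_derivatives(2)[OF f y, of t] 
        has_vector_derivative_mult_right[OF circle_curve_derivatives(2)[OF holomorphic_on_theta[OF f] y, of t], of \<i>]
      have n: "Re (cnj a * a) = (cmod a)\<^sup>2" for a
        by (simp add: cmod_power2) (simp add: power2_eq_square)
      have m: "\<i> * (\<i> * a) = - a" for a by simp
      from DERIV_cmult[OF DERIV_cmod_powr_inner[OF d, of "p - 2"], of p] p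
      show ?thesis
        unfolding E2_def n m by (simp add: algebra_simps power2_eq_square norm_mult)
    qed
    then have "((\<lambda>t. E2 (polar y t)) has_integral (?h (2 * pi) - ?h 0)) {0..2 * pi}"
      by (intro fundamental_theorem_of_calculus)
         (auto simp: has_real_derivative_iff_has_vector_derivative[symmetric] intro: has_field_derivative_at_within)
    moreover have "exp (Complex (- y) (2 * pi)) = exp (Complex (- y) 0)"
      by (simp add: complex_eq_iff Re_exp Im_exp)
    ultimately show ?thesis by (simp add: circle_int_def integral_unique)
  qed
  moreover have "circle_int E1 y + circle_int E2 y = p\<^sup>2 * circle_int (\<lambda>z. theta_energy p f z) y"
    unfolding circle_int_def using y 
    by (subst integral_add[symmetric])
       (auto intro!: integrable_continuous_real continuous_on_circle1 E1c E2c simp: E12 simp del: mult_cancel_left)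
  ultimately show ?B by (simp add: circle_int_def)
qed

lemma nn_integral_FTC_atLeast_continuous:
  fixes F g :: "real \<Rightarrow> real"
  assumes c: "continuous_on {a..} g" and d: "\<And>x. a \<le> x \<Longrightarrow> (F has_real_derivative g x) (at x)"
    and nonneg: "\<And>x. a \<le> x \<Longrightarrow> 0 \<le> g x" and lim: "(F \<longlongrightarrow> T) at_top"
  shows "(\<integral>\<^sup>+x\<in>{a..}. ennreal (g x) \<partial>lborel) = ennreal (T - F a)"
proof -
  define h where "h x = indicator {a..} x *\<^sub>R g x" for x
  have m: "h \<in> borel_measurable borel"
    unfolding h_def by (rule borel_measurable_continuous_on_indicator[OF _ c]) simp
  have "(\<integral>\<^sup>+x. ennreal (h x) * indicator {a..} x \<partial>lborel) = ennreal (T - F a)"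
    by (rule nn_integral_FTC_atLeast[OF m _ _ lim]) (auto simp: h_def d nonneg)
  also have "(\<integral>\<^sup>+x. ennreal (h x) * indicator {a..} x \<partial>lborel) = (\<integral>\<^sup>+x\<in>{a..}. ennreal (g x) \<partial>lborel)"
    by (intro nn_integral_cong) (auto simp: h_def indicator_def)
  finally show ?thesis .
qed

abbreviation energy_mean :: "real \<Rightarrow> (complex \<Rightarrow> complex) \<Rightarrow> real \<Rightarrow> ennreal" where
  "energy_mean p f \<equiv> circle_mean (\<lambda>z. ennreal (theta_energy p f z))"

text \<open>The formulas for the two derivatives are integrated from \<open>y\<close> to infinity. The boundary terms at infinity
  are the values at the origin of \<open>|f|\<^sup>p\<close> and of its Euler derivative, which is \<open>0\<close>.\<close>

theorem Hardy_Stein_identity: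
  assumes f: "f holomorphic_on ball 0 1" and p: "p > 2" and y: "y > 0"
  shows "circle_mean (\<lambda>z. ennreal (cmod (f z) powr p)) y = ennreal (cmod (f 0) powr p) +
    (\<integral>\<^sup>+v\<in>{y..}. (\<integral>\<^sup>+w\<in>{v..}. ennreal (p\<^sup>2) * energy_mean p f w \<partial>lborel) \<partial>lborel)"
proof -
  have [continuous_intros]: "continuous_on (ball 0 1) f" "continuous_on (ball 0 1) (theta f)"
    using f by (auto intro!: holomorphic_on_imp_continuous_on holomorphic_on_theta)
  note [continuous_intros] = continuous_on_cmod_powr[OF f]
  let ?u = "\<lambda>z. cmod (f z) powr p" and ?g = "\<lambda>z. theta_energy p f z"
    and ?n = "\<lambda>z. p * (cmod (f z) powr (p - 2) * Re (cnj (f z) * theta f z))"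
  let ?h = "\<lambda>v. \<integral>\<^sup>+w\<in>{v..}. ennreal (p\<^sup>2) * circle_mean (\<lambda>z. ennreal (?g z)) w \<partial>lborel"
  have cu: "continuous_on (ball 0 1) ?u" and cg: "continuous_on (ball 0 1) ?g" and cn: "continuous_on (ball 0 1) ?n"
    using p by (auto intro!: continuous_intros)
  define M N G where "M y = circle_int ?u y / (2 * pi)" and "N y = circle_int ?n y / (2 * pi)"
    and "G y = circle_int ?g y / (2 * pi)" for y
  have DM: "((\<lambda>w. - M w) has_real_derivative N w) (at w)" and DN: "((\<lambda>w. - N w) has_real_derivative p\<^sup>2 * G w) (at w)"
    if "w > 0" for w
    using Hardy_Stein_derivatives[OF f p that, THEN DERIV_cdivide[where c = "2 * pi"], THEN DERIV_minus]
    by (simp_all add: M_def[abs_def] N_def[abs_def] G_def)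
  have lim: "((\<lambda>w. - N w) \<longlongrightarrow> 0) at_top" "((\<lambda>w. - M w) \<longlongrightarrow> - (cmod (f 0) powr p)) at_top"
    using circle_int_tendsto[OF cn, THEN tendsto_divide, OF tendsto_const[of "2 * pi"], THEN tendsto_minus]
      circle_int_tendsto[OF cu, THEN tendsto_divide, OF tendsto_const[of "2 * pi"], THEN tendsto_minus]
    by (simp_all add: M_def N_def theta_def)
  have cG: "continuous_on {v..} (\<lambda>w. p\<^sup>2 * G w)" and cN: "continuous_on {v..} N" if "v > 0" for v
  proof -
    have sub: "{v..} \<subseteq> {0<..}" using that by auto
    note c = continuous_on_subset[OF continuous_on_circle_int[OF cg] sub] continuous_on_subset[OF continuous_on_circle_int[OF cn] sub]
    show "continuous_on {v..} (\<lambda>w. p\<^sup>2 * G w)" "continuous_on {v..} N"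
      unfolding G_def N_def[abs_def] by (intro continuous_intros c; simp)+
  qed
  have mean: "circle_mean (\<lambda>z. ennreal (?u z)) w = ennreal (M w)" "circle_mean (\<lambda>z. ennreal (?g z)) w = ennreal (G w)" "G w \<ge> 0"
    if "w > 0" for w
    using circle_mean_eq_circle_int[OF cu _ that] circle_mean_eq_circle_int[OF cg _ that] by (simp_all add: M_def G_def)
  have N0: "N v \<ge> 0" if v: "v > 0" for v
  proof -
    have "- N v \<le> 0"
    proof (rule tendsto_lowerbound[OF lim(1)])
      have "- N v \<le> - N w" if "v \<le> w" for w
        proof (rule DERIV_nonneg_imp_nondecreasing[OF that])
        fix x assume "v \<le> x"
        then show "\<exists>d. DERIV (\<lambda>w. - N w) x :> d \<and> 0 \<le> d"
          using DN[of x] mean(3)[of x] v by (intro exI[of _ "p\<^sup>2 * G x"]) simp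
      qed
      then show "\<forall>\<^sub>F w in at_top. - N v \<le> - N w" by (auto simp: eventually_at_top_linorder)
    qed simp
    then show ?thesis by simp
  qed
  have M0: "M y \<ge> cmod (f 0) powr p"
  proof -
    have "- M y \<le> - (cmod (f 0) powr p)"
    proof (rule tendsto_lowerbound[OF lim(2)])
      have "- M y \<le> - M w" if "y \<le> w" for w
        proof (rule DERIV_nonneg_imp_nondecreasing[OF that])
        fix x assume "y \<le> x"
        then show "\<exists>d. DERIV (\<lambda>w. - M w) x :> d \<and> 0 \<le> d"
          using DM[of x] N0[of x] y by (intro exI[of _ "N x"]) simp
      qed
      then show "\<forall>\<^sub>F w in at_top. - M y \<le> - M w" by (auto simp: eventually_at_top_linorder)
    qed simp
    then show ?thesis by simp
  qed
  have inner: "?h v = ennreal (N v)" if v: "v > 0" for v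
  proof -
    have "?h v = (\<integral>\<^sup>+w\<in>{v..}. ennreal (p\<^sup>2 * G w) \<partial>lborel)"
      using v by (intro nn_integral_cong) (auto simp: indicator_def mean simp flip: ennreal_mult')
    also have "\<dots> = ennreal (0 - - N v)"
      by (rule nn_integral_FTC_atLeast_continuous[OF cG[OF v] _ _ lim(1)]) (use v DN mean(3) in auto)
    finally show ?thesis by simp
  qed
  have "(\<integral>\<^sup>+v\<in>{y..}. ?h v \<partial>lborel) = (\<integral>\<^sup>+v\<in>{y..}. ennreal (N v) \<partial>lborel)"
  proof (rule nn_integral_cong)
    fix v show "?h v * indicator {y..} v = ennreal (N v) * indicator {y..} v"
      using inner[of v] y by (cases "y \<le> v") simp_all
  qed
  also have "\<dots> = ennreal (- (cmod (f 0) powr p) - - M y)"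
    by (rule nn_integral_FTC_atLeast_continuous[OF cN[OF y] _ _ lim(2)]) (use y DM N0 in auto)
  finally show ?thesis
    using mean(1)[OF y] M0 by (simp flip: ennreal_plus)
qed

section \<open>Radial weights and the Littlewood--Paley formula\<close>

lemma circle_mean_cong:
  assumes "\<And>z. cmod z = exp (- y) \<Longrightarrow> F z = G z"
  shows "circle_mean F y = circle_mean G y"
  unfolding circle_mean_def using assms by (simp add: norm_exp_eq_Re)

lemma circle_mean_mono:
  assumes "\<And>z. cmod z = exp (- y) \<Longrightarrow> F z \<le> G z"
  shows "circle_mean F y \<le> circle_mean G y"
  unfolding circle_mean_def using assms
  by (intro mult_left_mono nn_integral_mono mult_right_mono) (simp_all add: norm_exp_eq_Re)

lemma circle_mean_cmult:
  assumes u: "continuous_on (ball 0 1) u" and y: "y > 0"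
  shows "circle_mean (\<lambda>z. ennreal (u z) * c) y = circle_mean (\<lambda>z. ennreal (u z)) y * c"
proof -
  have "(\<lambda>t. indicator {0..2 * pi} t *\<^sub>R u (polar y t)) \<in> borel_measurable borel"
    by (rule borel_measurable_continuous_on_indicator[OF _ continuous_on_circle1[OF u y]]) simp
  then have m: "(\<lambda>t. ennreal (indicator {0..2 * pi} t *\<^sub>R u (polar y t))) \<in> borel_measurable lborel"
    by simp
  have e: "ennreal (u (polar y t)) * indicator {0..2 * pi} t = ennreal (indicator {0..2 * pi} t *\<^sub>R u (polar y t))" for t
    by (simp add: indicator_def)
  have "(\<integral>\<^sup>+t\<in>{0..2 * pi}. ennreal (u (polar y t)) * c \<partial>lborel)
     = (\<integral>\<^sup>+t. ennreal (indicator {0..2 * pi} t *\<^sub>R u (polar y t)) * c \<partial>lborel)"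
    unfolding e[symmetric] by (simp add: mult_ac)
  also have "\<dots> = (\<integral>\<^sup>+t. ennreal (indicator {0..2 * pi} t *\<^sub>R u (polar y t)) \<partial>lborel) * c"
    by (rule nn_integral_multc[OF m])
  finally show ?thesis unfolding circle_mean_def e by (simp add: mult.assoc)
qed

lemma circle_mean_measurable:
  assumes u: "continuous_on (ball 0 1) u" and nonneg: "\<And>z. z \<in> ball 0 1 \<Longrightarrow> u z \<ge> 0"
  shows "(\<lambda>y. circle_mean (\<lambda>z. ennreal (u z)) y * indicator {0<..} y) \<in> borel_measurable borel"
proof -
  have "(\<lambda>y. indicator {0<..} y *\<^sub>R circle_int u y) \<in> borel_measurable borel"
    by (rule borel_measurable_continuous_on_indicator[OF _ continuous_on_circle_int[OF u]]) simp
  then have "(\<lambda>y. ennreal (indicator {0<..} y *\<^sub>R circle_int u y / (2 * pi))) \<in> borel_measurable borel"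
    by measurable
  also have "(\<lambda>y. ennreal (indicator {0<..} y *\<^sub>R circle_int u y / (2 * pi))) = (\<lambda>y. circle_mean (\<lambda>z. ennreal (u z)) y * indicator {0<..} y)"
    using circle_mean_eq_circle_int(1)[OF u nonneg] by (auto simp: indicator_def fun_eq_iff)
  finally show ?thesis .
qed

lemma borel_measurable_on_disk:
  assumes u: "continuous_on (ball 0 1) (u :: complex \<Rightarrow> real)" and \<rho> [measurable]: "\<rho> \<in> borel_measurable borel"
  shows "(\<lambda>z. ennreal (u z) * \<rho> (cmod z)) \<in> borel_measurable (restrict_space borel (ball 0 1))"
proof -
  have [measurable]: "u \<in> borel_measurable (restrict_space borel (ball 0 1))"
    by (rule borel_measurable_continuous_on_restrict[OF u])
  have [measurable]: "cmod \<in> borel_measurable (restrict_space borel (ball 0 1))"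
    by (intro measurable_restrict_space1) simp
  show ?thesis by measurable
qed

lemma nn_integral_disk_radial:
  assumes u: "continuous_on (ball 0 1) u" and \<rho> [measurable]: "\<rho> \<in> borel_measurable borel"
  shows "(\<integral>\<^sup>+z. ennreal (u z) * \<rho> (cmod z) \<partial>disk_area) = 
     (\<integral>\<^sup>+y\<in>{0<..}. ennreal (2 * exp (- 2 * y)) * \<rho> (exp (- y)) * circle_mean (\<lambda>z. ennreal (u z)) y \<partial>lborel)"
proof -
  have "(\<integral>\<^sup>+z. ennreal (u z) * \<rho> (cmod z) \<partial>disk_area) = (\<integral>\<^sup>+y\<in>{0<..}. ennreal (2 * exp (- 2 * y)) * 
    circle_mean (\<lambda>z. ennreal (u z) * \<rho> (cmod z)) y \<partial>lborel)"
    by (rule polar_coordinates_disk[OF borel_measurable_on_disk[OF u \<rho>]])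
  also have "\<dots> = (\<integral>\<^sup>+y\<in>{0<..}. ennreal (2 * exp (- 2 * y)) * \<rho> (exp (- y)) * circle_mean (\<lambda>z. ennreal (u z)) y \<partial>lborel)"
  proof (intro nn_integral_cong)
    fix y :: real
    have "circle_mean (\<lambda>z. ennreal (u z) * \<rho> (cmod z)) y = \<rho> (exp (- y)) * circle_mean (\<lambda>z. ennreal (u z)) y" if "y > 0"
      using circle_mean_cong[of y "\<lambda>z. ennreal (u z) * \<rho> (cmod z)" "\<lambda>z. ennreal (u z) * \<rho> (exp (- y))"]
      by (simp add: circle_mean_cmult[OF u that] mult.commute)
    then show "ennreal (2 * exp (- 2 * y)) * circle_mean (\<lambda>z. ennreal (u z) * \<rho> (cmod z)) y * indicator {0<..} y
       = ennreal (2 * exp (- 2 * y)) * \<rho> (exp (- y)) * circle_mean (\<lambda>z. ennreal (u z)) y * indicator {0<..} y"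
      by (cases "y > 0") (simp_all add: mult.assoc)
  qed
  finally show ?thesis .
qed

text \<open>Tonelli on the triangle \<open>y0 < y \<le> v\<close>; this is integration by parts for integrals of nonnegative
  functions.\<close>

lemma nn_integral_triangle_swap:
  fixes a b :: "real \<Rightarrow> ennreal" and y0 :: real
  assumes [measurable]: "a \<in> borel_measurable borel" "b \<in> borel_measurable borel"
  shows "(\<integral>\<^sup>+y\<in>{y0<..}. a y * (\<integral>\<^sup>+v\<in>{y..}. b v \<partial>lborel) \<partial>lborel)
    = (\<integral>\<^sup>+v\<in>{y0<..}. b v * (\<integral>\<^sup>+y\<in>{y0<..v}. a y \<partial>lborel) \<partial>lborel)"
proof -
  have [measurable]: "Measurable.pred (borel \<Otimes>\<^sub>M borel) (\<lambda>x. fst x \<le> (snd x :: real))" 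
    "Measurable.pred (borel \<Otimes>\<^sub>M borel) (\<lambda>x. y0 < (fst x :: real))"
    by measurable
  have "(\<integral>\<^sup>+y\<in>{y0<..}. a y * (\<integral>\<^sup>+v\<in>{y..}. b v \<partial>lborel) \<partial>lborel)
    = (\<integral>\<^sup>+y. \<integral>\<^sup>+v. a y * b v * of_bool (y0 < y \<and> y \<le> v) \<partial>lborel \<partial>lborel)"
  proof (intro nn_integral_cong)
    fix y :: real
    have "a y * (\<integral>\<^sup>+v\<in>{y..}. b v \<partial>lborel) * indicator {y0<..} y = (a y * indicator {y0<..} y) * (\<integral>\<^sup>+v\<in>{y..}. b v \<partial>lborel)"
      by (simp add: mult_ac)
    also have "\<dots> = (\<integral>\<^sup>+v. (a y * indicator {y0<..} y) * (b v * indicator {y..} v) \<partial>lborel)"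
      by (rule nn_integral_cmult[symmetric]) simp
    also have "\<dots> = (\<integral>\<^sup>+v. a y * b v * of_bool (y0 < y \<and> y \<le> v) \<partial>lborel)"
      by (intro nn_integral_cong) (simp add: indicator_def)
    finally show "a y * (\<integral>\<^sup>+v\<in>{y..}. b v \<partial>lborel) * indicator {y0<..} y = \<dots>" .
  qed
  also have "\<dots> = (\<integral>\<^sup>+v. \<integral>\<^sup>+y. a y * b v * of_bool (y0 < y \<and> y \<le> v) \<partial>lborel \<partial>lborel)"
    by (rule lborel_pair.Fubini'[symmetric]) (simp add: split_beta, measurable)
  also have "\<dots> = (\<integral>\<^sup>+v\<in>{y0<..}. b v * (\<integral>\<^sup>+y\<in>{y0<..v}. a y \<partial>lborel) \<partial>lborel)"
  proof (intro nn_integral_cong)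
    fix v :: real
    have "b v * (\<integral>\<^sup>+y\<in>{y0<..v}. a y \<partial>lborel) * indicator {y0<..} v = (b v * indicator {y0<..} v) * (\<integral>\<^sup>+y\<in>{y0<..v}. a y \<partial>lborel)"
      by (simp add: mult_ac)
    also have "\<dots> = (\<integral>\<^sup>+y. (b v * indicator {y0<..} v) * (a y * indicator {y0<..v} y) \<partial>lborel)"
      by (rule nn_integral_cmult[symmetric]) simp
    also have "\<dots> = (\<integral>\<^sup>+y. a y * b v * of_bool (y0 < y \<and> y \<le> v) \<partial>lborel)"
      by (intro nn_integral_cong) (auto simp: indicator_def mult_ac)
    finally show "(\<integral>\<^sup>+y. a y * b v * of_bool (y0 < y \<and> y \<le> v) \<partial>lborel) = b v * (\<integral>\<^sup>+y\<in>{y0<..v}. a y \<partial>lborel) * indicator {y0<..} v" ..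
  qed
  finally show ?thesis .
qed

text \<open>The kernel of the Littlewood--Paley formula, as a function of \<open>y = - ln |z|\<close>. With
  \<open>X = 1 - |z|\<^sup>2 = 1 - exp (-2y)\<close> it equals half of \<open>X\<^sup>\<gamma>\<close> times the integral of
  \<open>s\<^sup>\<gamma>\<^sup>-\<^sup>1 / (1 - X s)\<close> over \<open>0 < s < 1\<close>.\<close>

definition lp_kernel :: "real \<Rightarrow> real \<Rightarrow> ennreal" where
  "lp_kernel \<gamma> y = (\<integral>\<^sup>+v\<in>{0<..y}. ennreal ((1 - exp (- 2 * v)) powr (\<gamma> - 1)) \<partial>lborel)"

text \<open>The density of \<open>(\<gamma> - 1) (1 - |z|\<^sup>2)\<^sup>\<gamma>\<^sup>-\<^sup>2 dA\<close> in the variable \<open>y\<close>: a probability density on the half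
  line, with distribution function \<open>(1 - exp (-2y))\<^sup>\<gamma>\<^sup>-\<^sup>1\<close>.\<close>

definition rad_weight :: "real \<Rightarrow> real \<Rightarrow> real" where
  "rad_weight \<gamma> y = (\<gamma> - 1) * (1 - exp (- 2 * y)) powr (\<gamma> - 2) * (2 * exp (- 2 * y))"

lemma rad_weight_primitive:
  assumes "y > 0"
  shows "((\<lambda>y. (1 - exp (- 2 * y)) powr (\<gamma> - 1)) has_real_derivative rad_weight \<gamma> y) (at y)"
  unfolding rad_weight_def using assms
  by (auto intro!: derivative_eq_intros)

text \<open>For \<open>\<gamma> < 2\<close> the weight is unbounded at \<open>0\<close>, so the fundamental theorem is used in the form that
  asks for the derivative in the interior only.\<close>

lemma nn_integral_rad_weight:
  assumes \<gamma>: "\<gamma> > 1" and v: "v \<ge> 0"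
  shows "(\<integral>\<^sup>+y\<in>{0<..v}. ennreal (rad_weight \<gamma> y) \<partial>lborel) = ennreal ((1 - exp (- 2 * v)) powr (\<gamma> - 1))"
proof -
  have "(rad_weight \<gamma> has_integral (1 - exp (- 2 * v)) powr (\<gamma> - 1) - (1 - exp (- 2 * 0)) powr (\<gamma> - 1)) {0..v}"
  proof (rule fundamental_theorem_of_calculus_interior[OF v])
    show "continuous_on {0..v} (\<lambda>y. (1 - exp (- 2 * y)) powr (\<gamma> - 1))"
      using \<gamma> by (intro continuous_on_powr' continuous_intros) auto
    show "((\<lambda>y. (1 - exp (- 2 * y)) powr (\<gamma> - 1)) has_vector_derivative rad_weight \<gamma> x) (at x)" if "x \<in> {0<..<v}" for x
      using rad_weight_primitive[of x \<gamma>] that by (simp add: has_real_derivative_iff_has_vector_derivative)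
  qed
  then have "(\<integral>\<^sup>+y\<in>{0..v}. ennreal (rad_weight \<gamma> y) \<partial>lborel) = ennreal ((1 - exp (- 2 * v)) powr (\<gamma> - 1))"
    using nn_integral_has_integral_lebesgue'[of "{0..v}" "rad_weight \<gamma>"] \<gamma>
    by (simp add: rad_weight_def)
  moreover have "(\<integral>\<^sup>+y\<in>{0<..v}. ennreal (rad_weight \<gamma> y) \<partial>lborel) = (\<integral>\<^sup>+y\<in>{0..v}. ennreal (rad_weight \<gamma> y) \<partial>lborel)"
    by (intro nn_integral_cong_AE, use AE_lborel_singleton[of 0] in eventually_elim) (auto simp: indicator_def)
  ultimately show ?thesis by simp
qed

lemma nn_integral_rad_weight_total:
  assumes \<gamma>: "\<gamma> > 1"
  shows "(\<integral>\<^sup>+y\<in>{0<..}. ennreal (rad_weight \<gamma> y) \<partial>lborel) = 1"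
proof -
  have [measurable]: "rad_weight \<gamma> \<in> borel_measurable borel" unfolding rad_weight_def[abs_def] by measurable
  have "(\<integral>\<^sup>+y\<in>{0<..}. ennreal (rad_weight \<gamma> y) \<partial>lborel) = (SUP n::nat. \<integral>\<^sup>+y\<in>{0<..real n}. ennreal (rad_weight \<gamma> y) \<partial>lborel)"
  proof (subst nn_integral_monotone_convergence_SUP[symmetric])
    show "incseq (\<lambda>n y. ennreal (rad_weight \<gamma> y) * indicator {0<..real n} y)"
      by (auto simp: incseq_def le_fun_def indicator_def)
    show "(\<integral>\<^sup>+y\<in>{0<..}. ennreal (rad_weight \<gamma> y) \<partial>lborel) = (\<integral>\<^sup>+y. (SUP n::nat. ennreal (rad_weight \<gamma> y) * indicator {0<..real n} y) \<partial>lborel)"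
    proof (intro nn_integral_cong antisym)
      fix y :: real
      obtain n :: nat where "y \<le> real n" using real_arch_simple by blast
      then have "ennreal (rad_weight \<gamma> y) * indicator {0<..} y = ennreal (rad_weight \<gamma> y) * indicator {0<..real n} y"
        by (auto simp: indicator_def)
      also have "\<dots> \<le> (SUP n::nat. ennreal (rad_weight \<gamma> y) * indicator {0<..real n} y)" by (rule SUP_upper) simp
      finally show "ennreal (rad_weight \<gamma> y) * indicator {0<..} y \<le> (SUP n::nat. ennreal (rad_weight \<gamma> y) * indicator {0<..real n} y)" .
      show "(SUP n::nat. ennreal (rad_weight \<gamma> y) * indicator {0<..real n} y) \<le> ennreal (rad_weight \<gamma> y) * indicator {0<..} y"
        by (intro SUP_least) (auto simp: indicator_def)
    qed
  qed simp
  also have "\<dots> = (SUP n::nat. ennreal ((1 - exp (- 2 * real n)) powr (\<gamma> - 1)))"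
    using \<gamma> by (intro SUP_cong refl nn_integral_rad_weight) auto
  also have "\<dots> = 1"
  proof (rule LIMSEQ_unique[OF LIMSEQ_SUP])
    show "incseq (\<lambda>n. ennreal ((1 - exp (- 2 * real n)) powr (\<gamma> - 1)))"
      using \<gamma> by (auto simp: incseq_def intro!: ennreal_leI powr_mono2)
    have "(\<lambda>n. (1 - exp (- 2 * real n)) powr (\<gamma> - 1)) \<longlonglongrightarrow> (1 - 0) powr (\<gamma> - 1)"
      by (intro tendsto_intros) (real_asymp | simp)+
    then have "(\<lambda>n. ennreal ((1 - exp (- 2 * real n)) powr (\<gamma> - 1))) \<longlonglongrightarrow> ennreal 1"
      by (intro tendsto_ennrealI) simp
    then show "(\<lambda>n. ennreal ((1 - exp (- 2 * real n)) powr (\<gamma> - 1))) \<longlonglongrightarrow> 1" by simp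
  qed
  finally show ?thesis .
qed

text \<open>For \<open>\<gamma> > 1\<close> the \<open>p\<close>-th power of the norm of \<open>A\<^sup>p\<^sub>\<gamma>\<^sub>-\<^sub>2\<close>.\<close>

definition bergman_pow :: "real \<Rightarrow> real \<Rightarrow> (complex \<Rightarrow> complex) \<Rightarrow> ennreal" where
  "bergman_pow p \<gamma> f = ennreal (\<gamma> - 1) * (\<integral>\<^sup>+z. ennreal ((1 - (cmod z)\<^sup>2) powr (\<gamma> - 2) * cmod (f z) powr p) \<partial>disk_area)"

text \<open>For \<open>\<gamma> = p (\<alpha> + 2) / 2\<close> the integral in (c).\<close>

definition deriv_energy :: "real \<Rightarrow> real \<Rightarrow> (complex \<Rightarrow> complex) \<Rightarrow> ennreal" where
  "deriv_energy p \<gamma> f = (\<integral>\<^sup>+ z. ennreal ((cmod (deriv f z))\<^sup>2 * cmod (f z) powr (p - 2) * (1 - (cmod z)\<^sup>2) powr \<gamma>) \<partial>disk_area)"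

text \<open>The norm is the integral of the circle means of \<open>|f|\<^sup>p\<close> against \<open>rad_weight\<close>. Inserting the
  Hardy--Stein identity and exchanging integrals twice moves the weight to the innermost integrand:
  first \<open>rad_weight\<close> is integrated to its distribution function, then that to \<open>lp_kernel\<close>.\<close>

theorem Littlewood_Paley:
  assumes f: "f holomorphic_on ball 0 1" and p: "p > 2" and \<gamma>: "\<gamma> > 1"
  shows "bergman_pow p \<gamma> f
     = ennreal (cmod (f 0) powr p) + 
       (\<integral>\<^sup>+w\<in>{0<..}. ennreal (p\<^sup>2) * lp_kernel \<gamma> w * energy_mean p f w \<partial>lborel)"
proof -
  let ?u = "\<lambda>z. cmod (f z) powr p" and ?g = "\<lambda>z. theta_energy p f z"
  let ?c = "ennreal (cmod (f 0) powr p)"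
  have cu: "continuous_on (ball 0 1) ?u" and cg: "continuous_on (ball 0 1) ?g"
    using p f by (auto intro!: continuous_on_cmod_powr continuous_on_theta_energy)
  \<comment> \<open>cut off at \<open>0\<close>, since circle means are known to be measurable for positive arguments only\<close>
  define b where "b = (\<lambda>w. ennreal (p\<^sup>2) * (circle_mean (\<lambda>z. ennreal (?g z)) w * indicator {0<..} w))"
  let ?J = "\<lambda>v. \<integral>\<^sup>+w\<in>{v..}. b w \<partial>lborel"
  let ?I = "\<lambda>y. \<integral>\<^sup>+v\<in>{y..}. ?J v \<partial>lborel"
  have [measurable]: "b \<in> borel_measurable borel"
    unfolding b_def using circle_mean_measurable[OF cg] by simp
  have b: "(\<integral>\<^sup>+w\<in>{v..}. ennreal (p\<^sup>2) * circle_mean (\<lambda>z. ennreal (?g z)) w \<partial>lborel) = ?J v" if "v > 0" for v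
    using that by (intro nn_integral_cong) (auto simp: b_def indicator_def)
  have [measurable]: "rad_weight \<gamma> \<in> borel_measurable borel" unfolding rad_weight_def[abs_def] by measurable
  have [measurable]: "?J \<in> borel_measurable borel"
  proof -
    have "(\<lambda>x. b (snd x) * indicator {fst x..} (snd x)) = (\<lambda>x. b (snd x) * of_bool (fst x \<le> snd x))"
      by (auto simp: indicator_def)
    then have "(\<lambda>x. b (snd x) * indicator {fst x..} (snd x)) \<in> borel_measurable (borel \<Otimes>\<^sub>M lborel)" by simp
    then show ?thesis using lborel.borel_measurable_nn_integral_fst by fastforce
  qed
  have "bergman_pow p \<gamma> f
    = ennreal (\<gamma> - 1) * (\<integral>\<^sup>+z. ennreal (?u z) * ennreal ((1 - (cmod z)\<^sup>2) powr (\<gamma> - 2)) \<partial>disk_area)"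
    by (simp add: bergman_pow_def ennreal_mult mult.commute)
  also have "\<dots> = ennreal (\<gamma> - 1) * (\<integral>\<^sup>+y\<in>{0<..}. ennreal (2 * exp (- 2 * y)) * ennreal ((1 - (exp (- y))\<^sup>2) powr (\<gamma> - 2)) * circle_mean (\<lambda>z. ennreal (?u z)) y \<partial>lborel)"
    by (subst nn_integral_disk_radial[OF cu]) simp_all
  also have "\<dots> = (\<integral>\<^sup>+y. ennreal (\<gamma> - 1) * (ennreal (2 * exp (- 2 * y)) * ennreal ((1 - (exp (- y))\<^sup>2) powr (\<gamma> - 2)) * (circle_mean (\<lambda>z. ennreal (?u z)) y * indicator {0<..} y)) \<partial>lborel)"
    using circle_mean_measurable[OF cu] by (subst nn_integral_cmult) (simp_all add: mult.assoc)
  also have "\<dots> = (\<integral>\<^sup>+y. ennreal (rad_weight \<gamma> y) * indicator {0<..} y * ?c + ennreal (rad_weight \<gamma> y) * ?I y * indicator {0<..} y \<partial>lborel)"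
  proof (intro nn_integral_cong)
    fix y :: real
    show "ennreal (\<gamma> - 1) * (ennreal (2 * exp (- 2 * y)) * ennreal ((1 - (exp (- y))\<^sup>2) powr (\<gamma> - 2)) * (circle_mean (\<lambda>z. ennreal (?u z)) y * indicator {0<..} y))
      = ennreal (rad_weight \<gamma> y) * indicator {0<..} y * ?c + ennreal (rad_weight \<gamma> y) * ?I y * indicator {0<..} y"
    proof (cases "y > 0")
      case True
      have "(\<integral>\<^sup>+v\<in>{y..}. (\<integral>\<^sup>+w\<in>{v..}. ennreal (p\<^sup>2) * circle_mean (\<lambda>z. ennreal (?g z)) w \<partial>lborel) \<partial>lborel)
         = ?I y"
      proof (rule nn_integral_cong)
        fix v show "(\<integral>\<^sup>+w\<in>{v..}. ennreal (p\<^sup>2) * circle_mean (\<lambda>z. ennreal (?g z)) w \<partial>lborel) * indicator {y..} v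
          = ?J v * indicator {y..} v"
          using True b[of v] by (cases "y \<le> v") simp_all
      qed
      with Hardy_Stein_identity[OF f p True]
      have "circle_mean (\<lambda>z. ennreal (?u z)) y = ?c + ?I y" by simp
      moreover have "ennreal (\<gamma> - 1) * (ennreal (2 * exp (- 2 * y)) * ennreal ((1 - (exp (- y))\<^sup>2) powr (\<gamma> - 2))) = ennreal (rad_weight \<gamma> y)"
      proof -
        have "(exp (- y))\<^sup>2 = exp (- 2 * y)" by (simp add: power2_eq_square flip: exp_add)
        then show ?thesis using \<gamma>
          by (simp add: rad_weight_def mult_ac flip: ennreal_mult)
      qed
      ultimately show ?thesis using True
        by (simp add: mult.assoc[symmetric]) (simp add: distrib_left)
    qed simp
  qed
  also have "\<dots> = ?c + (\<integral>\<^sup>+y\<in>{0<..}. ennreal (rad_weight \<gamma> y) * ?I y \<partial>lborel)"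
  proof (subst nn_integral_add)
    have [measurable]: "?I \<in> borel_measurable borel"
    proof -
      have "(\<lambda>x. ?J (snd x) * indicator {fst x..} (snd x)) = (\<lambda>x. ?J (snd x) * of_bool (fst x \<le> snd x))"
        by (auto simp: indicator_def)
      moreover have "(\<lambda>x. ?J (snd x)) \<in> borel_measurable (borel \<Otimes>\<^sub>M (lborel :: real measure))"
        by (rule measurable_compose[OF measurable_snd]) simp
      ultimately have "(\<lambda>x. ?J (snd x) * indicator {fst x..} (snd x)) \<in> borel_measurable (borel \<Otimes>\<^sub>M lborel)" by simp
      then show ?thesis using lborel.borel_measurable_nn_integral_fst by fastforce
    qed
    show "(\<lambda>y. ennreal (rad_weight \<gamma> y) * ?I y * indicator {0<..} y) \<in> borel_measurable lborel"
      by simp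
    show "(\<integral>\<^sup>+y. ennreal (rad_weight \<gamma> y) * indicator {0<..} y * ?c \<partial>lborel) + (\<integral>\<^sup>+y\<in>{0<..}. ennreal (rad_weight \<gamma> y) * ?I y \<partial>lborel)
     = ?c + (\<integral>\<^sup>+y\<in>{0<..}. ennreal (rad_weight \<gamma> y) * ?I y \<partial>lborel)"
      by (subst nn_integral_multc) (simp_all add: nn_integral_rad_weight_total[OF \<gamma>])
  qed simp
  also have "(\<integral>\<^sup>+y\<in>{0<..}. ennreal (rad_weight \<gamma> y) * ?I y \<partial>lborel)
     = (\<integral>\<^sup>+v\<in>{0<..}. ?J v * (\<integral>\<^sup>+y\<in>{0<..v}. ennreal (rad_weight \<gamma> y) \<partial>lborel) \<partial>lborel)"
    by (rule nn_integral_triangle_swap) simp_all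
  also have "\<dots> = (\<integral>\<^sup>+v\<in>{0<..}. ennreal ((1 - exp (- 2 * v)) powr (\<gamma> - 1)) * ?J v \<partial>lborel)"
  proof (intro nn_integral_cong)
    fix v :: real
    show "?J v * (\<integral>\<^sup>+y\<in>{0<..v}. ennreal (rad_weight \<gamma> y) \<partial>lborel) * indicator {0<..} v
       = ennreal ((1 - exp (- 2 * v)) powr (\<gamma> - 1)) * ?J v * indicator {0<..} v"
      by (cases "v > 0") (simp_all add: nn_integral_rad_weight[OF \<gamma>] mult.commute)
  qed
  also have "\<dots> = (\<integral>\<^sup>+w\<in>{0<..}. b w * lp_kernel \<gamma> w \<partial>lborel)"
    unfolding lp_kernel_def by (rule nn_integral_triangle_swap) simp_all
  also have "\<dots> = (\<integral>\<^sup>+w\<in>{0<..}. ennreal (p\<^sup>2) * lp_kernel \<gamma> w * circle_mean (\<lambda>z. ennreal (?g z)) w \<partial>lborel)"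
    by (intro nn_integral_cong) (auto simp: b_def indicator_def mult_ac)
  finally show ?thesis .
qed

section \<open>Estimates for the kernels\<close>

lemma lp_kernel_le_self:
  assumes "\<gamma> > 1" "y \<ge> 0"
  shows "lp_kernel \<gamma> y \<le> ennreal y"
proof -
  have "lp_kernel \<gamma> y \<le> (\<integral>\<^sup>+v. indicator {0<..y} v \<partial>lborel)"
    unfolding lp_kernel_def using assms
    by (intro nn_integral_mono) (auto simp: indicator_def powr_le1)
  also have "\<dots> = ennreal y" using assms by simp
  finally show ?thesis .
qed

text \<open>Compare the integrand with the derivative of \<open>(1 - exp (-2v))\<^sup>\<gamma>\<close>, which contains the additional factor
  \<open>2 \<gamma> exp (-2v)\<close>. The bound is sharp to first order as \<open>y\<close> tends to \<open>0\<close>.\<close>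

lemma lp_kernel_le_near_boundary:
  assumes \<gamma>: "\<gamma> > 1" and y: "y \<ge> 0"
  shows "lp_kernel \<gamma> y \<le> ennreal (exp (2 * y) / (2 * \<gamma>) * (1 - exp (- 2 * y)) powr \<gamma>)"
proof -
  have [measurable]: "rad_weight r \<in> borel_measurable borel" for r unfolding rad_weight_def[abs_def] by measurable
  have "lp_kernel \<gamma> y \<le> (\<integral>\<^sup>+v. ennreal (exp (2 * y) / (2 * \<gamma>)) * (ennreal (rad_weight (\<gamma> + 1) v) * indicator {0<..y} v) \<partial>lborel)"
    unfolding lp_kernel_def
  proof (intro nn_integral_mono)
    fix v :: real
    have "(1 - exp (- 2 * v)) powr (\<gamma> - 1) \<le> exp (2 * y) / (2 * \<gamma>) * rad_weight (\<gamma> + 1) v" if v: "0 < v" "v \<le> y"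
    proof -
      have "1 \<le> exp (2 * y) * exp (- 2 * v)" using v by (simp flip: exp_add)
      then have "(1 - exp (- 2 * v)) powr (\<gamma> - 1) * 1 \<le> (1 - exp (- 2 * v)) powr (\<gamma> - 1) * (exp (2 * y) * exp (- 2 * v))"
        by (rule mult_left_mono) simp
      then show ?thesis using \<gamma> by (simp add: rad_weight_def field_simps)
    qed
    then show "ennreal ((1 - exp (- 2 * v)) powr (\<gamma> - 1)) * indicator {0<..y} v
        \<le> ennreal (exp (2 * y) / (2 * \<gamma>)) * (ennreal (rad_weight (\<gamma> + 1) v) * indicator {0<..y} v)"
      using \<gamma> by (auto simp: indicator_def intro!: ennreal_leI simp flip: ennreal_mult')
  qed
  also have "\<dots> = ennreal (exp (2 * y) / (2 * \<gamma>)) * (\<integral>\<^sup>+v\<in>{0<..y}. ennreal (rad_weight (\<gamma> + 1) v) \<partial>lborel)"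
    by (rule nn_integral_cmult) simp
  also have "\<dots> = ennreal (exp (2 * y) / (2 * \<gamma>) * (1 - exp (- 2 * y)) powr \<gamma>)"
    using nn_integral_rad_weight[of "\<gamma> + 1" y] \<gamma> y by (simp flip: ennreal_mult'')
  finally show ?thesis .
qed

abbreviation kernel_b :: "real \<Rightarrow> real \<Rightarrow> ennreal" where
  "kernel_b \<alpha> X \<equiv> \<integral>\<^sup>+s\<in>{0..1}. ennreal (s powr (\<alpha> + 1) / (1 - X * s)) \<partial>lborel"

text \<open>Substitute \<open>s = \<tau>\<^sup>p\<^sup>/\<^sup>2\<close> with \<open>\<tau> = (1 - exp (-2v)) / X\<close>. Since \<open>\<tau> \<le> 1\<close> and \<open>p > 2\<close>, \<open>s \<le> \<tau>\<close> and the
  denominator satisfies \<open>1 - X s \<ge> 1 - X \<tau> = exp (-2v)\<close>; the exponents match because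
  \<open>p/2 (\<alpha> + 1) + p/2 - 1 = \<gamma> - 1\<close>.\<close>

lemma kernel_le_lp_kernel:
  fixes \<alpha> p :: real
  assumes \<alpha>: "\<alpha> \<ge> -1" and p: "p > 2" and \<gamma>: "\<gamma> = p / 2 * (\<alpha> + 2)" and y: "y > 0"
  defines "X \<equiv> 1 - exp (- 2 * y)"
  shows "ennreal (X powr \<gamma>) * kernel_b \<alpha> X \<le> ennreal p * lp_kernel \<gamma> y"
proof -
  have X: "0 < X" "X < 1" using y by (auto simp: X_def)
  define \<tau> where "\<tau> v = (1 - exp (- 2 * v)) / X" for v
  define \<tau>' where "\<tau>' v = 2 * exp (- 2 * v) / X" for v
  \<comment> \<open>written with a modulus so that \<open>DERIV_cmod_powr\<close> yields the two-sided derivative at \<open>v = 0\<close>\<close>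
  define g where "g v = cmod (complex_of_real (\<tau> v)) powr (p / 2)" for v
  define g' where "g' v = p / 2 * (\<tau> v powr (p / 2 - 1) * \<tau>' v)" for v
  have \<tau>0: "\<tau> v \<ge> 0" if "v \<ge> 0" for v using that X by (simp add: \<tau>_def)
  have dg: "(g has_real_derivative g' v) (at v)" if v: "v \<in> {0..y}" for v
  proof -
    have "((\<lambda>v. complex_of_real (\<tau> v)) has_vector_derivative complex_of_real (\<tau>' v)) (at v)"
      using X by (intro has_vector_derivative_of_real)
         (auto simp: \<tau>_def \<tau>'_def has_real_derivative_iff_has_vector_derivative[symmetric] intro!: derivative_eq_intros)
    from DERIV_cmod_powr[OF this, of "p / 2"] p
    have "(g has_real_derivative p / 2 * cmod (complex_of_real (\<tau> v)) powr (p / 2 - 2) * (\<tau> v * \<tau>' v)) (at v)"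
      unfolding g_def by simp
    moreover have "cmod (complex_of_real (\<tau> v)) powr (p / 2 - 2) * \<tau> v = \<tau> v powr (p / 2 - 1)"
      using \<tau>0[of v] v powr_add[of "\<tau> v" "p / 2 - 2" 1] by (cases "\<tau> v = 0") simp_all
    ultimately show ?thesis unfolding g'_def by (simp add: mult_ac)
  qed
  have g01: "g 0 = 0" "g y = 1" using X by (simp_all add: g_def \<tau>_def X_def)
  have cg': "continuous_on {0..y} g'"
    unfolding g'_def \<tau>_def \<tau>'_def using p X
    by (intro continuous_intros continuous_on_powr') auto
  have "kernel_b \<alpha> X
     = (\<integral>\<^sup>+s. ennreal (s powr (\<alpha> + 1) / (1 - X * s) * indicator {g 0..g y} s) \<partial>lborel)"
    unfolding g01 by (intro nn_integral_cong) (auto simp: indicator_def)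
  also have "\<dots> = (\<integral>\<^sup>+v. ennreal (g v powr (\<alpha> + 1) / (1 - X * g v) * g' v * indicator {0..y} v) \<partial>lborel)"
    by (rule nn_integral_substitution[OF _ dg cg']) 
       (use y p X \<tau>0 in \<open>auto simp: set_borel_measurable_def g'_def \<tau>'_def\<close>)
  finally have eq: "kernel_b \<alpha> X = \<dots>" .
  have pw: "X powr \<gamma> * (g v powr (\<alpha> + 1) / (1 - X * g v) * g' v) \<le> p * (1 - exp (- 2 * v)) powr (\<gamma> - 1)"
    if v: "0 < v" "v \<le> y" for v
  proof -
    have \<tau>: "0 < \<tau> v" "\<tau> v \<le> 1" using v X by (auto simp: \<tau>_def X_def)
    have g: "g v = \<tau> v powr (p / 2)" using \<tau> by (simp add: g_def)
    have "g v \<le> \<tau> v powr 1" unfolding g using \<tau> p by (intro powr_mono') auto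
    then have "X * g v \<le> X * \<tau> v" using X \<tau> by (intro mult_left_mono) auto
    also have "X * \<tau> v = 1 - exp (- 2 * v)" using X by (simp add: \<tau>_def)
    finally have le: "exp (- 2 * v) \<le> 1 - X * g v" by simp
    have "X powr \<gamma> * (g v powr (\<alpha> + 1) / (1 - X * g v) * g' v) = 
      X powr \<gamma> * g v powr (\<alpha> + 1) * g' v / (1 - X * g v)" by simp
    also have "\<dots> \<le> X powr \<gamma> * g v powr (\<alpha> + 1) * g' v / exp (- 2 * v)"
      using le \<tau> p X by (intro divide_left_mono) (auto simp: g'_def \<tau>'_def intro!: mult_pos_pos less_le_trans[OF _ le])
    also have "\<dots> = p * (X powr \<gamma> / X) * (\<tau> v powr (p / 2 * (\<alpha> + 1)) * \<tau> v powr (p / 2 - 1))"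
      by (simp add: g g'_def \<tau>'_def powr_powr)
    also have "X powr \<gamma> / X = X powr (\<gamma> - 1)" using X by (simp add: powr_diff)
    also have "\<tau> v powr (p / 2 * (\<alpha> + 1)) * \<tau> v powr (p / 2 - 1) = \<tau> v powr (\<gamma> - 1)"
      unfolding powr_add[symmetric] \<gamma> by (rule arg_cong[where f = "\<lambda>r. \<tau> v powr r"]) (simp add: field_simps)
    also have "p * X powr (\<gamma> - 1) * \<tau> v powr (\<gamma> - 1) = p * (X * \<tau> v) powr (\<gamma> - 1)"
      using X \<tau> by (simp add: powr_mult)
    also have "X * \<tau> v = 1 - exp (- 2 * v)" using X by (simp add: \<tau>_def)
    finally show ?thesis .
  qed
  have [measurable]: "g \<in> borel_measurable borel" "g' \<in> borel_measurable borel"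
    unfolding g_def[abs_def] g'_def[abs_def] \<tau>_def[abs_def] \<tau>'_def[abs_def] by measurable
  have "ennreal (X powr \<gamma>) * kernel_b \<alpha> X
     = (\<integral>\<^sup>+v. ennreal (X powr \<gamma>) * ennreal (g v powr (\<alpha> + 1) / (1 - X * g v) * g' v * indicator {0..y} v) \<partial>lborel)"
    unfolding eq by (rule nn_integral_cmult[symmetric]) simp
  also have "\<dots> \<le> (\<integral>\<^sup>+v. ennreal p * (ennreal ((1 - exp (- 2 * v)) powr (\<gamma> - 1)) * indicator {0<..y} v) \<partial>lborel)"
  proof (intro nn_integral_mono_AE, use AE_lborel_singleton[of 0] in eventually_elim)
    case (elim v)
    show ?case
      using pw[of v] elim p by (auto simp: indicator_def intro!: ennreal_leI simp flip: ennreal_mult' ennreal_mult'')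
  qed
  also have "\<dots> = ennreal p * lp_kernel \<gamma> y"
    unfolding lp_kernel_def by (rule nn_integral_cmult) simp
  finally show ?thesis .
qed

lemma kernel_lower_bound:
  fixes \<alpha> X :: real
  assumes \<alpha>: "\<alpha> \<ge> -1" and X: "0 \<le> X" "X \<le> 1"
  shows "ennreal (1 / (\<alpha> + 2)) \<le> kernel_b \<alpha> X"
proof -
  have "((\<lambda>s. s powr (\<alpha> + 1)) has_integral (1 powr (\<alpha> + 1 + 1) / (\<alpha> + 1 + 1))) {0..1}"
    using \<alpha> by (intro has_integral_powr_from_0) auto
  then have "(\<integral>\<^sup>+s\<in>{0..1}. ennreal (s powr (\<alpha> + 1)) \<partial>lborel) = ennreal (1 powr (\<alpha> + 1 + 1) / (\<alpha> + 1 + 1))"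
    by (intro nn_integral_has_integral_lebesgue') auto
  then have "ennreal (1 / (\<alpha> + 2)) = (\<integral>\<^sup>+s\<in>{0..1}. ennreal (s powr (\<alpha> + 1)) \<partial>lborel)" by (simp add: add.commute)
  also have "\<dots> \<le> kernel_b \<alpha> X"
  proof (intro nn_integral_mono_AE, use AE_lborel_singleton[of 1] in eventually_elim)
    case (elim s)
    have "s powr (\<alpha> + 1) \<le> s powr (\<alpha> + 1) / (1 - X * s)" if s: "0 \<le> s" "s < 1"
    proof -
      have "X * s \<le> 1 * s" using X s by (intro mult_right_mono) auto
      then have "0 < 1 - X * s" "1 - X * s \<le> 1" using X s by auto
      then show ?thesis by (simp add: le_divide_eq mult_left_le)
    qed
    then show ?case using elim by (auto simp: indicator_def intro!: ennreal_leI)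
  qed
  finally show ?thesis .
qed

text \<open>On \<open>|z| = exp (-y)\<close> the Euler derivative is \<open>exp (-y)\<close> times \<open>f'\<close> in modulus, which absorbs the
  Jacobian \<open>exp (-2y)\<close> of polar coordinates.\<close>

lemma nn_integral_disk_theta:
  assumes f: "f holomorphic_on ball 0 1" and p: "p > 2" and \<rho> [measurable]: "\<rho> \<in> borel_measurable borel"
  shows "(\<integral>\<^sup>+z. ennreal ((cmod (deriv f z))\<^sup>2 * cmod (f z) powr (p - 2)) * \<rho> (cmod z) \<partial>disk_area)
     = (\<integral>\<^sup>+y\<in>{0<..}. 2 * \<rho> (exp (- y)) * energy_mean p f y \<partial>lborel)"
proof -
  have [continuous_intros]: "continuous_on (ball 0 1) f" "continuous_on (ball 0 1) (deriv f)"
    using f by (auto intro!: holomorphic_on_imp_continuous_on holomorphic_deriv)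
  have cu: "continuous_on (ball 0 1) (\<lambda>z. (cmod (deriv f z))\<^sup>2 * cmod (f z) powr (p - 2))"
    using p by (intro continuous_intros continuous_on_powr') auto
  let ?u = "\<lambda>z. (cmod (deriv f z))\<^sup>2 * cmod (f z) powr (p - 2)"
  show ?thesis
    unfolding nn_integral_disk_radial[OF cu \<rho>]
  proof (intro nn_integral_cong)
    fix y :: real
    show "ennreal (2 * exp (- 2 * y)) * \<rho> (exp (- y)) * circle_mean (\<lambda>z. ennreal (?u z)) y * indicator {0<..} y
      = 2 * \<rho> (exp (- y)) * energy_mean p f y * indicator {0<..} y"
    proof (cases "y > 0")
      case True
      have "energy_mean p f y
        = circle_mean (\<lambda>z. ennreal (?u z) * ennreal (exp (- 2 * y))) y"
      proof (rule circle_mean_cong)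
        fix z assume z: "cmod z = exp (- y)"
        have "(cmod z)\<^sup>2 = exp (- 2 * y)" by (simp add: z power2_eq_square flip: exp_add)
        then show "ennreal (theta_energy p f z) = ennreal (?u z) * ennreal (exp (- 2 * y))"
          by (simp add: theta_def norm_mult power_mult_distrib mult_ac flip: ennreal_mult)
      qed
      also have "\<dots> = circle_mean (\<lambda>z. ennreal (?u z)) y * ennreal (exp (- 2 * y))"
        by (rule circle_mean_cmult[OF cu True])
      finally show ?thesis
        by (simp add: ennreal_mult mult_ac)
    qed simp
  qed
qed

lemma critical_exponent_gt_1:
  fixes p \<alpha> :: real
  assumes p: "p > 2" and \<alpha>: "\<alpha> \<ge> -1"
  shows "p / 2 * (\<alpha> + 2) > 1"
proof -
  have "p / 2 * 1 \<le> p / 2 * (\<alpha> + 2)" using p \<alpha> by (intro mult_left_mono) auto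
  moreover have "1 < p / 2 * 1" using p by simp
  ultimately show ?thesis by (rule less_le_trans[rotated])
qed

lemma Bergman_norm_lower_bound:
  assumes f: "f holomorphic_on ball 0 1" and p: "p > 2" and \<alpha>: "\<alpha> \<ge> -1" and \<gamma>: "\<gamma> = p / 2 * (\<alpha> + 2)"
  shows "ennreal (cmod (f 0) powr p) + ennreal (p / 2) *
          (\<integral>\<^sup>+ z. ennreal ((cmod (deriv f z))\<^sup>2 * cmod (f z) powr (p - 2) *
                          (1 - (cmod z)\<^sup>2) powr \<gamma>) *
                 kernel_b \<alpha> (1 - (cmod z)\<^sup>2)
             \<partial>disk_area)
     \<le> bergman_pow p \<gamma> f"
proof -
  have \<gamma>1: "\<gamma> > 1" using critical_exponent_gt_1[OF p \<alpha>] \<gamma> by simp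
  let ?g = "\<lambda>y. energy_mean p f y"
  define \<rho> where "\<rho> r = ennreal ((1 - r\<^sup>2) powr \<gamma>) * kernel_b \<alpha> (1 - r\<^sup>2)" for r
  have [measurable]: "\<rho> \<in> borel_measurable borel" unfolding \<rho>_def[abs_def] by measurable
  have "ennreal (p / 2) *
          (\<integral>\<^sup>+ z. ennreal ((cmod (deriv f z))\<^sup>2 * cmod (f z) powr (p - 2) *
                          (1 - (cmod z)\<^sup>2) powr \<gamma>) *
                 kernel_b \<alpha> (1 - (cmod z)\<^sup>2)
             \<partial>disk_area)
     = ennreal (p / 2) * (\<integral>\<^sup>+ z. ennreal ((cmod (deriv f z))\<^sup>2 * cmod (f z) powr (p - 2)) * \<rho> (cmod z) \<partial>disk_area)"
    by (simp add: \<rho>_def ennreal_mult mult.assoc)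
  also have "\<dots> = ennreal (p / 2) * (\<integral>\<^sup>+y\<in>{0<..}. 2 * \<rho> (exp (- y)) * ?g y \<partial>lborel)"
    by (subst nn_integral_disk_theta[OF f p]) simp_all
  also have "\<dots> = (\<integral>\<^sup>+y. ennreal (p / 2) * (2 * \<rho> (exp (- y)) * (?g y * indicator {0<..} y)) \<partial>lborel)"
  proof (subst nn_integral_cmult)
    have "(\<lambda>y. ?g y * indicator {0<..} y) \<in> borel_measurable borel"
      using circle_mean_measurable[OF continuous_on_theta_energy[OF f p]] by simp
    then show "(\<lambda>y. 2 * \<rho> (exp (- y)) * (?g y * indicator {0<..} y)) \<in> borel_measurable lborel" by simp
  qed (simp add: mult.assoc)
  also have "\<dots> \<le> (\<integral>\<^sup>+y\<in>{0<..}. ennreal (p\<^sup>2) * lp_kernel \<gamma> y * ?g y \<partial>lborel)"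
  proof (intro nn_integral_mono)
    fix y :: real
    have "ennreal (p / 2) * (2 * \<rho> (exp (- y))) \<le> ennreal (p\<^sup>2) * lp_kernel \<gamma> y" if y: "y > 0"
    proof -
      have e: "(exp (- y))\<^sup>2 = exp (- 2 * y)" by (simp add: power2_eq_square flip: exp_add)
      have "\<rho> (exp (- y)) \<le> ennreal p * lp_kernel \<gamma> y"
        unfolding \<rho>_def e by (rule kernel_le_lp_kernel[OF \<alpha> p \<gamma> y])
      then have "ennreal p * \<rho> (exp (- y)) \<le> ennreal p * (ennreal p * lp_kernel \<gamma> y)" by (rule mult_left_mono) simp
      moreover have "ennreal (p / 2) * 2 = ennreal p"
        using p by (metis ennreal_mult' ennreal_numeral nonzero_eq_divide_eq times_divide_eq_left zero_le_numeral ennreal_mult'' zero_neq_numeral)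
      moreover have "ennreal p * ennreal p = ennreal (p\<^sup>2)" using p by (simp add: power2_eq_square ennreal_mult)
      ultimately show ?thesis by (simp add: mult.assoc[symmetric])
    qed
    then show "ennreal (p / 2) * (2 * \<rho> (exp (- y)) * (?g y * indicator {0<..} y)) \<le> ennreal (p\<^sup>2) * lp_kernel \<gamma> y * ?g y * indicator {0<..} y"
      by (cases "y > 0") (simp_all add: mult.assoc[symmetric] mult_right_mono)
  qed
  finally show ?thesis
    unfolding Littlewood_Paley[OF f p \<gamma>1] by (rule add_left_mono)
qed

text \<open>The Littlewood--Paley integral is split at \<open>y = y0\<close>. Near the boundary (\<open>y \<le> y0\<close>) the kernel is compared
  with that of (c). In the centre (\<open>y > y0\<close>) it is at most \<open>y \<le> 2 (y - y0/2)\<close>, and by the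
  Hardy--Stein identity the integral with the kernel \<open>y - y0/2\<close> over \<open>y > y0/2\<close> is the difference of the
  mean of \<open>|f|\<^sup>p\<close> over the circle of radius \<open>exp (-y0/2)\<close> and \<open>|f(0)|\<^sup>p\<close>. This bounds
  the central part in terms of \<open>f\<close> alone.\<close>

lemma Bergman_norm_upper_bound:
  assumes f: "f holomorphic_on ball 0 1" and f0: "f 0 = 0" and p: "p > 2" and \<alpha>: "\<alpha> \<ge> -1" and \<gamma>: "\<gamma> = p / 2 * (\<alpha> + 2)"
    and y0: "y0 > 0"
  shows "bergman_pow p \<gamma> f
     \<le> ennreal (exp (2 * y0)) * (ennreal (p / (2 * (\<alpha> + 2))) * deriv_energy p \<gamma> f)
       + 2 * circle_mean (\<lambda>z. ennreal (cmod (f z) powr p)) (y0 / 2)"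
proof -
  have \<gamma>1: "\<gamma> > 1" using critical_exponent_gt_1[OF p \<alpha>] \<gamma> by simp
  let ?g = "\<lambda>y. energy_mean p f y"
  let ?X = "\<lambda>y. 1 - exp (- 2 * y) :: real"
  define c where "c = p / (2 * (\<alpha> + 2))"
  have c: "c > 0" using p \<alpha> by (simp add: c_def)
  \<comment> \<open>cut off at \<open>0\<close>, since circle means are known to be measurable for positive arguments only\<close>
  define b where "b = (\<lambda>w. ennreal (p\<^sup>2) * (?g w * indicator {0<..} w))"
  have gm [measurable]: "(\<lambda>y. ?g y * indicator {0<..} y) \<in> borel_measurable borel"
    using circle_mean_measurable[OF continuous_on_theta_energy[OF f p]] by simp
  have [measurable]: "b \<in> borel_measurable borel" unfolding b_def by simp
  have inner: "(\<integral>\<^sup>+w\<in>{y0 / 2<..}. b w * ennreal (w - y0 / 2) \<partial>lborel) \<le> circle_mean (\<lambda>z. ennreal (cmod (f z) powr p)) (y0 / 2)"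
  proof -
    have "(\<integral>\<^sup>+w\<in>{y0 / 2<..}. b w * ennreal (w - y0 / 2) \<partial>lborel)
       = (\<integral>\<^sup>+w\<in>{y0 / 2<..}. b w * (\<integral>\<^sup>+v\<in>{y0 / 2<..w}. 1 \<partial>lborel) \<partial>lborel)"
      by (intro nn_integral_cong) (auto simp: indicator_def[of "{y0 / 2<..}"])
    also have "\<dots> = (\<integral>\<^sup>+v\<in>{y0 / 2<..}. 1 * (\<integral>\<^sup>+w\<in>{v..}. b w \<partial>lborel) \<partial>lborel)"
      by (rule nn_integral_triangle_swap[symmetric]) simp_all
    also have "\<dots> \<le> (\<integral>\<^sup>+v\<in>{y0 / 2..}. (\<integral>\<^sup>+w\<in>{v..}. ennreal (p\<^sup>2) * ?g w \<partial>lborel) \<partial>lborel)"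
    proof (intro nn_integral_mono)
      fix v :: real
      have "(\<integral>\<^sup>+w\<in>{v..}. b w \<partial>lborel) \<le> (\<integral>\<^sup>+w\<in>{v..}. ennreal (p\<^sup>2) * ?g w \<partial>lborel)"
        by (intro nn_integral_mono) (auto simp: b_def indicator_def)
      then show "1 * (\<integral>\<^sup>+w\<in>{v..}. b w \<partial>lborel) * indicator {y0 / 2<..} v \<le> (\<integral>\<^sup>+w\<in>{v..}. ennreal (p\<^sup>2) * ?g w \<partial>lborel) * indicator {y0 / 2..} v"
        by (cases "y0 / 2 < v") simp_all
    qed
    also have "\<dots> \<le> circle_mean (\<lambda>z. ennreal (cmod (f z) powr p)) (y0 / 2)"
      using Hardy_Stein_identity[OF f p, of "y0 / 2"] y0 by simp
    finally show ?thesis .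
  qed
  have "deriv_energy p \<gamma> f
     = (\<integral>\<^sup>+ z. ennreal ((cmod (deriv f z))\<^sup>2 * cmod (f z) powr (p - 2)) * ennreal ((1 - (cmod z)\<^sup>2) powr \<gamma>) \<partial>disk_area)"
    by (simp add: deriv_energy_def ennreal_mult)
  also have "\<dots> = (\<integral>\<^sup>+y\<in>{0<..}. 2 * ennreal ((1 - (exp (- y))\<^sup>2) powr \<gamma>) * ?g y \<partial>lborel)"
    by (subst nn_integral_disk_theta[OF f p]) simp_all
  finally have DI: "deriv_energy p \<gamma> f = \<dots>" .
  have "bergman_pow p \<gamma> f
     = (\<integral>\<^sup>+y\<in>{0<..}. ennreal (p\<^sup>2) * lp_kernel \<gamma> y * ?g y \<partial>lborel)"
    unfolding Littlewood_Paley[OF f p \<gamma>1] using p by (simp add: f0)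
  also have "\<dots> \<le> (\<integral>\<^sup>+y. ennreal (exp (2 * y0)) * (ennreal c * (2 * ennreal ((1 - (exp (- y))\<^sup>2) powr \<gamma>) * (?g y * indicator {0<..} y)))
      + 2 * (b y * ennreal (y - y0 / 2) * indicator {y0 / 2<..} y) \<partial>lborel)"
  proof (intro nn_integral_mono)
    fix y :: real
    have e: "(exp (- y))\<^sup>2 = exp (- 2 * y)" by (simp add: power2_eq_square flip: exp_add)
    show "ennreal (p\<^sup>2) * lp_kernel \<gamma> y * ?g y * indicator {0<..} y \<le>
      ennreal (exp (2 * y0)) * (ennreal c * (2 * ennreal ((1 - (exp (- y))\<^sup>2) powr \<gamma>) * (?g y * indicator {0<..} y)))
      + 2 * (b y * ennreal (y - y0 / 2) * indicator {y0 / 2<..} y)"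
    proof (cases "y > 0")
      case True
      show ?thesis
      proof (cases "y \<le> y0")
        case True
        have "lp_kernel \<gamma> y \<le> ennreal (exp (2 * y) / (2 * \<gamma>) * ?X y powr \<gamma>)"
          using lp_kernel_le_near_boundary[OF \<gamma>1, of y] \<open>y > 0\<close> by simp
        also have "\<dots> \<le> ennreal (exp (2 * y0) / (2 * \<gamma>) * ?X y powr \<gamma>)"
          using True \<gamma>1 by (intro ennreal_leI mult_right_mono divide_right_mono) auto
        finally have "ennreal (p\<^sup>2) * lp_kernel \<gamma> y \<le> ennreal (p\<^sup>2) * ennreal (exp (2 * y0) / (2 * \<gamma>) * ?X y powr \<gamma>)"
          by (rule mult_left_mono) simp
        also have "\<dots> = ennreal (exp (2 * y0) * (c * (2 * ?X y powr \<gamma>)))"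
        proof -
          have "2 * \<gamma> = p * (\<alpha> + 2)" by (simp add: \<gamma>)
          moreover have "2 * c = p / (\<alpha> + 2)"
            unfolding c_def times_divide_eq_right by (rule mult_divide_mult_cancel_left) simp
          ultimately have "p\<^sup>2 / (2 * \<gamma>) = 2 * c" using p by (simp add: power2_eq_square)
          have "p\<^sup>2 * (exp (2 * y0) / (2 * \<gamma>) * ?X y powr \<gamma>) = p\<^sup>2 / (2 * \<gamma>) * (exp (2 * y0) * ?X y powr \<gamma>)"
            by simp
          also have "\<dots> = exp (2 * y0) * (c * (2 * ?X y powr \<gamma>))"
            unfolding \<open>p\<^sup>2 / (2 * \<gamma>) = 2 * c\<close> by (simp only: mult_ac)
          finally show ?thesis by (simp flip: ennreal_mult')
        qed
        also have "\<dots> = ennreal (exp (2 * y0)) * (ennreal c * (2 * ennreal (?X y powr \<gamma>)))"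
          using c by (simp add: ennreal_mult)
        finally have "ennreal (p\<^sup>2) * lp_kernel \<gamma> y * ?g y \<le> ennreal (exp (2 * y0)) * (ennreal c * (2 * ennreal (?X y powr \<gamma>))) * ?g y"
          by (rule mult_right_mono) simp
        then show ?thesis using \<open>y > 0\<close> unfolding e
          by (simp add: mult.assoc add_increasing2)
      next
        case False
        have "lp_kernel \<gamma> y \<le> ennreal y" using \<gamma>1 \<open>y > 0\<close> by (intro lp_kernel_le_self) auto
        also have "\<dots> \<le> ennreal (2 * (y - y0 / 2))" using False by (intro ennreal_leI) simp
        also have "\<dots> = 2 * ennreal (y - y0 / 2)" using False y0 by (subst ennreal_mult) auto
        finally have "ennreal (p\<^sup>2) * ?g y * lp_kernel \<gamma> y \<le> ennreal (p\<^sup>2) * ?g y * (2 * ennreal (y - y0 / 2))"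
          by (rule mult_left_mono) simp
        then show ?thesis using \<open>y > 0\<close> False y0
          by (simp add: b_def mult_ac add_increasing)
      qed
    qed simp
  qed
  also have "\<dots> = ennreal (exp (2 * y0)) * (ennreal c * (\<integral>\<^sup>+y\<in>{0<..}. 2 * ennreal ((1 - (exp (- y))\<^sup>2) powr \<gamma>) * ?g y \<partial>lborel))
      + 2 * (\<integral>\<^sup>+w\<in>{y0 / 2<..}. b w * ennreal (w - y0 / 2) \<partial>lborel)"
    by (subst nn_integral_add) (simp_all add: nn_integral_cmult mult.assoc)
  finally show ?thesis
    unfolding DI c_def[symmetric]
    by (rule order_trans) (intro add_left_mono mult_left_mono inner; simp)
qed

section \<open>Square means over circles and Taylor polynomials\<close>

lemma polar_eq_cis: "polar y t = of_real (exp (- y)) * cis t"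
  by (simp add: complex_eq_iff Re_exp Im_exp)

text \<open>Cauchy's integral formula for the \<open>k\<close>-th derivative, written as an integral over the angle.\<close>

lemma circle_coefficient:
  fixes f :: "complex \<Rightarrow> complex"
  assumes f: "f holomorphic_on ball 0 1" and y: "y > 0"
  shows "((\<lambda>t. f (polar y t) / polar y t ^ k) has_integral (of_real (2 * pi) * (deriv ^^ k) f 0 / fact k)) {0..2 * pi}"
proof -
  let ?r = "exp (- y) :: real"
  have r: "0 < ?r" "?r < 1" using y by auto
  have sub: "cball 0 ?r \<subseteq> ball (0 :: complex) 1" using y by (simp add: cball_subset_ball_iff)
  have "((\<lambda>u. f u / (u - 0) ^ Suc k) has_contour_integral (2 * pi * \<i> / fact k * (deriv ^^ k) f 0)) (circlepath 0 ?r)"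
    using holomorphic_on_subset[OF f sub] r
    by (intro Cauchy_has_contour_integral_higher_derivative_circlepath)
       (auto intro!: holomorphic_on_imp_continuous_on elim: holomorphic_on_subset)
  then have "((\<lambda>t. f (0 + ?r * cis t) / (0 + ?r * cis t - 0) ^ Suc k * ?r * \<i> * cis t) has_integral (2 * pi * \<i> / fact k * (deriv ^^ k) f 0)) {0..2 * pi}"
    unfolding circlepath_def by (subst (asm) has_contour_integral_part_circlepath_iff) simp_all
  then have "((\<lambda>t. - \<i> * (f (0 + ?r * cis t) / (0 + ?r * cis t - 0) ^ Suc k * ?r * \<i> * cis t)) has_integral (- \<i> * (2 * pi * \<i> / fact k * (deriv ^^ k) f 0))) {0..2 * pi}"
    by (rule has_integral_mult_right)
  moreover have "- \<i> * (f (0 + ?r * cis t) / (0 + ?r * cis t - 0) ^ Suc k * ?r * \<i> * cis t) = f (polar y t) / polar y t ^ k" for t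
    unfolding polar_eq_cis by (simp add: field_simps)
  moreover have "- \<i> * (2 * pi * \<i> / fact k * (deriv ^^ k) f 0) = of_real (2 * pi) * (deriv ^^ k) f 0 / fact k"
    by (simp add: field_simps)
  ultimately show ?thesis by (simp only:)
qed

lemma higher_deriv_poly_0: "(deriv ^^ n) (poly P) 0 = fact n * coeff P n" for P :: "complex poly"
proof (induction n arbitrary: P)
  case 0
  then show ?case by (simp add: poly_0_coeff_0)
next
  case (Suc n)
  have "deriv (poly P) = poly (pderiv P)" by (intro ext DERIV_imp_deriv poly_DERIV)
  then have "(deriv ^^ Suc n) (poly P) 0 = (deriv ^^ n) (poly (pderiv P)) 0"
    by (simp add: funpow_Suc_right del: funpow.simps)
  also have "\<dots> = fact n * (of_nat (Suc n) * coeff P (Suc n))" by (simp add: Suc coeff_pderiv)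
  finally show ?case by (simp add: mult_ac)
qed

definition taylor_poly :: "(complex \<Rightarrow> complex) \<Rightarrow> nat \<Rightarrow> complex poly" where
  "taylor_poly f n = (\<Sum>k\<le>n. monom ((deriv ^^ k) f 0 / fact k) k)"

lemma coeff_taylor_poly: "coeff (taylor_poly f n) k = (if k \<le> n then (deriv ^^ k) f 0 / fact k else 0)"
  unfolding taylor_poly_def by (simp add: coeff_sum)

lemma degree_taylor_poly: "degree (taylor_poly f n) \<le> n"
  by (rule degree_le) (simp add: coeff_taylor_poly)

lemma poly_taylor_poly: "poly (taylor_poly f n) z = (\<Sum>k\<le>n. (deriv ^^ k) f 0 / fact k * z ^ k)"
  unfolding taylor_poly_def by (simp add: poly_sum poly_monom)

lemma higher_deriv_taylor_remainder:
  assumes f: "f holomorphic_on ball 0 1" and "k \<le> n"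
  shows "(deriv ^^ k) (\<lambda>z. f z - poly (taylor_poly f n) z) 0 = 0"
  using assms
  by (subst higher_deriv_diff[where S = "ball 0 1"])
     (auto intro!: holomorphic_intros simp: higher_deriv_poly_0 coeff_taylor_poly)

text \<open>On the circle of radius \<open>r\<close> the conjugate of \<open>z\<close> is \<open>r\<^sup>2 / z\<close>, so the integral is a combination of
  Taylor coefficients of \<open>R\<close> of order at most \<open>n\<close>.\<close>

lemma circle_int_orthogonal:
  assumes R: "R holomorphic_on ball 0 1" and R0: "\<And>k. k \<le> n \<Longrightarrow> (deriv ^^ k) R 0 = 0"
    and P: "degree P \<le> n" and y: "y > 0"
  shows "circle_int (\<lambda>z. Re (cnj (poly P z) * R z)) y = 0"
proof -
  let ?r = "exp (- y) :: real" and ?z = "\<lambda>t. polar y t"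
  have cz: "cnj (?z t) = of_real (?r\<^sup>2) / ?z t" for t
    using complex_norm_square[of "?z t"] by (simp add: norm_exp_eq_Re field_simps)
  have eq: "cnj (poly P (?z t)) * R (?z t) = (\<Sum>k\<le>degree P. cnj (coeff P k) * of_real (?r\<^sup>2) ^ k * (R (?z t) / ?z t ^ k))" for t
    unfolding poly_altdef by (simp add: cnj_sum cz sum_distrib_left sum_distrib_right power_divide mult_ac del: of_real_power)
  have "((\<lambda>t. \<Sum>k\<le>degree P. cnj (coeff P k) * of_real (?r\<^sup>2) ^ k * (R (?z t) / ?z t ^ k)) has_integral
      (\<Sum>k\<le>degree P. cnj (coeff P k) * of_real (?r\<^sup>2) ^ k * (of_real (2 * pi) * (deriv ^^ k) R 0 / fact k))) {0..2 * pi}"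
    by (intro has_integral_sum has_integral_mult_right circle_coefficient[OF R y]) simp
  also have "(\<Sum>k\<le>degree P. cnj (coeff P k) * of_real (?r\<^sup>2) ^ k * (of_real (2 * pi) * (deriv ^^ k) R 0 / fact k)) = 0"
    using R0 P by (intro sum.neutral) auto
  finally have "((\<lambda>t. cnj (poly P (?z t)) * R (?z t)) has_integral 0) {0..2 * pi}" unfolding eq .
  from has_integral_linear[OF this bounded_linear_Re] show ?thesis
    unfolding circle_int_def o_def by (simp add: integral_unique)
qed

text \<open>Both the Taylor polynomial and the remainder have smaller square means than \<open>f\<close>, on every circle.
  This bounds the norms of both in \<open>A\<^sup>2\<^sub>\<alpha>\<close> for all \<open>\<alpha> \<ge> -1\<close> at once.\<close>

lemma circle_int_taylor_Pythagoras:
  assumes f: "f holomorphic_on ball 0 1" and y: "y > 0"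
  shows "circle_sq f y = circle_sq (poly (taylor_poly f n)) y
     + circle_sq (\<lambda>z. f z - poly (taylor_poly f n) z) y"
proof -
  let ?P = "taylor_poly f n"
  define R where "R z = f z - poly ?P z" for z
  have R: "R holomorphic_on ball 0 1" unfolding R_def using f by (intro holomorphic_intros)
  have c [continuous_intros]: "continuous_on (ball 0 1) (poly ?P)" "continuous_on (ball 0 1) R"
    using R by (auto intro!: holomorphic_on_imp_continuous_on holomorphic_intros)
  have eq: "(cmod (f z))\<^sup>2 = (cmod (poly ?P z))\<^sup>2 + (cmod (R z))\<^sup>2 + 2 * Re (cnj (poly ?P z) * R z)" for z
  proof -
    have "f z = poly ?P z + R z" by (simp add: R_def)
    then show ?thesis by (simp add: cmod_power2) (simp add: power2_eq_square algebra_simps)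
  qed
  have "circle_sq f y = circle_sq (poly ?P) y + circle_sq R y
     + 2 * circle_int (\<lambda>z. Re (cnj (poly ?P z) * R z)) y"
    unfolding eq circle_int_def
    by (simp add: integral_add integrable_continuous_real continuous_on_circle1[OF _ y] continuous_intros integrable_add)
  also have "circle_int (\<lambda>z. Re (cnj (poly ?P z) * R z)) y = 0"
    by (rule circle_int_orthogonal[OF R _ degree_taylor_poly y])
       (use higher_deriv_taylor_remainder[OF f] in \<open>simp add: R_def[abs_def]\<close>)
  finally show ?thesis by (simp add: R_def)
qed

lemma circle_int_square_nonneg:
  assumes f: "f holomorphic_on ball 0 1" and y: "y > 0"
  shows "circle_sq f y \<ge> 0"
  using f y by (intro circle_mean_eq_circle_int) (auto intro!: continuous_intros holomorphic_on_imp_continuous_on)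

lemma circle_int_taylor_le:
  assumes f: "f holomorphic_on ball 0 1" and y: "y > 0"
  shows "circle_sq (poly (taylor_poly f n)) y \<le> circle_sq f y"
    and "circle_sq (\<lambda>z. f z - poly (taylor_poly f n) z) y \<le> circle_sq f y"
proof -
  have "poly (taylor_poly f n) holomorphic_on ball 0 1" "(\<lambda>z. f z - poly (taylor_poly f n) z) holomorphic_on ball 0 1"
    using f by (auto intro!: holomorphic_intros)
  from this[THEN circle_int_square_nonneg[OF _ y]] circle_int_taylor_Pythagoras[OF f y, of n]
  show "circle_sq (poly (taylor_poly f n)) y \<le> circle_sq f y"
    "circle_sq (\<lambda>z. f z - poly (taylor_poly f n) z) y \<le> circle_sq f y" by auto
qed

lemma circle_int_powr_antimono:
  assumes f: "f holomorphic_on ball 0 1" and p: "p > 2" and y: "0 < y1" "y1 \<le> y2"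
  shows "circle_int (\<lambda>z. cmod (f z) powr p) y2 \<le> circle_int (\<lambda>z. cmod (f z) powr p) y1"
proof -
  have cu: "continuous_on (ball 0 1) (\<lambda>z. cmod (f z) powr p)"
    using f p by (intro continuous_on_cmod_powr) auto
  have "circle_mean (\<lambda>z. ennreal (cmod (f z) powr p)) y2 \<le> circle_mean (\<lambda>z. ennreal (cmod (f z) powr p)) y1"
  proof -
    let ?h = "\<lambda>v. \<integral>\<^sup>+w\<in>{v..}. ennreal (p\<^sup>2) * energy_mean p f w \<partial>lborel"
    have "(\<integral>\<^sup>+v\<in>{y2..}. ?h v \<partial>lborel) \<le> (\<integral>\<^sup>+v\<in>{y1..}. ?h v \<partial>lborel)"
      using y by (intro nn_integral_mono mult_left_mono) (auto simp: indicator_def)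
    then show ?thesis
      using y by (simp add: Hardy_Stein_identity[OF f p, of y1] Hardy_Stein_identity[OF f p, of y2] add_left_mono)
  qed
  then show ?thesis
    using y by (simp add: circle_mean_eq_circle_int[OF cu] ennreal_le_iff divide_le_cancel)
qed

text \<open>The Hardy--Stein identity requires \<open>p > 2\<close>; the case \<open>p = 2\<close> follows by continuity in \<open>p\<close>.\<close>

lemma circle_int_square_antimono:
  assumes f: "f holomorphic_on ball 0 1" and y: "0 < y1" "y1 \<le> y2"
  shows "circle_sq f y2 \<le> circle_sq f y1"
proof -
  have lim: "((\<lambda>p. circle_int (\<lambda>z. cmod (f z) powr p) y) \<longlongrightarrow> circle_sq f y) (at_right 2)" if y: "y > 0" for y
  proof -
    have c: "continuous_on UNIV (\<lambda>t. f (polar y t))"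
      using f y by (intro continuous_on_circle1 holomorphic_on_imp_continuous_on)
    have "continuous_on {2..3::real} (\<lambda>p. integral (cbox 0 (2 * pi)) (\<lambda>t. cmod (f (polar y t)) powr p))"
    proof (rule integral_continuous_on_param)
      have "continuous_on ({2..3} \<times> cbox 0 (2 * pi)) (\<lambda>x. cmod (f (exp (Complex (- y) (snd x)))) powr (fst x))"
        by (intro continuous_on_powr' continuous_intros continuous_on_compose2[OF c]) auto
      then show "continuous_on ({2..3} \<times> cbox 0 (2 * pi)) (\<lambda>(p, t). cmod (f (polar y t)) powr p)"
        by (simp add: split_beta)
    qed
    then have "((\<lambda>p. integral (cbox 0 (2 * pi)) (\<lambda>t. cmod (f (polar y t)) powr p)) \<longlongrightarrow>
        integral (cbox 0 (2 * pi)) (\<lambda>t. cmod (f (polar y t)) powr 2)) (at 2 within {2..3})"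
      unfolding continuous_on by (rule bspec) simp
    then have "((\<lambda>p. circle_int (\<lambda>z. cmod (f z) powr p) y) \<longlongrightarrow> circle_int (\<lambda>z. cmod (f z) powr 2) y) (at 2 within {2..3})"
      unfolding circle_int_def cbox_interval .
    then have "((\<lambda>p. circle_int (\<lambda>z. cmod (f z) powr p) y) \<longlongrightarrow> circle_int (\<lambda>z. cmod (f z) powr 2) y) (at_right 2)"
      by (simp add: at_within_Icc_at_right)
    then show ?thesis by simp
  qed
  show ?thesis
  proof (rule tendsto_le)
    show "\<forall>\<^sub>F p in at_right 2. circle_int (\<lambda>z. cmod (f z) powr p) y2 \<le> circle_int (\<lambda>z. cmod (f z) powr p) y1"
      using circle_int_powr_antimono[OF f _ y] by (auto simp: eventually_at_filter)
  qed (use lim y in auto)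
qed

text \<open>The value of \<open>circle_int\<close> at \<open>0\<close> is the integral over the unit circle.\<close>

lemma circle_int_right_limit:
  assumes u: "continuous_on (cball 0 1) (u :: complex \<Rightarrow> real)"
  shows "(circle_int u \<longlongrightarrow> circle_int u 0) (at_right 0)"
proof -
  have "continuous_on {0..1} (\<lambda>y. integral (cbox 0 (2 * pi)) (\<lambda>t. u (polar y t)))"
  proof (rule integral_continuous_on_param)
    have "continuous_on ({0..1} \<times> cbox 0 (2 * pi)) (\<lambda>x. u (exp (Complex (- fst x) (snd x))))"
      by (intro continuous_on_compose2[OF u]) (auto simp: Complex_eq norm_exp_eq_Re intro!: continuous_intros)
    then show "continuous_on ({0..1} \<times> cbox 0 (2 * pi)) (\<lambda>(y, t). u (polar y t))"
      by (simp add: split_beta)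
  qed
  then have "((\<lambda>y. integral (cbox 0 (2 * pi)) (\<lambda>t. u (polar y t))) \<longlongrightarrow>
      integral (cbox 0 (2 * pi)) (\<lambda>t. u (exp (Complex (- 0) t)))) (at 0 within {0..1})"
    unfolding continuous_on by (rule bspec) simp
  then have "(circle_int u \<longlongrightarrow> circle_int u 0) (at 0 within {0..1})"
    unfolding circle_int_def[abs_def] cbox_interval .
  then show ?thesis by (simp add: at_within_Icc_at_right)
qed

lemma circle_int_square_le_boundary:
  assumes f: "f holomorphic_on ball 0 1" and c: "continuous_on (cball 0 1) f" and y: "y > 0"
  shows "circle_sq f y \<le> circle_sq f 0"
proof (rule tendsto_lowerbound)
  show "((\<lambda>v. circle_sq f v) \<longlongrightarrow> circle_sq f 0) (at_right 0)"
    using c by (intro circle_int_right_limit continuous_intros)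
  show "\<forall>\<^sub>F v in at_right 0. circle_sq f y \<le> circle_sq f v"
    by (rule eventually_at_right_real[OF y, THEN eventually_mono]) (auto intro!: circle_int_square_antimono[OF f])
qed simp

section \<open>Norms in terms of circle means\<close>

lemma ennpowr_mono: "x \<le> y \<Longrightarrow> a > 0 \<Longrightarrow> ennpowr x a \<le> ennpowr y a"
  unfolding ennpowr_def
  by (auto intro!: ennreal_leI powr_mono2 enn2real_mono simp: less_top top_unique)

lemma ennpowr_le_iff:
  assumes "a > 0" "c \<ge> 0"
  shows "ennpowr x (1 / a) \<le> ennreal c \<longleftrightarrow> x \<le> ennreal (c powr a)"
proof (cases x)
  case (real r)
  have "r powr (1 / a) \<le> c \<longleftrightarrow> r \<le> c powr a"
  proof
    assume "r powr (1 / a) \<le> c"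
    then have "(r powr (1 / a)) powr a \<le> c powr a" using assms by (intro powr_mono2) auto
    then show "r \<le> c powr a" using assms real by (simp add: powr_powr)
  next
    assume "r \<le> c powr a"
    then have "r powr (1 / a) \<le> (c powr a) powr (1 / a)" using assms real by (intro powr_mono2) auto
    then show "r powr (1 / a) \<le> c" using assms by (simp add: powr_powr)
  qed
  then show ?thesis using real assms by (simp add: ennpowr_def)
qed (simp add: ennpowr_def top_unique)

text \<open>In this form the Hardy norm, like the Bergman norms with exponent \<open>2\<close>, is visibly monotone in the square
  means over circles.\<close>

lemma hardy_norm_eq:
  assumes f: "f holomorphic_on ball 0 1"
  shows "hardy_norm 2 f = (SUP y\<in>{0<..}. ennreal (sqrt (circle_sq f y / (2 * pi))))"
proof -
  have cu: "continuous_on (ball 0 1) (\<lambda>z. (cmod (f z))\<^sup>2)"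
    using f by (intro continuous_intros holomorphic_on_imp_continuous_on)
  let ?I = "\<lambda>y. ennreal (1 / (2 * pi)) * (\<integral>\<^sup>+ t\<in>{0..2 * pi}. ennreal (cmod (f (of_real (exp (- y)) * exp (\<i> * of_real t))) powr 2) \<partial>lborel)"
  have im: "{0<..<1::real} = (\<lambda>y. exp (- y)) ` {0<..}"
  proof (intro equalityI subsetI)
    fix r :: real assume "r \<in> {0<..<1}"
    then show "r \<in> (\<lambda>y. exp (- y)) ` {0<..}" by (intro image_eqI[of _ _ "- ln r"]) auto
  qed auto
  have "hardy_norm 2 f = (SUP y\<in>{0<..}. ennpowr (?I y) (1 / 2))"
    unfolding hardy_norm_def im image_image ..
  also have "\<dots> = (SUP y\<in>{0<..}. ennreal (sqrt (circle_sq f y / (2 * pi))))"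
  proof (rule SUP_cong)
    fix y :: real assume "y \<in> {0<..}"
    then have y: "y > 0" by simp
    have e: "of_real (exp (- y)) * exp (\<i> * of_real t) = polar y t" for t
      by (simp add: polar_eq_cis cis_conv_exp)
    have "?I y
      = circle_mean (\<lambda>z. ennreal ((cmod (f z))\<^sup>2)) y"
      unfolding circle_mean_def e by simp
    also have "\<dots> = ennreal (circle_sq f y / (2 * pi))"
      by (rule circle_mean_eq_circle_int(1)[OF cu _ y]) simp
    finally have *: "?I y = \<dots>" .
    show "ennpowr (?I y) (1 / 2)
       = ennreal (sqrt (circle_sq f y / (2 * pi)))"
      unfolding * using circle_int_square_nonneg[OF f y] by (simp add: ennpowr_def powr_half_sqrt)
  qed simp
  finally show ?thesis .
qed

lemma bergman_norm_2_mono: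
  assumes f: "f holomorphic_on ball 0 1" and g: "g holomorphic_on ball 0 1"
    and le: "\<And>y. y > 0 \<Longrightarrow> circle_sq f y \<le> circle_sq g y"
  shows "bergman_norm 2 \<alpha> f \<le> bergman_norm 2 \<alpha> g"
proof (cases "\<alpha> = -1")
  case True
  have "hardy_norm 2 f \<le> hardy_norm 2 g"
    unfolding hardy_norm_eq[OF f] hardy_norm_eq[OF g]
  proof (rule SUP_mono)
    fix y :: real assume "y \<in> {0<..}"
    then show "\<exists>x\<in>{0<..}. ennreal (sqrt (circle_sq f y / (2 * pi))) \<le> ennreal (sqrt (circle_sq g x / (2 * pi)))"
      using le[of y] by (intro bexI[of _ y] ennreal_leI real_sqrt_le_mono divide_right_mono) auto
  qed
  then show ?thesis using True by (simp add: bergman_norm_def)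
next
  case False
  have eq: "(\<integral>\<^sup>+ z. ennreal ((1 - (cmod z)\<^sup>2) powr \<alpha> * cmod (h z) powr 2) \<partial>disk_area)
    = (\<integral>\<^sup>+y\<in>{0<..}. ennreal (2 * exp (- 2 * y)) * ennreal ((1 - (exp (- y))\<^sup>2) powr \<alpha>) * ennreal (circle_sq h y / (2 * pi)) \<partial>lborel)"
    if h: "h holomorphic_on ball 0 1" for h
  proof -
    have cu: "continuous_on (ball 0 1) (\<lambda>z. (cmod (h z))\<^sup>2)"
      using h by (intro continuous_intros holomorphic_on_imp_continuous_on)
    have "(\<integral>\<^sup>+ z. ennreal ((1 - (cmod z)\<^sup>2) powr \<alpha> * cmod (h z) powr 2) \<partial>disk_area)
       = (\<integral>\<^sup>+ z. ennreal ((cmod (h z))\<^sup>2) * ennreal ((1 - (cmod z)\<^sup>2) powr \<alpha>) \<partial>disk_area)"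
      by (simp add: mult.commute ennreal_mult)
    also have "\<dots> = (\<integral>\<^sup>+y\<in>{0<..}. ennreal (2 * exp (- 2 * y)) * ennreal ((1 - (exp (- y))\<^sup>2) powr \<alpha>) * circle_mean (\<lambda>z. ennreal ((cmod (h z))\<^sup>2)) y \<partial>lborel)"
      by (rule nn_integral_disk_radial[OF cu]) simp
    also have "\<dots> = (\<integral>\<^sup>+y\<in>{0<..}. ennreal (2 * exp (- 2 * y)) * ennreal ((1 - (exp (- y))\<^sup>2) powr \<alpha>) * ennreal (circle_sq h y / (2 * pi)) \<partial>lborel)"
      by (intro nn_integral_cong) (auto simp: indicator_def circle_mean_eq_circle_int(1)[OF cu])
    finally show ?thesis .
  qed
  show ?thesis
    unfolding bergman_norm_def eq[OF f] eq[OF g] using False le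
    by (auto intro!: ennpowr_mono mult_left_mono nn_integral_mono ennreal_leI divide_right_mono simp: indicator_def)
qed

section \<open>Disk automorphisms\<close>

text \<open>The disk automorphism that sends the real number \<open>a\<close> to \<open>0\<close>. Its inverse is \<open>mob (- a)\<close>.\<close>

definition mob :: "real \<Rightarrow> complex \<Rightarrow> complex" where
  "mob a z = (z - of_real a) / (1 - of_real a * z)"

text \<open>The power \<open>s/2\<close> of the derivative of \<open>mob a\<close>; the principal branch is holomorphic because
  \<open>1 - a z\<close> has positive real part.\<close>

definition mob_weight :: "real \<Rightarrow> real \<Rightarrow> complex \<Rightarrow> complex" where
  "mob_weight a s z = of_real ((1 - a\<^sup>2) powr (s / 2)) * (1 - of_real a * z) powr (of_real (- s))"

lemma mob_denominator:
  assumes "\<bar>a\<bar> < 1" "cmod z \<le> 1"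
  shows "Re (1 - of_real a * z) > 0" "1 - of_real a * z \<noteq> 0"
proof -
  have "\<bar>a * Re z\<bar> \<le> \<bar>a\<bar> * cmod z"
    unfolding abs_mult by (intro mult_left_mono abs_Re_le_cmod) simp
  also have "\<dots> \<le> \<bar>a\<bar> * 1" using assms by (intro mult_left_mono) auto
  finally show "Re (1 - of_real a * z) > 0" using assms by simp
  then show "1 - of_real a * z \<noteq> 0" by (metis less_irrefl zero_complex.sel(1))
qed

lemma one_minus_mob:
  assumes a: "\<bar>a\<bar> < 1" and z: "cmod z \<le> 1"
  shows "1 - (cmod (mob a z))\<^sup>2 = (1 - a\<^sup>2) / (cmod (1 - of_real a * z))\<^sup>2 * (1 - (cmod z)\<^sup>2)"
proof -
  have nz: "(cmod (1 - of_real a * z))\<^sup>2 \<noteq> 0" using mob_denominator(2)[OF a z] by simp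
  have "(cmod (1 - of_real a * z))\<^sup>2 - (cmod (z - of_real a))\<^sup>2 = (1 - a\<^sup>2) * (1 - (cmod z)\<^sup>2)"
    unfolding cmod_power2 by (simp add: power2_eq_square algebra_simps)
  moreover have "1 - (cmod (mob a z))\<^sup>2 = ((cmod (1 - of_real a * z))\<^sup>2 - (cmod (z - of_real a))\<^sup>2) / (cmod (1 - of_real a * z))\<^sup>2"
    unfolding mob_def norm_divide power_divide using nz by (simp add: diff_divide_distrib)
  ultimately show ?thesis by simp
qed

lemma mob_in_ball:
  assumes a: "\<bar>a\<bar> < 1" and z: "cmod z < 1"
  shows "cmod (mob a z) < 1"
proof -
  have "a\<^sup>2 < 1" "(cmod z)\<^sup>2 < 1" using a z by (simp_all add: abs_square_less_1)
  then have "0 < (1 - a\<^sup>2) / (cmod (1 - of_real a * z))\<^sup>2 * (1 - (cmod z)\<^sup>2)"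
    using mob_denominator(2)[OF a, of z] z by (intro mult_pos_pos divide_pos_pos) auto
  then have "(cmod (mob a z))\<^sup>2 < 1" using one_minus_mob[OF a, of z] z by simp
  then show ?thesis by (simp add: abs_square_less_1)
qed

lemma mob_on_circle:
  assumes a: "\<bar>a\<bar> < 1" and z: "cmod z = 1"
  shows "cmod (mob a z) = 1"
  using one_minus_mob[OF a, of z] z by (simp add: power2_eq_1_iff) (smt (verit) norm_ge_zero)

lemma mob_inverse:
  assumes a: "\<bar>a\<bar> < 1" and z: "cmod z < 1"
  shows "mob (- a) (mob a z) = z"
proof -
  have 1: "1 - of_real a * z \<noteq> 0" using mob_denominator[OF a] z by simp
  have "complex_of_real (1 - a\<^sup>2) \<noteq> 0"
    unfolding of_real_eq_0_iff using a by (simp add: abs_square_eq_1)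
  then have 2: "1 - complex_of_real a * complex_of_real a \<noteq> 0" by (simp add: power2_eq_square)
  have 3: "mob a z + of_real a = z * (1 - of_real a * of_real a) / (1 - of_real a * z)"
    using 1 unfolding mob_def by (simp add: divide_simps) (simp add: algebra_simps)
  have 4: "1 + of_real a * mob a z = (1 - of_real a * of_real a) / (1 - of_real a * z)"
    using 1 unfolding mob_def by (simp add: divide_simps) (simp add: algebra_simps)
  have "mob (- a) (mob a z) = (mob a z + of_real a) / (1 + of_real a * mob a z)"
    by (simp add: mob_def[of "- a"])
  then show ?thesis using 1 2 unfolding 3 4 by simp
qed

lemma mob_bij:
  assumes a: "\<bar>a\<bar> < 1"
  shows "mob a ` ball 0 1 = ball 0 1" "inj_on (mob a) (ball 0 1)"
proof -
  show "inj_on (mob a) (ball 0 1)"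
    using mob_inverse[OF a] by (intro inj_on_inverseI[of _ "mob (- a)"]) auto
  show "mob a ` ball 0 1 = ball 0 1"
  proof (intro equalityI subsetI)
    fix z assume "z \<in> ball (0 :: complex) 1"
    then have "z = mob a (mob (- a) z)" "mob (- a) z \<in> ball 0 1"
      using mob_inverse[of "- a" z] mob_in_ball[of "- a" z] a by auto
    then show "z \<in> mob a ` ball 0 1" by blast
  qed (use mob_in_ball[OF a] in auto)
qed

lemma mob_derivative:
  assumes a: "\<bar>a\<bar> < 1" and z: "cmod z \<le> 1"
  shows "(mob a has_field_derivative of_real (1 - a\<^sup>2) / (1 - of_real a * z)\<^sup>2) (at z)"
  unfolding mob_def[abs_def] using mob_denominator(2)[OF a z]
  by (auto intro!: derivative_eq_intros simp: power2_eq_square algebra_simps)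

lemma mob_holomorphic:
  assumes a: "\<bar>a\<bar> < 1"
  shows "mob a holomorphic_on ball 0 1" "continuous_on (cball 0 1) (mob a)"
  unfolding mob_def[abs_def] using mob_denominator(2)[OF a]
  by (auto intro!: holomorphic_intros continuous_intros)

lemma mob_weight_holomorphic:
  assumes a: "\<bar>a\<bar> < 1"
  shows "mob_weight a s holomorphic_on ball 0 1" "continuous_on (cball 0 1) (mob_weight a s)"
proof -
  have *: "1 - of_real a * z \<notin> \<real>\<^sub>\<le>\<^sub>0" if "cmod z \<le> 1" for z
    using mob_denominator(1)[OF a that] by (auto simp: complex_nonpos_Reals_iff)
  show "mob_weight a s holomorphic_on ball 0 1"
    unfolding mob_weight_def[abs_def] using * by (intro holomorphic_intros) auto
  have "continuous_on (cball 0 1) (\<lambda>z. exp (complex_of_real (- s) * Ln (1 - of_real a * z)))"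
    using * by (intro continuous_intros) auto
  then have c: "continuous_on (cball 0 1) (\<lambda>z. of_real ((1 - a\<^sup>2) powr (s / 2)) * exp (complex_of_real (- s) * Ln (1 - of_real a * z)))"
    by (intro continuous_on_mult continuous_on_const)
  show "continuous_on (cball 0 1) (mob_weight a s)"
  proof (rule continuous_on_eq[OF c])
    fix z :: complex assume "z \<in> cball 0 1"
    then have "1 - of_real a * z \<noteq> 0" using mob_denominator(2)[OF a, of z] by simp
    then show "of_real ((1 - a\<^sup>2) powr (s / 2)) * exp (complex_of_real (- s) * Ln (1 - of_real a * z)) = mob_weight a s z"
      unfolding mob_weight_def powr_def by (simp only: if_False)
  qed
qed

lemma norm_mob_weight:
  assumes a: "\<bar>a\<bar> < 1" and z: "cmod z \<le> 1"
  shows "cmod (mob_weight a s z) = ((1 - a\<^sup>2) / (cmod (1 - of_real a * z))\<^sup>2) powr (s / 2)"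
proof -
  let ?d = "1 - of_real a * z :: complex"
  have nz: "?d \<noteq> 0" using mob_denominator(2)[OF a z] .
  have "cmod (?d powr of_real (- s)) = cmod ?d powr (- s)"
    using nz by (simp add: powr_def norm_exp_eq_Re)
  also have "\<dots> = inverse ((cmod ?d powr 2) powr (s / 2))"
    unfolding powr_powr by (simp add: powr_minus)
  also have "cmod ?d powr 2 = (cmod ?d)\<^sup>2" by simp
  finally have "cmod (?d powr of_real (- s)) = inverse ((cmod ?d)\<^sup>2 powr (s / 2))" .
  moreover have "cmod (complex_of_real ((1 - a\<^sup>2) powr (s / 2))) = (1 - a\<^sup>2) powr (s / 2)"
    unfolding norm_of_real by simp
  moreover have "0 \<le> 1 - a\<^sup>2" using a by (simp add: abs_square_le_1)
  ultimately show ?thesis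
    unfolding mob_weight_def norm_mult by (simp only: powr_divide zero_le_power2) (simp only: divide_inverse)
qed

definition mob_transform :: "real \<Rightarrow> real \<Rightarrow> (complex \<Rightarrow> complex) \<Rightarrow> complex \<Rightarrow> complex" where
  "mob_transform a s f z = f (mob a z) * mob_weight a s z"

lemma mob_transform_holomorphic:
  assumes a: "\<bar>a\<bar> < 1" and f: "f holomorphic_on ball 0 1"
  shows "mob_transform a s f holomorphic_on ball 0 1"
proof -
  have "(f \<circ> mob a) holomorphic_on ball 0 1"
    using f mob_bij[OF a] by (intro holomorphic_on_compose mob_holomorphic[OF a]) auto
  then show ?thesis
    unfolding mob_transform_def[abs_def] using mob_weight_holomorphic(1)[OF a, of s]
    by (auto simp: o_def intro!: holomorphic_intros)
qed

text \<open>With \<open>D = |mob'|\<close> one has \<open>1 - |mob z|\<^sup>2 = D (1 - |z|\<^sup>2)\<close>, so the weight to the power \<open>\<beta>\<close> together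
  with the Jacobian \<open>D\<^sup>2\<close> is compensated by the \<open>q\<close>-th power of \<open>mob_weight\<close>, which is \<open>D\<^sup>\<beta>\<^sup>+\<^sup>2\<close>. For
  \<open>s = \<alpha> + 2\<close> the condition holds both for \<open>q = 2, \<beta> = \<alpha>\<close> and for \<open>q = p, \<beta> = \<gamma> - 2\<close>.\<close>

theorem weighted_integral_mob_transform:
  assumes a: "\<bar>a\<bar> < 1" and f: "f holomorphic_on ball 0 1" and q: "q > 0" and s: "q * s / 2 = \<beta> + 2"
  shows "(\<integral>\<^sup>+z. ennreal ((1 - (cmod z)\<^sup>2) powr \<beta> * cmod (mob_transform a s f z) powr q) \<partial>disk_area)
     = (\<integral>\<^sup>+z. ennreal ((1 - (cmod z)\<^sup>2) powr \<beta> * cmod (f z) powr q) \<partial>disk_area)"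
proof -
  have m: "(\<lambda>z. ennreal ((1 - (cmod z)\<^sup>2) powr \<beta> * cmod (h z) powr q)) \<in> borel_measurable (restrict_space borel (ball 0 1))"
    if h: "h holomorphic_on ball 0 1" for h
  proof -
    have "continuous_on (ball 0 1) (\<lambda>z. cmod (h z) powr q)"
      by (rule continuous_on_cmod_powr[OF h q])
    from borel_measurable_on_disk[OF this, of "\<lambda>r. ennreal ((1 - r\<^sup>2) powr \<beta>)"]
    show ?thesis by (simp add: ennreal_mult mult.commute)
  qed
  let ?F = "\<lambda>w. ennreal ((1 - (cmod w)\<^sup>2) powr \<beta> * cmod (f w) powr q)"
  have mF: "(\<lambda>w. ?F w * indicator (ball 0 1) w) \<in> borel_measurable borel"
    using m[OF f] by (subst (asm) borel_measurable_restrict_space_iff_ennreal) auto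
  have "(\<integral>\<^sup>+w\<in>ball 0 1. ?F w \<partial>lborel) = (\<integral>\<^sup>+w. ?F w * indicator (ball 0 1) w * indicator (mob a ` ball 0 1) w \<partial>lborel)"
    unfolding mob_bij(1)[OF a] by (intro nn_integral_cong) (simp add: indicator_def)
  also have "\<dots> = (\<integral>\<^sup>+z. ?F (mob a z) * indicator (ball 0 1) (mob a z) * ennreal ((cmod (deriv (mob a) z))\<^sup>2) * indicator (ball 0 1) z \<partial>lborel)"
    by (rule nn_integral_holomorphic_substitution[OF _ mob_holomorphic(1)[OF a] mob_bij(2)[OF a] mF]) simp
  also have "\<dots> = (\<integral>\<^sup>+z\<in>ball 0 1. ennreal ((1 - (cmod z)\<^sup>2) powr \<beta> * cmod (mob_transform a s f z) powr q) \<partial>lborel)"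
  proof (intro nn_integral_cong)
    fix z :: complex
    have "(1 - (cmod (mob a z))\<^sup>2) powr \<beta> * cmod (f (mob a z)) powr q * (cmod (deriv (mob a) z))\<^sup>2
        = (1 - (cmod z)\<^sup>2) powr \<beta> * cmod (mob_transform a s f z) powr q" if z: "cmod z < 1"
    proof -
      define D where "D = (1 - a\<^sup>2) / (cmod (1 - of_real a * z))\<^sup>2"
      have "a\<^sup>2 < 1" using a by (simp add: abs_square_less_1)
      then have D: "D > 0" unfolding D_def using mob_denominator(2)[OF a, of z] z by (intro divide_pos_pos) auto
      have z2: "0 < 1 - (cmod z)\<^sup>2" using z by (simp add: abs_square_less_1)
      have d: "cmod (deriv (mob a) z) = D"
        using DERIV_imp_deriv[OF mob_derivative[OF a, of z]] z \<open>a\<^sup>2 < 1\<close>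
        by (simp add: D_def norm_divide norm_power del: of_real_diff)
      have "cmod (mob_transform a s f z) powr q = cmod (f (mob a z)) powr q * D powr (s / 2 * q)"
        using norm_mob_weight[OF a, of z s] z by (simp add: mob_transform_def norm_mult powr_mult powr_powr D_def)
      also have "s / 2 * q = \<beta> + 2" using s by (simp add: mult.commute)
      also have "D powr (\<beta> + 2) = D powr \<beta> * D\<^sup>2" using D by (simp add: powr_add powr_numeral)
      finally have g: "cmod (mob_transform a s f z) powr q = cmod (f (mob a z)) powr q * (D powr \<beta> * D\<^sup>2)" .
      have "(1 - (cmod (mob a z))\<^sup>2) powr \<beta> = D powr \<beta> * (1 - (cmod z)\<^sup>2) powr \<beta>"
        using one_minus_mob[OF a, of z] z z2 D by (simp add: D_def[symmetric] powr_mult)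
      then show ?thesis unfolding d g by simp
    qed
    then show "?F (mob a z) * indicator (ball 0 1) (mob a z) * ennreal ((cmod (deriv (mob a) z))\<^sup>2) * indicator (ball 0 1) z
       = ennreal ((1 - (cmod z)\<^sup>2) powr \<beta> * cmod (mob_transform a s f z) powr q) * indicator (ball 0 1) z"
      using mob_in_ball[OF a, of z] by (cases "cmod z < 1") (simp_all flip: ennreal_mult)
  qed
  finally show ?thesis
    unfolding nn_integral_disk_area[OF m[OF f]] nn_integral_disk_area[OF m[OF mob_transform_holomorphic[OF a f]]] by simp
qed

text \<open>Cauchy's formula at the point \<open>a\<close> for \<open>h(u) (1 - a\<^sup>2) / (1 - a u)\<close>, a function with the value \<open>h(a)\<close> at
  \<open>a\<close>. On the unit circle \<open>u - a\<close> is \<open>u\<close> times the conjugate of \<open>1 - a u\<close>, so Cauchy's kernel becomes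
  the Poisson kernel.\<close>

lemma Poisson_formula:
  assumes a: "\<bar>a\<bar> < 1" and h: "h holomorphic_on ball 0 1" "continuous_on (cball 0 1) h"
  shows "((\<lambda>t. h (cis t) * of_real ((1 - a\<^sup>2) / (cmod (1 - of_real a * cis t))\<^sup>2)) has_integral of_real (2 * pi) * h (of_real a)) {0..2 * pi}"
proof -
  define F where "F u = h u * of_real (1 - a\<^sup>2) / (1 - of_real a * u)" for u
  have a2: "a\<^sup>2 < 1" using a by (simp add: abs_square_less_1)
  have F: "continuous_on (cball 0 1) F" "F holomorphic_on ball 0 1"
    unfolding F_def[abs_def] using h mob_denominator(2)[OF a] by (auto intro!: continuous_intros holomorphic_intros)
  have "((\<lambda>u. F u / (u - of_real a)) has_contour_integral (2 * of_real pi * \<i> * F (of_real a))) (circlepath 0 1)"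
    using a by (intro Cauchy_integral_circlepath F) auto
  then have "((\<lambda>t. F (0 + 1 * cis t) / (0 + 1 * cis t - of_real a) * 1 * \<i> * cis t) has_integral (2 * of_real pi * \<i> * F (of_real a))) {0..2 * pi}"
    unfolding circlepath_def by (subst (asm) has_contour_integral_part_circlepath_iff) simp_all
  then have "((\<lambda>t. - \<i> * (F (0 + 1 * cis t) / (0 + 1 * cis t - of_real a) * 1 * \<i> * cis t)) has_integral - \<i> * (2 * of_real pi * \<i> * F (of_real a))) {0..2 * pi}"
    by (rule has_integral_mult_right)
  moreover have "- \<i> * (2 * of_real pi * \<i> * F (of_real a)) = of_real (2 * pi) * h (of_real a)"
  proof -
    have "1 - complex_of_real a * complex_of_real a = of_real (1 - a\<^sup>2)" by (simp add: power2_eq_square)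
    then have "F (of_real a) = h (of_real a)" using a2 by (simp add: F_def del: of_real_diff)
    then show ?thesis by simp
  qed
  moreover have "- \<i> * (F (0 + 1 * cis t) / (0 + 1 * cis t - of_real a) * 1 * \<i> * cis t)
      = h (cis t) * of_real ((1 - a\<^sup>2) / (cmod (1 - of_real a * cis t))\<^sup>2)" for t
  proof -
    let ?u = "cis t" and ?d = "1 - of_real a * cis t"
    have d: "?d \<noteq> 0" using mob_denominator(2)[OF a, of "cis t"] by simp
    have "?u - of_real a = ?u * cnj ?d"
      by (simp add: algebra_simps) (simp add: cis_cnj cis_mult)
    moreover have "of_real ((cmod ?d)\<^sup>2) = ?d * cnj ?d" by (rule complex_norm_square)
    ultimately show ?thesis using d
      unfolding F_def by (simp add: divide_simps) (simp add: algebra_simps)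
  qed
  ultimately show ?thesis by (simp only:)
qed

lemma circle_int_0: "circle_int u 0 = integral {0..2 * pi} (\<lambda>t. u (cis t))"
  by (simp add: circle_int_def polar_eq_cis[of 0, simplified])

text \<open>The Hardy space case of the invariance. The right-hand side does not depend on \<open>a\<close>, so it can be compared
  with \<open>a = 0\<close>. The induction splits off the constant coefficient: on the unit circle
  \<open>|c + \<phi> P(\<phi>)|\<^sup>2 = |c|\<^sup>2 + |P(\<phi>)|\<^sup>2 + 2 Re (c\<^sup>* \<phi> P(\<phi>))\<close> with \<open>\<phi> = mob a\<close>, where the last term is harmonic
  and vanishes at \<open>a\<close>, so that its Poisson integral is \<open>0\<close>.\<close>

lemma mob_square_mean_polynomial:
  assumes a: "\<bar>a\<bar> < 1"
  shows "circle_int (\<lambda>z. (cmod (mob_transform a 1 (poly P) z))\<^sup>2) 0 = 2 * pi * (\<Sum>c\<leftarrow>coeffs P. (cmod c)\<^sup>2)"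
proof -
  define \<kappa> where "\<kappa> t = (1 - a\<^sup>2) / (cmod (1 - of_real a * cis t))\<^sup>2" for t
  have \<kappa>0: "\<kappa> t \<ge> 0" for t using a by (simp add: \<kappa>_def abs_square_le_1)
  have Poi: "((\<lambda>t. Re (h (cis t)) * \<kappa> t) has_integral 2 * pi * Re (h (of_real a))) {0..2 * pi}"
    if "h holomorphic_on ball 0 1" "continuous_on (cball 0 1) h" for h
    using has_integral_linear[OF Poisson_formula[OF a that] bounded_linear_Re]
    by (simp add: o_def \<kappa>_def)
  have main: "((\<lambda>t. (cmod (poly P (mob a (cis t))))\<^sup>2 * \<kappa> t) has_integral 2 * pi * (\<Sum>c\<leftarrow>coeffs P. (cmod c)\<^sup>2)) {0..2 * pi}"
  proof (induction P)
    case 0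
    then show ?case by simp
  next
    case (pCons c P)
    let ?h = "\<lambda>z. cnj c * (mob a z * poly P (mob a z))"
    have "?h holomorphic_on ball 0 1" "continuous_on (cball 0 1) ?h"
      using mob_holomorphic[OF a] by (auto intro!: holomorphic_intros continuous_intros)
    from Poi[OF this] have 1: "((\<lambda>t. Re (?h (cis t)) * \<kappa> t) has_integral 0) {0..2 * pi}"
      by (simp add: mob_def)
    have 2: "((\<lambda>t. (cmod c)\<^sup>2 * \<kappa> t) has_integral 2 * pi * (cmod c)\<^sup>2) {0..2 * pi}"
      using Poi[of "\<lambda>_. of_real ((cmod c)\<^sup>2)"] by (simp del: of_real_power)
    have eq: "(cmod (poly (pCons c P) (mob a (cis t))))\<^sup>2 * \<kappa> t = 
       (cmod c)\<^sup>2 * \<kappa> t + (cmod (poly P (mob a (cis t))))\<^sup>2 * \<kappa> t + 2 * (Re (?h (cis t)) * \<kappa> t)" for t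
    proof -
      have *: "(cmod (c + w * v))\<^sup>2 = (cmod c)\<^sup>2 + (cmod (w * v))\<^sup>2 + 2 * Re (cnj c * (w * v))" for w v
        by (simp add: cmod_power2) (simp add: power2_eq_square algebra_simps)
      show ?thesis
        using mob_on_circle[OF a, of "cis t"] by (simp add: * norm_mult algebra_simps)
    qed
    have "((\<lambda>t. (cmod (poly (pCons c P) (mob a (cis t))))\<^sup>2 * \<kappa> t) has_integral
       2 * pi * (cmod c)\<^sup>2 + 2 * pi * (\<Sum>c\<leftarrow>coeffs P. (cmod c)\<^sup>2) + 2 * 0) {0..2 * pi}"
      unfolding eq by (intro has_integral_add has_integral_mult_right 1 2 pCons.IH)
    then show ?case using pCons.hyps by (simp add: cCons_def distrib_left split: if_splits)
  qed
  have "(cmod (mob_transform a 1 (poly P) (cis t)))\<^sup>2 = (cmod (poly P (mob a (cis t))))\<^sup>2 * \<kappa> t" for t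
    using \<kappa>0[of t] norm_mob_weight[OF a, of "cis t" 1]
    by (simp add: mob_transform_def norm_mult power_mult_distrib \<kappa>_def[symmetric] powr_half_sqrt)
  then show ?thesis using main by (simp add: circle_int_0 integral_unique)
qed

text \<open>For \<open>\<alpha> > -1\<close> equality is an instance of the invariance of weighted integrals. For the Hardy space,
  square means increase to the one over the unit circle, where the previous lemma applies.\<close>

theorem bergman_norm_2_mob_transform_le:
  assumes a: "\<bar>a\<bar> < 1" and \<alpha>: "\<alpha> \<ge> -1"
  shows "bergman_norm 2 \<alpha> (mob_transform a (\<alpha> + 2) (poly P)) \<le> bergman_norm 2 \<alpha> (poly P)"
proof (cases "\<alpha> = -1")
  case False
  have "poly P holomorphic_on ball 0 1" by (intro holomorphic_intros)
  from weighted_integral_mob_transform[OF a this, of 2 "\<alpha> + 2" \<alpha>] False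
  show ?thesis by (simp add: bergman_norm_def)
next
  case True
  let ?g = "mob_transform a 1 (poly P)"
  have P: "poly P holomorphic_on ball 0 1" "continuous_on (cball 0 1) (poly P)"
    by (auto intro!: holomorphic_intros continuous_intros)
  have g: "?g holomorphic_on ball 0 1" "continuous_on (cball 0 1) ?g"
    using mob_transform_holomorphic[OF a P(1)] mob_holomorphic(2)[OF a] mob_weight_holomorphic(2)[OF a, of 1]
    by (auto simp: mob_transform_def[abs_def] intro!: continuous_intros)
  have "mob_transform 0 1 (poly P) = poly P"
    by (simp add: mob_transform_def[abs_def] mob_def mob_weight_def)
  then have eq: "circle_sq ?g 0 = circle_sq (poly P) 0"
    using mob_square_mean_polynomial[OF a, of P] mob_square_mean_polynomial[of 0 P] by simp
  have bd: "ennreal (sqrt (circle_sq (poly P) 0 / (2 * pi))) \<le> hardy_norm 2 (poly P)"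
  proof (rule tendsto_upperbound)
    have "((\<lambda>y. circle_sq (poly P) y) \<longlongrightarrow> circle_sq (poly P) 0) (at_right 0)"
      by (intro circle_int_right_limit continuous_intros)
    then show "((\<lambda>y. ennreal (sqrt (circle_sq (poly P) y / (2 * pi)))) \<longlongrightarrow> ennreal (sqrt (circle_sq (poly P) 0 / (2 * pi)))) (at_right 0)"
      by (intro tendsto_ennrealI tendsto_intros) auto
    show "\<forall>\<^sub>F y in at_right 0. ennreal (sqrt (circle_sq (poly P) y / (2 * pi))) \<le> hardy_norm 2 (poly P)"
      unfolding hardy_norm_eq[OF P(1)]
      by (rule eventually_mono[OF eventually_at_right_less]) (rule SUP_upper, simp)
  qed simp
  have "hardy_norm 2 ?g \<le> hardy_norm 2 (poly P)"
    unfolding hardy_norm_eq[OF g(1)]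
  proof (rule SUP_least)
    fix y :: real assume "y \<in> {0<..}"
    then have "circle_sq ?g y \<le> circle_sq (poly P) 0"
      using circle_int_square_le_boundary[OF g, of y] eq by simp
    then have "ennreal (sqrt (circle_sq ?g y / (2 * pi))) \<le> ennreal (sqrt (circle_sq (poly P) 0 / (2 * pi)))"
      by (intro ennreal_leI real_sqrt_le_mono divide_right_mono) auto
    with bd show "ennreal (sqrt (circle_sq ?g y / (2 * pi))) \<le> hardy_norm 2 (poly P)" by order
  qed
  then show ?thesis using True by (simp add: bergman_norm_def)
qed

section \<open>From tails to all functions\<close>

lemma bergman_norm_eq_pow:
  assumes "\<gamma> > 1"
  shows "bergman_norm p (\<gamma> - 2) f = ennpowr (bergman_pow p \<gamma> f) (1 / p)"
  using assms by (simp add: bergman_norm_def bergman_pow_def)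

lemma space_disk_area: "space disk_area = ball 0 1"
  by (simp add: disk_area_def space_restrict_space space_scale_measure)

lemma bergman_pow_mono:
  assumes "p > 0" "\<And>z. z \<in> ball 0 1 \<Longrightarrow> cmod (f z) \<le> cmod (g z)"
  shows "bergman_pow p \<gamma> f \<le> bergman_pow p \<gamma> g"
  unfolding bergman_pow_def using assms
  by (intro mult_left_mono nn_integral_mono ennreal_leI powr_mono2) (auto simp: space_disk_area)

lemma bergman_pow_const:
  assumes "p > 2" "\<gamma> > 1"
  shows "bergman_pow p \<gamma> (\<lambda>_. c) = ennreal (cmod c powr p)"
  using assms by (subst Littlewood_Paley) (auto simp: theta_def circle_mean_def)

lemma measurable_disk_area_power:
  assumes h: "h holomorphic_on ball 0 1" and q: "q > 0"
  shows "(\<lambda>z. ennreal ((1 - (cmod z)\<^sup>2) powr \<beta> * cmod (h z) powr q)) \<in> borel_measurable disk_area"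
proof -
  have "continuous_on (ball 0 1) (\<lambda>z. cmod (h z) powr q)"
    by (rule continuous_on_cmod_powr[OF h q])
  from borel_measurable_on_disk[OF this, of "\<lambda>r. ennreal ((1 - r\<^sup>2) powr \<beta>)"]
  have "(\<lambda>z. ennreal ((1 - (cmod z)\<^sup>2) powr \<beta> * cmod (h z) powr q)) \<in> borel_measurable (restrict_space borel (ball 0 1))"
    by (simp add: ennreal_mult mult.commute)
  moreover have "sets disk_area = sets (restrict_space borel (ball (0 :: complex) 1))"
    by (simp add: disk_area_def sets_restrict_space)
  ultimately show ?thesis by (simp cong: measurable_cong_sets)
qed

text \<open>Since \<open>x + y\<close> is the convex combination of \<open>x / (1 - s)\<close> and \<open>y / s\<close> with the weights \<open>1 - s\<close> and \<open>s\<close>,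
  it is at most one of them. In \<open>bergman_pow_add_le\<close> this replaces Minkowski's inequality; the factor
  of the first term tends to \<open>1\<close> with \<open>s\<close>.\<close>

lemma powr_add_le:
  fixes x y s p :: real
  assumes "x \<ge> 0" "y \<ge> 0" "0 < s" "s < 1" "p > 0"
  shows "(x + y) powr p \<le> (1 - s) powr (- p) * x powr p + s powr (- p) * y powr p"
proof -
  have A: "(x / (1 - s)) powr p = (1 - s) powr (- p) * x powr p" and B: "(y / s) powr p = s powr (- p) * y powr p"
    using assms by (simp_all add: powr_divide powr_minus_divide)
  have e: "x + y = (1 - s) * (x / (1 - s)) + s * (y / s)" using assms by simp
  show ?thesis
  proof (cases "x / (1 - s) \<le> y / s")
    case True
    then have "(1 - s) * (x / (1 - s)) \<le> (1 - s) * (y / s)" using assms by (intro mult_left_mono) auto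
    then have "x + y \<le> (1 - s) * (y / s) + s * (y / s)" unfolding e by linarith
    also have "\<dots> = y / s" unfolding distrib_right[symmetric] by simp
    finally have "(x + y) powr p \<le> (y / s) powr p" using assms by (intro powr_mono2) auto
    then show ?thesis unfolding B by (rule order_trans) simp
  next
    case False
    then have "s * (y / s) \<le> s * (x / (1 - s))" using assms by (intro mult_left_mono) auto
    then have "x + y \<le> (1 - s) * (x / (1 - s)) + s * (x / (1 - s))" unfolding e by linarith
    also have "\<dots> = x / (1 - s)" unfolding distrib_right[symmetric] by simp
    finally have "(x + y) powr p \<le> (x / (1 - s)) powr p" using assms by (intro powr_mono2) auto
    then show ?thesis unfolding A by (rule order_trans) simp
  qed
qed

lemma bergman_pow_add_le:
  assumes f: "f holomorphic_on ball 0 1" and g: "g holomorphic_on ball 0 1" and s: "0 < s" "s < 1" and p: "p > 0"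
  shows "bergman_pow p \<gamma> (\<lambda>z. f z + g z) \<le> ennreal ((1 - s) powr (- p)) * bergman_pow p \<gamma> f + ennreal (s powr (- p)) * bergman_pow p \<gamma> g"
proof -
  let ?w = "\<lambda>z. (1 - (cmod z)\<^sup>2) powr (\<gamma> - 2)"
  have "(\<integral>\<^sup>+z. ennreal (?w z * cmod (f z + g z) powr p) \<partial>disk_area)
    \<le> (\<integral>\<^sup>+z. ennreal ((1 - s) powr (- p)) * ennreal (?w z * cmod (f z) powr p) + ennreal (s powr (- p)) * ennreal (?w z * cmod (g z) powr p) \<partial>disk_area)"
  proof (intro nn_integral_mono)
    fix z :: complex
    have "cmod (f z + g z) powr p \<le> (cmod (f z) + cmod (g z)) powr p"
      using p by (intro powr_mono2 norm_triangle_ineq) auto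
    also have "\<dots> \<le> (1 - s) powr (- p) * cmod (f z) powr p + s powr (- p) * cmod (g z) powr p"
      by (rule powr_add_le) (use s p in auto)
    finally have "?w z * cmod (f z + g z) powr p \<le> ?w z * ((1 - s) powr (- p) * cmod (f z) powr p + s powr (- p) * cmod (g z) powr p)"
      by (rule mult_left_mono) simp
    then show "ennreal (?w z * cmod (f z + g z) powr p) \<le> ennreal ((1 - s) powr (- p)) * ennreal (?w z * cmod (f z) powr p) + ennreal (s powr (- p)) * ennreal (?w z * cmod (g z) powr p)"
      by (simp add: algebra_simps flip: ennreal_mult ennreal_plus)
  qed
  also have "\<dots> = ennreal ((1 - s) powr (- p)) * (\<integral>\<^sup>+z. ennreal (?w z * cmod (f z) powr p) \<partial>disk_area) + ennreal (s powr (- p)) * (\<integral>\<^sup>+z. ennreal (?w z * cmod (g z) powr p) \<partial>disk_area)"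
    using measurable_disk_area_power[OF f p, of "\<gamma> - 2"] measurable_disk_area_power[OF g p, of "\<gamma> - 2"]
    by (simp add: nn_integral_add nn_integral_cmult)
  finally have "bergman_pow p \<gamma> (\<lambda>z. f z + g z) \<le> ennreal (\<gamma> - 1) * \<dots>"
    unfolding bergman_pow_def by (rule mult_left_mono) simp
  also have "\<dots> = ennreal ((1 - s) powr (- p)) * bergman_pow p \<gamma> f + ennreal (s powr (- p)) * bergman_pow p \<gamma> g"
    unfolding bergman_pow_def by (simp add: distrib_left mult_ac)
  finally show ?thesis .
qed

lemma bergman_norm_2_cmult:
  assumes h: "h holomorphic_on ball 0 1" and k: "k > 0"
  shows "bergman_norm 2 \<alpha> (\<lambda>z. of_real k * h z) = ennreal k * bergman_norm 2 \<alpha> h"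
proof (cases "\<alpha> = -1")
  case True
  have kh: "(\<lambda>z. of_real k * h z) holomorphic_on ball 0 1" using h by (intro holomorphic_intros)
  have "hardy_norm 2 (\<lambda>z. of_real k * h z) = (SUP y\<in>{0<..}. ennreal k * ennreal (sqrt (circle_sq h y / (2 * pi))))"
    unfolding hardy_norm_eq[OF kh]
  proof (rule SUP_cong)
    fix y :: real
    have "circle_int (\<lambda>z. (cmod (of_real k * h z))\<^sup>2) y = k\<^sup>2 * circle_sq h y"
      by (simp add: circle_int_def norm_mult power_mult_distrib)
    then have "sqrt (circle_int (\<lambda>z. (cmod (of_real k * h z))\<^sup>2) y / (2 * pi)) = sqrt (k\<^sup>2 * (circle_sq h y / (2 * pi)))"
      by simp
    also have "\<dots> = k * sqrt (circle_sq h y / (2 * pi))"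
      using k unfolding real_sqrt_mult by simp
    finally show "ennreal (sqrt (circle_int (\<lambda>z. (cmod (of_real k * h z))\<^sup>2) y / (2 * pi))) = ennreal k * ennreal (sqrt (circle_sq h y / (2 * pi)))"
      using k by (simp only: ennreal_mult')
  qed simp
  also have "\<dots> = ennreal k * hardy_norm 2 h"
    unfolding hardy_norm_eq[OF h] by (rule SUP_mult_left_ennreal[symmetric])
  finally show ?thesis using True by (simp add: bergman_norm_def)
next
  case False
  have ep: "ennpowr (ennreal (k\<^sup>2) * x) (1 / 2) = ennreal k * ennpowr x (1 / 2)" for x
  proof (cases x)
    case (real r)
    have "(k\<^sup>2 * r) powr (1 / 2) = k * r powr (1 / 2)"
      using k real by (simp add: powr_half_sqrt real_sqrt_mult)
    then show ?thesis using real k by (simp add: ennpowr_def flip: ennreal_mult)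
  next
    case top
    then show ?thesis using k by (simp add: ennpowr_def ennreal_mult_top)
  qed
  have "(\<integral>\<^sup>+z. ennreal ((1 - (cmod z)\<^sup>2) powr \<alpha> * cmod (of_real k * h z) powr 2) \<partial>disk_area)
     = (\<integral>\<^sup>+z. ennreal (k\<^sup>2) * ennreal ((1 - (cmod z)\<^sup>2) powr \<alpha> * cmod (h z) powr 2) \<partial>disk_area)"
    by (intro nn_integral_cong) (simp add: norm_mult power_mult_distrib mult_ac flip: ennreal_mult')
  also have "\<dots> = ennreal (k\<^sup>2) * (\<integral>\<^sup>+z. ennreal ((1 - (cmod z)\<^sup>2) powr \<alpha> * cmod (h z) powr 2) \<partial>disk_area)"
    by (rule nn_integral_cmult[OF measurable_disk_area_power[OF h]]) simp
  finally show ?thesis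
    using False by (simp only: bergman_norm_def if_False mult.left_commute[of "ennreal (\<alpha> + 1)"] ep)
qed

lemma eq_0_if_weighted_integral_eq_0:
  assumes h: "h holomorphic_on ball 0 1" and I: "(\<integral>\<^sup>+z. ennreal ((1 - (cmod z)\<^sup>2) powr \<beta> * cmod (h z) powr 2) \<partial>disk_area) = 0"
    and z: "z \<in> ball 0 1"
  shows "h z = 0"
proof (rule ccontr)
  assume "h z \<noteq> 0"
  let ?F = "\<lambda>z. ennreal ((1 - (cmod z)\<^sup>2) powr \<beta> * cmod (h z) powr 2)"
  define U where "U = {z \<in> ball 0 1. h z \<noteq> 0}"
  have "U = ball 0 1 \<inter> h -` (- {0})" by (auto simp: U_def)
  then have "open U"
    using continuous_open_preimage[OF holomorphic_on_imp_continuous_on[OF h] open_ball, of "- {0}"] by auto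
  moreover have "z \<in> U" using z \<open>h z \<noteq> 0\<close> by (simp add: U_def)
  ultimately have "\<not> negligible U" using open_not_negligible by blast
  moreover have "emeasure disk_area {x \<in> space disk_area. ?F x \<noteq> 0} = 0"
    using nn_integral_0_iff[OF measurable_disk_area_power[OF h], of 2 \<beta>] I by simp
  moreover have "{x \<in> space disk_area. ?F x \<noteq> 0} = U"
  proof -
    have "?F x \<noteq> 0 \<longleftrightarrow> h x \<noteq> 0" if "x \<in> ball 0 1" for x
    proof -
      have "1 - (cmod x)\<^sup>2 > 0" using that by (simp add: abs_square_less_1)
      then have "(1 - (cmod x)\<^sup>2) powr \<beta> > 0" by simp
      then show ?thesis by (auto simp: ennreal_eq_0_iff mult_le_0_iff not_le)
    qed
    then show ?thesis unfolding U_def space_disk_area by blast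
  qed
  ultimately have "emeasure disk_area U = 0" by simp
  moreover have "emeasure (restrict_space lborel (ball 0 1)) U = emeasure lborel U"
    by (rule emeasure_restrict_space) (auto simp: U_def)
  ultimately have "ennreal (1 / pi) * emeasure lborel U = 0" by (simp add: disk_area_def)
  moreover have "ennreal (1 / pi) \<noteq> 0" using pi_gt_zero by (simp add: ennreal_eq_0_iff not_le)
  ultimately have "emeasure lborel U = 0" unfolding mult_eq_0_iff by blast
  then have "U \<in> null_sets lebesgue" using \<open>open U\<close> by (auto simp: null_sets_def)
  then have "negligible U" by (simp add: negligible_iff_null_sets)
  with \<open>\<not> negligible U\<close> show False by simp
qed

text \<open>Condition (c) is extended from the unit sphere to all functions by scaling; this covers norm \<open>0\<close>.\<close>

lemma eq_0_if_bergman_norm_eq_0: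
  assumes h: "h holomorphic_on ball 0 1" and \<alpha>: "\<alpha> \<ge> -1" and n: "bergman_norm 2 \<alpha> h = 0" and z: "z \<in> ball 0 1"
  shows "h z = 0"
proof (cases "\<alpha> = -1")
  case False
  have ep: "x = 0" if "ennpowr x (1 / 2) = 0" for x
    using that by (cases x) (simp_all add: ennpowr_def ennreal_eq_0_iff)
  have "ennreal (\<alpha> + 1) * (\<integral>\<^sup>+z. ennreal ((1 - (cmod z)\<^sup>2) powr \<alpha> * cmod (h z) powr 2) \<partial>disk_area) = 0"
    using n False by - (rule ep, simp add: bergman_norm_def)
  moreover have "ennreal (\<alpha> + 1) \<noteq> 0" using False \<alpha> by (simp add: ennreal_eq_0_iff)
  ultimately have "(\<integral>\<^sup>+z. ennreal ((1 - (cmod z)\<^sup>2) powr \<alpha> * cmod (h z) powr 2) \<partial>disk_area) = 0"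
    unfolding mult_eq_0_iff by blast
  then show ?thesis by (rule eq_0_if_weighted_integral_eq_0[OF h _ z])
next
  case True
  have c: "continuous_on (ball 0 1) (\<lambda>z. (cmod (h z))\<^sup>2)"
    using h by (intro continuous_intros holomorphic_on_imp_continuous_on)
  have "circle_sq h y = 0" if y: "y > 0" for y
  proof -
    have "ennreal (sqrt (circle_sq h y / (2 * pi))) \<le> hardy_norm 2 h"
      unfolding hardy_norm_eq[OF h] using y by (intro SUP_upper) auto
    then have "circle_sq h y / (2 * pi) \<le> 0"
      using n True by (simp add: bergman_norm_def ennreal_eq_0_iff)
    then show ?thesis
      using circle_int_square_nonneg[OF h y] pi_gt_zero by (simp add: divide_le_0_iff)
  qed
  then have "circle_mean (\<lambda>z. ennreal ((cmod (h z))\<^sup>2)) y = 0" if "y > 0" for y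
    using circle_mean_eq_circle_int(1)[OF c _ that] that by simp
  then have "(\<integral>\<^sup>+y\<in>{0<..}. ennreal (2 * exp (- 2 * y)) * ennreal ((1 - (exp (- y))\<^sup>2) powr 0) * circle_mean (\<lambda>z. ennreal ((cmod (h z))\<^sup>2)) y \<partial>lborel) = (\<integral>\<^sup>+y. 0 \<partial>(lborel :: real measure))"
    by (intro nn_integral_cong) (auto simp: indicator_def)
  then have "(\<integral>\<^sup>+z. ennreal ((cmod (h z))\<^sup>2) * ennreal ((1 - (cmod z)\<^sup>2) powr 0) \<partial>disk_area) = 0"
    by (subst nn_integral_disk_radial[OF c, where \<rho> = "\<lambda>r. ennreal ((1 - r\<^sup>2) powr 0)"]) simp_all
  then have "(\<integral>\<^sup>+z. ennreal ((1 - (cmod z)\<^sup>2) powr 0 * cmod (h z) powr 2) \<partial>disk_area) = 0"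
    by (simp add: ennreal_mult mult.commute)
  then show ?thesis by (rule eq_0_if_weighted_integral_eq_0[OF h _ z])
qed

lemma measurable_deriv_energy:
  assumes h: "h holomorphic_on ball 0 1" and p: "p > 2"
  shows "(\<lambda>z. ennreal ((cmod (deriv h z))\<^sup>2 * cmod (h z) powr (p - 2) * (1 - (cmod z)\<^sup>2) powr \<gamma>)) \<in> borel_measurable disk_area"
proof -
  have "continuous_on (ball 0 1) (\<lambda>z. (cmod (deriv h z))\<^sup>2 * cmod (h z) powr (p - 2))"
    using h p by (intro continuous_on_powr' continuous_intros holomorphic_on_imp_continuous_on holomorphic_deriv) auto
  from borel_measurable_on_disk[OF this, of "\<lambda>r. ennreal ((1 - r\<^sup>2) powr \<gamma>)"]
  have "(\<lambda>z. ennreal ((cmod (deriv h z))\<^sup>2 * cmod (h z) powr (p - 2) * (1 - (cmod z)\<^sup>2) powr \<gamma>)) \<in> borel_measurable (restrict_space borel (ball 0 1))"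
    by (simp add: ennreal_mult)
  moreover have "sets disk_area = sets (restrict_space borel (ball (0 :: complex) 1))"
    by (simp add: disk_area_def sets_restrict_space)
  ultimately show ?thesis by (simp cong: measurable_cong_sets)
qed

lemma deriv_energy_cmult:
  assumes h: "h holomorphic_on ball 0 1" and k: "k > 0" and p: "p > 2"
  shows "deriv_energy p \<gamma> (\<lambda>z. of_real k * h z) = ennreal (k powr p) * deriv_energy p \<gamma> h"
proof -
  note m = measurable_deriv_energy[OF h p, of \<gamma>]
  have "deriv_energy p \<gamma> (\<lambda>z. of_real k * h z) = (\<integral>\<^sup>+ z. ennreal (k powr p) * ennreal ((cmod (deriv h z))\<^sup>2 * cmod (h z) powr (p - 2) * (1 - (cmod z)\<^sup>2) powr \<gamma>) \<partial>disk_area)"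
    unfolding deriv_energy_def
  proof (intro nn_integral_cong)
    fix z assume "z \<in> space disk_area"
    then have z: "z \<in> ball 0 1" by (simp add: space_disk_area)
    then have "h field_differentiable at z" using h holomorphic_on_imp_differentiable_at by blast
    then have d: "deriv (\<lambda>z. of_real k * h z) z = of_real k * deriv h z" by (rule deriv_cmult)
    have "k powr p = k\<^sup>2 * k powr (p - 2)" using k by (simp add: powr_diff powr_numeral)
    then show "ennreal ((cmod (deriv (\<lambda>z. of_real k * h z) z))\<^sup>2 * cmod (of_real k * h z) powr (p - 2) * (1 - (cmod z)\<^sup>2) powr \<gamma>)
       = ennreal (k powr p) * ennreal ((cmod (deriv h z))\<^sup>2 * cmod (h z) powr (p - 2) * (1 - (cmod z)\<^sup>2) powr \<gamma>)"
      using k unfolding d by (simp add: norm_mult power_mult_distrib powr_mult mult_ac flip: ennreal_mult')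
  qed
  also have "\<dots> = ennreal (k powr p) * deriv_energy p \<gamma> h"
    unfolding deriv_energy_def by (rule nn_integral_cmult[OF m])
  finally show ?thesis .
qed

text \<open>Both sides are homogeneous of degree \<open>p\<close>, so (c) extends from the unit sphere to all functions.\<close>

lemma deriv_energy_bound_scaled:
  assumes h: "h holomorphic_on ball 0 1" and \<alpha>: "\<alpha> \<ge> -1" and p: "p > 2" and C: "C \<ge> 0" and c: "c \<ge> 0"
    and N: "bergman_norm 2 \<alpha> h \<le> ennreal N" "N \<ge> 0"
    and h0: "\<And>j. j \<le> M \<Longrightarrow> (deriv ^^ j) h 0 = 0"
    and D: "\<And>f. f holomorphic_on ball 0 1 \<Longrightarrow> bergman_norm 2 \<alpha> f = 1 \<Longrightarrow> (\<forall>j\<le>M. (deriv ^^ j) f 0 = 0) \<Longrightarrow> ennreal c * deriv_energy p \<gamma> f \<le> ennreal (C powr p)"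
  shows "ennreal c * deriv_energy p \<gamma> h \<le> ennreal ((C * N) powr p)"
proof (cases "bergman_norm 2 \<alpha> h = 0")
  case True
  have z: "h z = 0" if "z \<in> ball 0 1" for z using eq_0_if_bergman_norm_eq_0[OF h \<alpha> True that] .
  have d: "deriv h z = 0" if "z \<in> ball 0 1" for z
  proof -
    have "\<forall>\<^sub>F w in nhds z. h w = 0"
      using z that by (intro eventually_nhds_in_open[of "ball 0 1" z, THEN eventually_mono]) auto
    then have "deriv h z = deriv (\<lambda>_. 0) z" by (rule deriv_cong_ev) simp
    then show ?thesis by simp
  qed
  have "deriv_energy p \<gamma> h = (\<integral>\<^sup>+ z. 0 \<partial>disk_area)"
    unfolding deriv_energy_def by (intro nn_integral_cong) (simp add: d space_disk_area)
  then show ?thesis by simp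
next
  case False
  obtain m where m: "bergman_norm 2 \<alpha> h = ennreal m" "m \<ge> 0"
    using N by (cases "bergman_norm 2 \<alpha> h") (auto simp: top_unique)
  have m0: "m > 0" "m \<le> N" using False m N by (auto simp: less_le)
  let ?k = "\<lambda>z. of_real (1 / m) * h z"
  have k: "?k holomorphic_on ball 0 1" using h by (intro holomorphic_intros)
  have kn: "bergman_norm 2 \<alpha> ?k = 1"
    using bergman_norm_2_cmult[OF h, of "1 / m" \<alpha>] m m0 by (simp flip: ennreal_mult)
  have k0: "\<forall>j\<le>M. (deriv ^^ j) ?k 0 = 0"
  proof (intro allI impI)
    fix j assume "j \<le> M"
    have "(deriv ^^ j) ?k 0 = of_real (1 / m) * (deriv ^^ j) h 0"
      by (rule higher_deriv_cmult[OF h]) auto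
    then show "(deriv ^^ j) ?k 0 = 0" unfolding h0[OF \<open>j \<le> M\<close>] by simp
  qed
  have "h = (\<lambda>z. of_real m * ?k z)" using m0 by (auto simp: fun_eq_iff)
  then have "deriv_energy p \<gamma> h = ennreal (m powr p) * deriv_energy p \<gamma> ?k"
    using deriv_energy_cmult[OF k m0(1) p] by metis
  then have "ennreal c * deriv_energy p \<gamma> h = ennreal (m powr p) * (ennreal c * deriv_energy p \<gamma> ?k)" by (simp add: mult_ac)
  also have "\<dots> \<le> ennreal (m powr p) * ennreal (C powr p)" by (intro mult_left_mono D k kn k0) simp
  also have "\<dots> = ennreal ((C * m) powr p)" using C m0 by (simp add: powr_mult mult.commute flip: ennreal_mult)
  also have "\<dots> \<le> ennreal ((C * N) powr p)" using C m0 p by (intro ennreal_leI powr_mono2 mult_left_mono) auto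
  finally show ?thesis .
qed

text \<open>The factor \<open>(1 - a\<^sup>2) powr (s / 2)\<close> shows that the transforms tend to \<open>0\<close> locally uniformly as \<open>a\<close> tends
  to \<open>1\<close>.\<close>

lemma mob_transform_bound:
  assumes a: "0 \<le> a" "a < 1" and z: "cmod z \<le> r" "r < 1" and s: "s \<ge> 0"
    and B: "\<And>w. w \<in> ball 0 1 \<Longrightarrow> cmod (f w) \<le> B"
  shows "cmod (mob_transform a s f z) \<le> B * (1 - a\<^sup>2) powr (s / 2) * (1 / (1 - r)\<^sup>2) powr (s / 2)"
proof -
  have a1: "\<bar>a\<bar> < 1" using a by simp
  have a2: "0 \<le> 1 - a\<^sup>2" using a1 by (simp add: abs_square_le_1)
  have "cmod (of_real a * z) \<le> 1 * r"
    unfolding norm_mult using a z by (intro mult_mono) auto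
  then have "1 - r \<le> cmod (1 - of_real a * z)" using norm_triangle_ineq2[of 1 "of_real a * z"] by simp
  then have "(1 - r)\<^sup>2 \<le> (cmod (1 - of_real a * z))\<^sup>2" using z by (intro power_mono) auto
  then have "(1 - a\<^sup>2) / (cmod (1 - of_real a * z))\<^sup>2 \<le> (1 - a\<^sup>2) / (1 - r)\<^sup>2"
    using a2 z by (intro divide_left_mono mult_pos_pos) (auto intro: less_le_trans[rotated])
  then have "cmod (mob_weight a s z) \<le> ((1 - a\<^sup>2) / (1 - r)\<^sup>2) powr (s / 2)"
    using norm_mob_weight[OF a1, of z s] z a2 s by (auto intro!: powr_mono2)
  also have "\<dots> = (1 - a\<^sup>2) powr (s / 2) * (1 / (1 - r)\<^sup>2) powr (s / 2)"
    using a2 by (simp add: powr_divide)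
  finally have w: "cmod (mob_weight a s z) \<le> \<dots>" .
  have "mob a z \<in> ball 0 1" using mob_in_ball[OF a1, of z] z by simp
  from mult_mono[OF B[OF this] w] B[OF this] norm_ge_zero[of "f (mob a z)"]
  show ?thesis by (simp add: mob_transform_def norm_mult mult.assoc)
qed

lemma circle_mean_const: "circle_mean (\<lambda>_. c) y = c"
proof -
  have "(\<integral>\<^sup>+t\<in>{0..2 * pi}. c \<partial>lborel) = c * ennreal (2 * pi)"
    by (subst nn_integral_cmult_indicator) simp_all
  then have "circle_mean (\<lambda>_. c) y = c * (ennreal (1 / (2 * pi)) * ennreal (2 * pi))"
    by (simp add: circle_mean_def mult.left_commute)
  also have "ennreal (1 / (2 * pi)) * ennreal (2 * pi) = 1" by (simp flip: ennreal_mult)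
  finally show ?thesis by simp
qed

text \<open>The main step of (c) \<open>\<Longrightarrow>\<close> (a), for a polynomial \<open>P\<close>. The parameter \<open>s\<close> has two roles: it is the distance
  from the boundary in \<open>Bergman_norm_upper_bound\<close> and the weight in \<open>bergman_pow_add_le\<close>. For fixed \<open>s\<close>
  let \<open>a\<close> tend to \<open>1\<close>; all terms except the one with \<open>E\<close> contain \<open>\<delta> a\<close>, which tends to \<open>0\<close>.\<close>

lemma power_norm_bound_with_loss:
  fixes P :: "complex poly"
  assumes \<alpha>: "\<alpha> \<ge> -1" and p: "p > 2" and \<gamma>: "\<gamma> = p / 2 * (\<alpha> + 2)" and s: "0 < s" "s < 1" and E: "E \<ge> 0"
    and D: "\<And>h. h holomorphic_on ball 0 1 \<Longrightarrow> bergman_norm 2 \<alpha> h \<le> bergman_norm 2 \<alpha> (poly P) \<Longrightarrow>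
        (\<And>j. j \<le> M \<Longrightarrow> (deriv ^^ j) h 0 = 0) \<Longrightarrow> ennreal (p / (2 * (\<alpha> + 2))) * deriv_energy p \<gamma> h \<le> ennreal E"
  shows "bergman_pow p \<gamma> (poly P) \<le> ennreal ((1 - s) powr (- p) * (exp (2 * s) * E))"
proof -
  have \<gamma>1: "\<gamma> > 1" using critical_exponent_gt_1[OF p \<alpha>] \<gamma> by simp
  have "compact (poly P ` cball 0 1)" by (intro compact_continuous_image continuous_intros) auto
  then obtain B where B: "B > 0" "\<And>w. w \<in> cball 0 1 \<Longrightarrow> cmod (poly P w) \<le> B"
    by (metis bounded_pos compact_imp_bounded imageI)
  define r where "r = exp (- (s / 2))"
  have r: "r < 1" using s by (simp add: r_def)
  define \<delta> where "\<delta> a = B * (1 - a\<^sup>2) powr ((\<alpha> + 2) / 2)" for a :: real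
  define Kr where "Kr = (1 / (1 - r)\<^sup>2) powr ((\<alpha> + 2) / 2)"
  \<comment> \<open>Cauchy estimates on the circle of radius \<open>1/2\<close> bound the Taylor polynomial\<close>
  define K2 where "K2 = (1 / (1 - 1 / 2)\<^sup>2 :: real) powr ((\<alpha> + 2) / 2)"
  define K3 where "K3 = (\<Sum>k\<le>M. K2 / (1 / 2) ^ k)"
  have K: "Kr \<ge> 0" "K2 \<ge> 0" "K3 \<ge> 0" by (auto simp: Kr_def K2_def K3_def intro!: sum_nonneg)
  have P: "poly P holomorphic_on ball 0 1" by (intro holomorphic_intros)
  have est: "bergman_pow p \<gamma> (poly P) \<le> ennreal ((1 - s) powr (- p) * (exp (2 * s) * E + 2 * (\<delta> a * (Kr + K3)) powr p) + s powr (- p) * (\<delta> a * K3) powr p)"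
    if a: "0 < a" "a < 1" for a
  proof -
    have a1: "\<bar>a\<bar> < 1" using a by simp
    have \<delta>0: "\<delta> a \<ge> 0" using B by (simp add: \<delta>_def)
    define g where "g = mob_transform a (\<alpha> + 2) (poly P)"
    define T where "T = taylor_poly g M"
    define h where "h z = g z - poly T z" for z
    have g: "g holomorphic_on ball 0 1" unfolding g_def by (rule mob_transform_holomorphic[OF a1 P])
    have T: "poly T holomorphic_on ball 0 1" by (intro holomorphic_intros)
    have h: "h holomorphic_on ball 0 1" unfolding h_def using g by (intro holomorphic_intros)
    have gb: "cmod (g z) \<le> \<delta> a * (1 / (1 - q)\<^sup>2) powr ((\<alpha> + 2) / 2)" if "cmod z \<le> q" "q < 1" for z q
      unfolding g_def \<delta>_def using a B that \<alpha> by (intro mob_transform_bound) auto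
    have Tb: "cmod (poly T z) \<le> \<delta> a * K3" if z: "cmod z \<le> 1" for z
    proof -
      have co: "cmod ((deriv ^^ k) g 0 / fact k) \<le> \<delta> a * K2 / (1 / 2) ^ k" for k
      proof -
        have "cmod ((deriv ^^ k) g 0) \<le> fact k * (\<delta> a * K2) / (1 / 2) ^ k"
        proof (rule Cauchy_inequality)
          have sub: "cball 0 (1 / 2) \<subseteq> ball (0 :: complex) 1" by (simp add: cball_subset_ball_iff)
          show "g holomorphic_on ball 0 (1 / 2)" using holomorphic_on_subset[OF g] sub ball_subset_cball by blast
          show "continuous_on (cball 0 (1 / 2)) g" using holomorphic_on_subset[OF g sub] by (rule holomorphic_on_imp_continuous_on)
          show "cmod (g x) \<le> \<delta> a * K2" if "cmod (0 - x) = 1 / 2" for x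
            using gb[of x "1 / 2"] that by (simp add: K2_def)
        qed simp
        then show ?thesis by (simp add: norm_divide field_simps)
      qed
      have "cmod (poly T z) \<le> (\<Sum>k\<le>M. cmod ((deriv ^^ k) g 0 / fact k * z ^ k))"
        unfolding T_def poly_taylor_poly by (rule norm_sum)
      also have "\<dots> \<le> (\<Sum>k\<le>M. \<delta> a * K2 / (1 / 2) ^ k * 1)"
        unfolding norm_mult using \<delta>0 K z by (intro sum_mono mult_mono co) (auto simp: norm_power power_le_one)
      also have "\<dots> = \<delta> a * K3" by (simp add: K3_def sum_distrib_left)
      finally show ?thesis .
    qed
    have hn: "bergman_norm 2 \<alpha> h \<le> bergman_norm 2 \<alpha> (poly P)"
    proof -
      have "bergman_norm 2 \<alpha> h \<le> bergman_norm 2 \<alpha> g"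
        unfolding h_def T_def using h[unfolded h_def T_def]
        by (intro bergman_norm_2_mono circle_int_taylor_le(2) g) auto
      also have "\<dots> \<le> bergman_norm 2 \<alpha> (poly P)"
        unfolding g_def by (rule bergman_norm_2_mob_transform_le[OF a1 \<alpha>])
      finally show ?thesis .
    qed
    have h0: "(deriv ^^ j) h 0 = 0" if "j \<le> M" for j
      using higher_deriv_taylor_remainder[OF g that] by (simp add: h_def[abs_def] T_def)
    have hcirc: "circle_mean (\<lambda>z. ennreal (cmod (h z) powr p)) (s / 2) \<le> ennreal ((\<delta> a * (Kr + K3)) powr p)"
    proof -
      have "circle_mean (\<lambda>z. ennreal (cmod (h z) powr p)) (s / 2) \<le> circle_mean (\<lambda>_. ennreal ((\<delta> a * (Kr + K3)) powr p)) (s / 2)"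
      proof (rule circle_mean_mono)
        fix z assume "cmod z = exp (- (s / 2))"
        then have z: "cmod z = r" by (simp add: r_def)
        have "cmod (h z) \<le> cmod (g z) + cmod (poly T z)" unfolding h_def by (rule norm_triangle_ineq4)
        also have "\<dots> \<le> \<delta> a * Kr + \<delta> a * K3"
          using gb[of z r] Tb[of z] z r by (intro add_mono) (auto simp: Kr_def)
        finally show "ennreal (cmod (h z) powr p) \<le> ennreal ((\<delta> a * (Kr + K3)) powr p)"
          using p by (intro ennreal_leI powr_mono2) (auto simp: distrib_left)
      qed
      then show ?thesis by (simp add: circle_mean_const)
    qed
    have "bergman_pow p \<gamma> h \<le> ennreal (exp (2 * s)) * (ennreal (p / (2 * (\<alpha> + 2))) * deriv_energy p \<gamma> h)
         + 2 * circle_mean (\<lambda>z. ennreal (cmod (h z) powr p)) (s / 2)"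
      using h0[of 0] by (intro Bergman_norm_upper_bound[OF h _ p \<alpha> \<gamma> s(1)]) simp
    also have "\<dots> \<le> ennreal (exp (2 * s)) * ennreal E + 2 * ennreal ((\<delta> a * (Kr + K3)) powr p)"
      by (intro add_mono mult_left_mono D h hn h0 hcirc) auto
    also have "\<dots> = ennreal (exp (2 * s) * E + 2 * (\<delta> a * (Kr + K3)) powr p)"
      using E by (simp add: ennreal_mult)
    finally have Qh: "bergman_pow p \<gamma> h \<le> \<dots>" .
    have "bergman_pow p \<gamma> (poly T) \<le> bergman_pow p \<gamma> (\<lambda>_. of_real (\<delta> a * K3))"
      using p Tb \<delta>0 K by (intro bergman_pow_mono) (auto simp del: of_real_mult)
    also have "\<dots> = ennreal ((\<delta> a * K3) powr p)"
      using bergman_pow_const[OF p \<gamma>1] \<delta>0 K by (simp del: of_real_mult)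
    finally have QT: "bergman_pow p \<gamma> (poly T) \<le> \<dots>" .
    have "bergman_pow p \<gamma> (poly P) = bergman_pow p \<gamma> g"
      unfolding bergman_pow_def g_def
      by (subst weighted_integral_mob_transform[OF a1 P]) (use p in \<open>simp_all add: \<gamma>\<close>)
    also have "g = (\<lambda>z. h z + poly T z)" by (simp add: h_def)
    also have "bergman_pow p \<gamma> (\<lambda>z. h z + poly T z) \<le> ennreal ((1 - s) powr (- p)) * bergman_pow p \<gamma> h + ennreal (s powr (- p)) * bergman_pow p \<gamma> (poly T)"
      using p by (intro bergman_pow_add_le h T s) auto
    also have "\<dots> \<le> ennreal ((1 - s) powr (- p)) * ennreal (exp (2 * s) * E + 2 * (\<delta> a * (Kr + K3)) powr p) + ennreal (s powr (- p)) * ennreal ((\<delta> a * K3) powr p)"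
      by (intro add_mono mult_left_mono Qh QT) auto
    also have "\<dots> = ennreal ((1 - s) powr (- p) * (exp (2 * s) * E + 2 * (\<delta> a * (Kr + K3)) powr p) + s powr (- p) * (\<delta> a * K3) powr p)"
      using E by (simp flip: ennreal_mult ennreal_plus)
    finally show ?thesis .
  qed
  show ?thesis
  proof (rule tendsto_lowerbound)
    let ?R = "\<lambda>a. (1 - s) powr (- p) * (exp (2 * s) * E + 2 * (\<delta> a * (Kr + K3)) powr p) + s powr (- p) * (\<delta> a * K3) powr p"
    have c\<delta>: "continuous_on {0..1} \<delta>"
      unfolding \<delta>_def[abs_def] using \<alpha> by (intro continuous_intros continuous_on_powr') (auto simp: abs_square_le_1 power_le_one)
    have \<delta>0: "0 \<le> \<delta> a" for a using B by (simp add: \<delta>_def)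
    have "continuous_on {0..1} (\<lambda>a. (\<delta> a * k) powr p)" if "k \<ge> 0" for k
      using that \<delta>0 p by (intro continuous_on_powr' continuous_on_mult c\<delta> continuous_on_const) auto
    then have "continuous_on {0..1} ?R"
      using K by (intro continuous_on_add continuous_on_mult continuous_on_const) auto
    then have "(?R \<longlongrightarrow> ?R 1) (at 1 within {0..1})"
      unfolding continuous_on by (rule bspec) simp
    moreover have "?R 1 = (1 - s) powr (- p) * (exp (2 * s) * E)" using \<alpha> by (simp add: \<delta>_def)
    ultimately have "(?R \<longlongrightarrow> (1 - s) powr (- p) * (exp (2 * s) * E)) (at_left 1)"
      by (simp add: at_within_Icc_at_left)
    then show "((\<lambda>a. ennreal (?R a)) \<longlongrightarrow> ennreal ((1 - s) powr (- p) * (exp (2 * s) * E))) (at_left 1)"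
      by (rule tendsto_ennrealI)
    have "\<forall>\<^sub>F a in at_left 1. a \<in> {0<..<1::real}" by (rule eventually_at_left_real) simp
    then show "\<forall>\<^sub>F a in at_left 1. bergman_pow p \<gamma> (poly P) \<le> ennreal (?R a)"
      by eventually_elim (rule est; simp)
  qed simp
qed

lemma power_norm_bound_polynomial:
  fixes P :: "complex poly"
  assumes \<alpha>: "\<alpha> \<ge> -1" and p: "p > 2" and \<gamma>: "\<gamma> = p / 2 * (\<alpha> + 2)" and E: "E \<ge> 0"
    and D: "\<And>h. h holomorphic_on ball 0 1 \<Longrightarrow> bergman_norm 2 \<alpha> h \<le> bergman_norm 2 \<alpha> (poly P) \<Longrightarrow>
        (\<And>j. j \<le> M \<Longrightarrow> (deriv ^^ j) h 0 = 0) \<Longrightarrow> ennreal (p / (2 * (\<alpha> + 2))) * deriv_energy p \<gamma> h \<le> ennreal E"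
  shows "bergman_pow p \<gamma> (poly P) \<le> ennreal E"
proof (rule tendsto_lowerbound)
  have "((\<lambda>s. (1 - s) powr (- p) * (exp (2 * s) * E)) \<longlongrightarrow> (1 - 0) powr (- p) * (exp (2 * 0) * E)) (at_right 0)"
    by (intro tendsto_intros) auto
  then show "((\<lambda>s. ennreal ((1 - s) powr (- p) * (exp (2 * s) * E))) \<longlongrightarrow> ennreal E) (at_right 0)"
    by (intro tendsto_ennrealI) simp
  have "\<forall>\<^sub>F s in at_right 0. s \<in> {0<..<1::real}" by (rule eventually_at_right_real) simp
  then show "\<forall>\<^sub>F s in at_right 0. bergman_pow p \<gamma> (poly P) \<le> ennreal ((1 - s) powr (- p) * (exp (2 * s) * E))"
    by eventually_elim (rule power_norm_bound_with_loss[OF \<alpha> p \<gamma> _ _ E D]; simp)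
qed simp

text \<open>Fatou's lemma, since the Taylor polynomials converge pointwise on the disk.\<close>

lemma bergman_pow_taylor_liminf:
  assumes f: "f holomorphic_on ball 0 1" and p: "p > 0" and le: "\<And>n. bergman_pow p \<gamma> (poly (taylor_poly f n)) \<le> K"
  shows "bergman_pow p \<gamma> f \<le> K"
proof -
  let ?F = "\<lambda>f z. ennreal ((1 - (cmod z)\<^sup>2) powr (\<gamma> - 2) * cmod (f z) powr p)"
  have T: "poly (taylor_poly f n) holomorphic_on ball 0 1" for n by (intro holomorphic_intros)
  have lim: "(\<lambda>n. ?F (poly (taylor_poly f n)) z) \<longlonglongrightarrow> ?F f z" if z: "z \<in> ball 0 1" for z
  proof -
    have "(\<lambda>n. (deriv ^^ n) f 0 / fact n * (z - 0) ^ n) sums f z"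
      by (rule holomorphic_power_series[OF f z])
    then have "(\<lambda>n. poly (taylor_poly f n) z) \<longlonglongrightarrow> f z"
      unfolding poly_taylor_poly by (simp add: sums_def_le)
    then show ?thesis
      using p by (intro tendsto_ennrealI tendsto_intros tendsto_powr') auto
  qed
  let ?G = "\<lambda>f z. ennreal (\<gamma> - 1) * ?F f z"
  have eq: "bergman_pow p \<gamma> h = (\<integral>\<^sup>+z. ?G h z \<partial>disk_area)" if "h holomorphic_on ball 0 1" for h
    unfolding bergman_pow_def by (rule nn_integral_cmult[symmetric, OF measurable_disk_area_power[OF that p]])
  have limG: "(\<lambda>n. ?G (poly (taylor_poly f n)) z) \<longlonglongrightarrow> ?G f z" if "z \<in> ball 0 1" for z
    by (intro ennreal_tendsto_cmult lim[OF that]) simp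
  have "bergman_pow p \<gamma> f = (\<integral>\<^sup>+z. liminf (\<lambda>n. ?G (poly (taylor_poly f n)) z) \<partial>disk_area)"
    unfolding eq[OF f]
    by (intro nn_integral_cong lim_imp_Liminf[symmetric] limG) (auto simp: space_disk_area)
  also have "\<dots> \<le> liminf (\<lambda>n. \<integral>\<^sup>+z. ?G (poly (taylor_poly f n)) z \<partial>disk_area)"
    by (intro nn_integral_liminf borel_measurable_times_ennreal borel_measurable_const measurable_disk_area_power T p)
  also have "\<dots> = liminf (\<lambda>n. bergman_pow p \<gamma> (poly (taylor_poly f n)))"
    by (simp only: eq[OF T])
  also have "\<dots> \<le> K"
    using le by (intro Liminf_le) auto
  finally show ?thesis .
qed

theorem theorem2p2:
  fixes \<alpha> p C :: real
  assumes "\<alpha> \<ge> -1" and "p > 2" and "C \<ge> 1"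
  defines "A \<equiv>
     (\<forall>f\<in>bergman_space 2 \<alpha>.
        bergman_norm p (p / 2 * (\<alpha> + 2) - 2) f \<le> ennreal C * bergman_norm 2 \<alpha> f)"
  defines "B \<equiv>
     (\<forall>f\<in>bergman_space 2 \<alpha>. bergman_norm 2 \<alpha> f = 1 \<longrightarrow>
        ennreal (cmod (f 0) powr p) + ennreal (p / 2) *
          (\<integral>\<^sup>+ z. ennreal ((cmod (deriv f z))\<^sup>2 * cmod (f z) powr (p - 2) *
                          (1 - (cmod z)\<^sup>2) powr (p * (\<alpha> + 2) / 2)) *
                 (\<integral>\<^sup>+ s\<in>{0..1}. ennreal (s powr (\<alpha> + 1) / (1 - (1 - (cmod z)\<^sup>2) * s)) \<partial>lborel)
             \<partial>disk_area)
        \<le> ennreal (C powr p))"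
  defines "D \<equiv>
     (\<exists>M::nat. M > 0 \<and>
       (\<forall>f\<in>bergman_space 2 \<alpha>.
          bergman_norm 2 \<alpha> f = 1 \<and> (\<forall>j\<le>M. (deriv ^^ j) f 0 = 0) \<longrightarrow>
          ennreal (p / (2 * (\<alpha> + 2))) *
            (\<integral>\<^sup>+ z. ennreal ((cmod (deriv f z))\<^sup>2 * cmod (f z) powr (p - 2) *
                            (1 - (cmod z)\<^sup>2) powr (p * (\<alpha> + 2) / 2)) \<partial>disk_area)
          \<le> ennreal (C powr p)))"
  shows "(A \<longleftrightarrow> B) \<and> (B \<longleftrightarrow> D)"
proof -
  note \<alpha> = assms(1) and p = assms(2)
  have C: "C \<ge> 0" using assms(3) by simp
  define \<gamma> where "\<gamma> = p / 2 * (\<alpha> + 2)"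
  have \<gamma>': "p * (\<alpha> + 2) / 2 = \<gamma>" by (simp add: \<gamma>_def)
  have \<gamma>1: "\<gamma> > 1" using critical_exponent_gt_1[OF p \<alpha>] by (simp add: \<gamma>_def)
  have AB: "B" if A: "A"
    unfolding B_def
  proof (intro ballI impI)
    fix f assume f: "f \<in> bergman_space 2 \<alpha>" and n: "bergman_norm 2 \<alpha> f = 1"
    have fh: "f holomorphic_on ball 0 1" using f by (simp add: bergman_space_def)
    have "bergman_norm p (p / 2 * (\<alpha> + 2) - 2) f \<le> ennreal C * bergman_norm 2 \<alpha> f"
      using A f unfolding A_def by blast
    then have "bergman_norm p (\<gamma> - 2) f \<le> ennreal C" unfolding n \<gamma>_def by simp
    then have "ennpowr (bergman_pow p \<gamma> f) (1 / p) \<le> ennreal C" unfolding bergman_norm_eq_pow[OF \<gamma>1] .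
    then have "bergman_pow p \<gamma> f \<le> ennreal (C powr p)" using p C by (simp add: ennpowr_le_iff)
    with Bergman_norm_lower_bound[OF fh p \<alpha> \<gamma>_def]
    show "ennreal (cmod (f 0) powr p) + ennreal (p / 2) *
          (\<integral>\<^sup>+ z. ennreal ((cmod (deriv f z))\<^sup>2 * cmod (f z) powr (p - 2) *
                          (1 - (cmod z)\<^sup>2) powr (p * (\<alpha> + 2) / 2)) *
                 kernel_b \<alpha> (1 - (cmod z)\<^sup>2)
             \<partial>disk_area)
        \<le> ennreal (C powr p)"
      unfolding \<gamma>' by (rule order_trans)
  qed
  have BD: "D" if B: "B"
    unfolding D_def
  proof (intro exI[of _ 1] conjI ballI impI)
    fix f assume f: "f \<in> bergman_space 2 \<alpha>" and n: "bergman_norm 2 \<alpha> f = 1 \<and> (\<forall>j\<le>1. (deriv ^^ j) f 0 = 0)"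
    let ?u = "\<lambda>z. ennreal ((cmod (deriv f z))\<^sup>2 * cmod (f z) powr (p - 2) * (1 - (cmod z)\<^sup>2) powr (p * (\<alpha> + 2) / 2))"
    let ?k = "\<lambda>z. kernel_b \<alpha> (1 - (cmod z)\<^sup>2)"
    have fh: "f holomorphic_on ball 0 1" using f by (simp add: bergman_space_def)
    have k1: "ennreal (1 / (\<alpha> + 2)) * (\<integral>\<^sup>+ z. ?u z \<partial>disk_area) \<le> (\<integral>\<^sup>+ z. ?u z * ?k z \<partial>disk_area)"
    proof -
      have "(\<integral>\<^sup>+ z. ?u z * ennreal (1 / (\<alpha> + 2)) \<partial>disk_area) \<le> (\<integral>\<^sup>+ z. ?u z * ?k z \<partial>disk_area)"
        using kernel_lower_bound[OF \<alpha>] by (intro nn_integral_mono mult_left_mono) (auto simp: space_disk_area abs_square_le_1)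
      moreover have "ennreal (1 / (\<alpha> + 2)) * (\<integral>\<^sup>+ z. ?u z \<partial>disk_area) = (\<integral>\<^sup>+ z. ?u z * ennreal (1 / (\<alpha> + 2)) \<partial>disk_area)"
        using nn_integral_multc[OF measurable_deriv_energy[OF fh p, of \<gamma>], of "ennreal (1 / (\<alpha> + 2))"]
        unfolding \<gamma>' by (simp add: mult.commute)
      ultimately show ?thesis by simp
    qed
    have "ennreal (p / (2 * (\<alpha> + 2))) * (\<integral>\<^sup>+ z. ?u z \<partial>disk_area) = ennreal (p / 2) * (ennreal (1 / (\<alpha> + 2)) * (\<integral>\<^sup>+ z. ?u z \<partial>disk_area))"
      using p \<alpha> by (simp add: mult.assoc[symmetric] flip: ennreal_mult)
    also have "\<dots> \<le> ennreal (p / 2) * (\<integral>\<^sup>+ z. ?u z * ?k z \<partial>disk_area)"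
      by (rule mult_left_mono[OF k1]) simp
    also have "\<dots> \<le> ennreal (cmod (f 0) powr p) + ennreal (p / 2) * (\<integral>\<^sup>+ z. ?u z * ?k z \<partial>disk_area)"
      by (rule add_increasing[OF zero_le order_refl])
    also have "\<dots> \<le> ennreal (C powr p)" using B f n unfolding B_def by blast
    finally show "ennreal (p / (2 * (\<alpha> + 2))) * (\<integral>\<^sup>+ z. ?u z \<partial>disk_area) \<le> ennreal (C powr p)" .
  qed simp
  have DA: "A" if D: "D"
    unfolding A_def
  proof (intro ballI)
    fix f assume f: "f \<in> bergman_space 2 \<alpha>"
    have fh: "f holomorphic_on ball 0 1" using f by (simp add: bergman_space_def)
    obtain N where N: "bergman_norm 2 \<alpha> f = ennreal N" "N \<ge> 0"
      using f by (cases "bergman_norm 2 \<alpha> f") (auto simp: bergman_space_def)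
    obtain M where M0: "\<forall>f\<in>bergman_space 2 \<alpha>. bergman_norm 2 \<alpha> f = 1 \<and> (\<forall>j\<le>M. (deriv ^^ j) f 0 = 0) \<longrightarrow>
        ennreal (p / (2 * (\<alpha> + 2))) * deriv_energy p \<gamma> f \<le> ennreal (C powr p)"
      using D unfolding D_def \<gamma>' deriv_energy_def[symmetric] by blast
    have M: "ennreal (p / (2 * (\<alpha> + 2))) * deriv_energy p \<gamma> f \<le> ennreal (C powr p)"
      if "f holomorphic_on ball 0 1" "bergman_norm 2 \<alpha> f = 1" "\<forall>j\<le>M. (deriv ^^ j) f 0 = 0" for f
    proof -
      have "f \<in> bergman_space 2 \<alpha>" using that by (simp add: bergman_space_def)
      then show ?thesis using M0 that by blast
    qed
    have "bergman_pow p \<gamma> f \<le> ennreal ((C * N) powr p)"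
    proof (rule bergman_pow_taylor_liminf[OF fh])
      fix n
      have le: "bergman_norm 2 \<alpha> (poly (taylor_poly f n)) \<le> ennreal N"
        unfolding N(1)[symmetric] by (intro bergman_norm_2_mono circle_int_taylor_le(1) fh holomorphic_intros)
      show "bergman_pow p \<gamma> (poly (taylor_poly f n)) \<le> ennreal ((C * N) powr p)"
      proof (rule power_norm_bound_polynomial[OF \<alpha> p \<gamma>_def, of _ _ M])
        fix h assume "h holomorphic_on ball 0 1" "bergman_norm 2 \<alpha> h \<le> bergman_norm 2 \<alpha> (poly (taylor_poly f n))"
          "\<And>j. j \<le> M \<Longrightarrow> (deriv ^^ j) h 0 = 0"
        then show "ennreal (p / (2 * (\<alpha> + 2))) * deriv_energy p \<gamma> h \<le> ennreal ((C * N) powr p)"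
          using le p \<alpha> by (intro deriv_energy_bound_scaled[OF _ \<alpha> p C _ _ N(2) _ M]) (auto intro: order_trans)
      qed simp
    qed (use p in simp)
    then have "ennpowr (bergman_pow p \<gamma> f) (1 / p) \<le> ennreal (C * N)"
      using p C N by (simp add: ennpowr_le_iff)
    then show "bergman_norm p (p / 2 * (\<alpha> + 2) - 2) f \<le> ennreal C * bergman_norm 2 \<alpha> f"
      unfolding \<gamma>_def[symmetric] bergman_norm_eq_pow[OF \<gamma>1] N(1) using C N(2) by (simp add: ennreal_mult)
  qed
  show ?thesis using AB BD DA by blast
qed

end
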